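(* Let $f=(f_1,\ldots,f_m)$ be a contractive free holomorphic function with $\|f(0)\|<1$ such that the boundary functions $\widetilde f_1,\ldots,\widetilde f_m$ are in the noncommutative disc algebra $\mathcal A_n$. If $(T_1,\ldots,T_n)\in B(\mathcal H)^n$ is of class $\mathcal C_\rho$, $\rho>0$, then $f(T_1,\ldots,T_n)\in B(\mathcal H)^m$ is of class $\mathcal C_{\rho_f}$, where $$\rho_f:=\begin{cases}1+(\rho-1)\dfrac{1-\|f(0)\|}{1+\|f(0)\|}&\text{if }\rho<1,\\[2mm]1+(\rho-1)\dfrac{1+\|f(0)\|}{1-\|f(0)\|}&\text{if }\rho\ge1.\end{cases}$$
   Context: Let $n,m\ge1$, $\mathcal H$ a complex Hilbert space, $\mathcal K$ a separable infinite-dimensional Hilbert space. $\mathbb F_n^+$ is the unital free semigroup on generators $g_1,\ldots,g_n$ with identity $g_0$; $|\alpha|$ is the length of $\alpha$. $T_\alpha:=T_{i_1}\cdots T_{i_k}$ if $\alpha=g_{i_1}\cdots g_{i_k}$, $T_{g_0}:=I$. For any number $n$ of operators and $\rho>0$, $T\in B(\mathcal H)^n$ is of class $\mathcal C_\rho$ if there exist a Hilbert space $\mathcal G\supseteq\mathcal H$ and isometries $V_1,\ldots,V_n\in B(\mathcal G)$ with mutually orthogonal ranges such that $T_\alpha=\rho P_{\mathcal H}V_\alpha|_{\mathcal H}$ for all $\alpha\in\mathbb F_n^+\setminus\{g_0\}$. $[B(\mathcal K)^n]_1:=\{X\in B(\mathcal K)^n:\|\sum_iX_iX_i^*\|<1\}$.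 Each $f_j(X)=\sum_{k=0}^\infty\sum_{|\alpha|=k}a_\alpha^{(j)}X_\alpha$ ($a^{(j)}_\alpha\in\mathbb C$, $\limsup_k(\sum_{|\alpha|=k}|a_\alpha^{(j)}|^2)^{1/2k}\le1$) is a free holomorphic function on $[B(\mathcal K)^n]_1$; $f$ is contractive if the row operator $[f_1(X)\ \cdots\ f_m(X)]$ has norm at most $1$ for all $X\in[B(\mathcal K)^n]_1$. $f(0)=(f_1(0),\ldots,f_m(0))$ has norm the Euclidean norm in $\mathbb C^m$. $S_i\varphi:=e_i\otimes\varphi$ are the left creation operators on the full Fock space $F^2(H_n)=\mathbb C1\oplus\bigoplus_{k\ge1}H_n^{\otimes k}$ ($e_1,\ldots,e_n$ an orthonormal basis of the $n$-dimensional Hilbert space $H_n$), and $\mathcal A_n$ is the norm closed algebra generated by $S_1,\ldots,S_n,I$. The boundary function of $f_j$ is $\widetilde f_j=\lim_{r\to1}f_j(rS_1,\ldots,rS_n)$; the condition $\widetilde f_j\in\mathcal A_n$ means that this limit exists in operator norm. For $T\in\mathcal C_\rho$, $f(T)=(f_1(T),\ldots,f_m(T))$ with $f_j(T):=\lim_{r\to1}f_j(rT_1,\ldots,rT_n)$ in operator norm (the limit exists). *)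

theory Defs
  imports "HOL-Analysis.Analysis"
begin

section \<open>Complex Hilbert spaces\<close>

text \<open>The underlying real Hilbert space structure carries norm and topology; the complex inner
  product is linear in its first argument.\<close>

class complex_hilbert = real_inner + banach +
  fixes scaleC :: "complex \<Rightarrow> 'a \<Rightarrow> 'a"  (infixr "*\<^sub>C" 75)
    and cinner :: "'a \<Rightarrow> 'a \<Rightarrow> complex"
  assumes scaleC_add_right: "c *\<^sub>C (x + y) = c *\<^sub>C x + c *\<^sub>C y"
    and scaleC_add_left: "(c + d) *\<^sub>C x = c *\<^sub>C x + d *\<^sub>C x"
    and scaleC_scaleC: "c *\<^sub>C d *\<^sub>C x = (c * d) *\<^sub>C x"
    and scaleC_of_real: "complex_of_real r *\<^sub>C x = r *\<^sub>R x"
    and cinner_add_left: "cinner (x + y) z = cinner x z + cinner y z"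
    and cinner_scaleC_left: "cinner (c *\<^sub>C x) y = c * cinner x y"
    and cinner_commute: "cinner x y = cnj (cinner y x)"
    and Re_cinner: "Re (cinner x y) = inner x y"

interpretation complex_vector: vector_space "scaleC :: complex \<Rightarrow> 'a \<Rightarrow> 'a::complex_hilbert"
  by unfold_locales
    (auto simp: scaleC_add_right scaleC_add_left scaleC_scaleC scaleC_of_real[of 1, simplified])

lemma cinner_self: "cinner x x = complex_of_real ((norm x)\<^sup>2)"
  for x :: "'a::complex_hilbert"
proof -
  have "Im (cinner x x) = 0"
    using arg_cong[OF cinner_commute[of x x], of Im] by simp
  moreover have "Re (cinner x x) = (norm x)\<^sup>2"
    by (simp add: Re_cinner power2_norm_eq_inner)
  ultimately show ?thesis
    by (simp add: complex_eq_iff)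
qed

lemma norm_scaleC: "norm (c *\<^sub>C x) = cmod c * norm x"
  for x :: "'a::complex_hilbert"
proof -
  have "cinner (c *\<^sub>C x) (c *\<^sub>C x) = c * cnj (c * cinner x x)"
    by (metis cinner_commute cinner_scaleC_left)
  also have "\<dots> = (c * cnj c) * complex_of_real ((norm x)\<^sup>2)"
    by (simp add: cinner_self)
  also have "\<dots> = complex_of_real ((cmod c * norm x)\<^sup>2)"
    unfolding complex_norm_square[symmetric] by (simp add: power_mult_distrib)
  finally have "(norm (c *\<^sub>C x))\<^sup>2 = (cmod c * norm x)\<^sup>2"
    by (simp only: cinner_self of_real_eq_iff)
  then show ?thesis
    by simp
qed

lemma bounded_linear_scaleC: "bounded_linear (\<lambda>x::'a::complex_hilbert. c *\<^sub>C x)"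
proof (rule bounded_linear_intro[where K = "cmod c"])
  show "c *\<^sub>C (r *\<^sub>R x) = r *\<^sub>R c *\<^sub>C x" for r and x :: 'a
    by (simp add: scaleC_of_real[symmetric] scaleC_scaleC mult.commute)
qed (simp_all add: scaleC_add_right norm_scaleC)

definition separable_infinite_dim :: "'k::complex_hilbert itself \<Rightarrow> bool" where
  "separable_infinite_dim _ \<longleftrightarrow>
     (\<exists>D::'k set. countable D \<and> closure D = UNIV) \<and>
     \<not> (\<exists>B::'k set. finite B \<and> complex_vector.span B = UNIV)"


section \<open>Bounded operators\<close>

text \<open>The type \<open>'a \<Rightarrow>\<^sub>L 'b\<close> consists of the bounded real-linear maps, with the operator norm.
  \<open>complex_ops\<close> is the closed subspace $B(\mathcal H,\mathcal K)$ of the complex-linear ones.\<close>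

definition complex_ops :: "('a::complex_hilbert \<Rightarrow>\<^sub>L 'b::complex_hilbert) set" where
  "complex_ops = {A. \<forall>c x. blinfun_apply A (c *\<^sub>C x) = c *\<^sub>C blinfun_apply A x}"

definition scaleC_op ::
    "complex \<Rightarrow> ('a::complex_hilbert \<Rightarrow>\<^sub>L 'b::complex_hilbert) \<Rightarrow> ('a \<Rightarrow>\<^sub>L 'b)" where
  "scaleC_op c A = Blinfun (\<lambda>x. c *\<^sub>C x) o\<^sub>L A"

lemma scaleC_op_apply [simp]: "scaleC_op c A x = c *\<^sub>C A x"
  by (simp add: scaleC_op_def bounded_linear_Blinfun_apply[OF bounded_linear_scaleC])

definition cadjoint :: "('a::complex_hilbert \<Rightarrow>\<^sub>L 'b::complex_hilbert) \<Rightarrow> 'b \<Rightarrow> 'a" where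
  "cadjoint A = (THE B. \<forall>x y. cinner (A x) y = cinner x (B y))"

definition isometric_op :: "('a::complex_hilbert \<Rightarrow>\<^sub>L 'b::complex_hilbert) \<Rightarrow> bool" where
  "isometric_op A \<longleftrightarrow> A \<in> complex_ops \<and> (\<forall>x. norm (A x) = norm x)"

definition orth_proj :: "'a::complex_hilbert set \<Rightarrow> 'a \<Rightarrow> 'a" where
  "orth_proj M x = (THE p. p \<in> M \<and> (\<forall>y\<in>M. cinner (x - p) y = 0))"

text \<open>The free semigroup $\mathbb F_n^+$ is the type \<open>'n list\<close> of words, \<open>'n\<close> being a finite type
  with \<open>n\<close> elements, with \<open>[]\<close> for the identity $g_0$ and \<open>length\<close> for $|\alpha|$.\<close>

definition word_op :: "('n \<Rightarrow> 'a::complex_hilbert \<Rightarrow>\<^sub>L 'a) \<Rightarrow> 'n list \<Rightarrow> 'a \<Rightarrow>\<^sub>L 'a" where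
  "word_op X \<alpha> = foldr (\<lambda>i A. X i o\<^sub>L A) \<alpha> id_blinfun"


section \<open>The Hilbert space of square-summable families\<close>

typedef 'i ell2 = "{x :: 'i \<Rightarrow> complex. (\<lambda>i. (cmod (x i))\<^sup>2) summable_on UNIV}"
  by (rule exI[of _ "\<lambda>_. 0"]) simp

setup_lifting type_definition_ell2

lemma square_summable_add:
  fixes x y :: "'i \<Rightarrow> complex"
  assumes "(\<lambda>i. (cmod (x i))\<^sup>2) summable_on A" "(\<lambda>i. (cmod (y i))\<^sup>2) summable_on A"
  shows "(\<lambda>i. (cmod (x i + y i))\<^sup>2) summable_on A"
proof (rule summable_on_comparison_test)
  show "(\<lambda>i. 2 * (cmod (x i))\<^sup>2 + 2 * (cmod (y i))\<^sup>2) summable_on A"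
    by (intro summable_on_add summable_on_cmult_right assms)
  show "(cmod (x i + y i))\<^sup>2 \<le> 2 * (cmod (x i))\<^sup>2 + 2 * (cmod (y i))\<^sup>2" for i
  proof -
    have "(cmod (x i + y i))\<^sup>2 \<le> (cmod (x i) + cmod (y i))\<^sup>2"
      by (intro power_mono norm_triangle_ineq) simp
    also have "\<dots> \<le> 2 * (cmod (x i))\<^sup>2 + 2 * (cmod (y i))\<^sup>2"
      using zero_le_power2[of "cmod (x i) - cmod (y i)"]
      by (simp add: power2_sum power2_diff)
    finally show ?thesis .
  qed
qed simp

lemma square_summable_cmult:
  fixes x :: "'i \<Rightarrow> complex"
  assumes "(\<lambda>i. (cmod (x i))\<^sup>2) summable_on A"
  shows "(\<lambda>i. (cmod (c * x i))\<^sup>2) summable_on A"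
  using summable_on_cmult_right[OF assms, of "(cmod c)\<^sup>2"]
  by (simp add: norm_mult power_mult_distrib)

lemma square_summable_prod:
  fixes x y :: "'i \<Rightarrow> complex"
  assumes "(\<lambda>i. (cmod (x i))\<^sup>2) summable_on A" "(\<lambda>i. (cmod (y i))\<^sup>2) summable_on A"
  shows "(\<lambda>i. x i * cnj (y i)) summable_on A"
proof (rule abs_summable_summable, rule Infinite_Sum.abs_summable_on_comparison_test')
  show "(\<lambda>i. (cmod (x i))\<^sup>2 + (cmod (y i))\<^sup>2) summable_on A"
    by (intro summable_on_add assms)
  show "cmod (x i * cnj (y i)) \<le> (cmod (x i))\<^sup>2 + (cmod (y i))\<^sup>2" for i
  proof -
    have "2 * (cmod (x i) * cmod (y i)) \<le> (cmod (x i))\<^sup>2 + (cmod (y i))\<^sup>2"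
      using zero_le_power2[of "cmod (x i) - cmod (y i)"] by (simp add: power2_diff)
    moreover have "0 \<le> cmod (x i) * cmod (y i)"
      by simp
    ultimately show ?thesis
      unfolding norm_mult complex_mod_cnj by linarith
  qed
qed

lemma infsum_mult_cnj_self:
  fixes x :: "'i \<Rightarrow> complex"
  assumes "(\<lambda>i. (cmod (x i))\<^sup>2) summable_on A"
  shows "(\<Sum>\<^sub>\<infinity>i\<in>A. x i * cnj (x i)) = complex_of_real (\<Sum>\<^sub>\<infinity>i\<in>A. (cmod (x i))\<^sup>2)"
  unfolding complex_norm_square[symmetric]
  by (intro infsumI has_sum_of_real has_sum_infsum assms)

instantiation ell2 :: (type) real_inner
begin

lift_definition zero_ell2 :: "'a ell2" is "\<lambda>_. 0"
  by simp

lift_definition plus_ell2 :: "'a ell2 \<Rightarrow> 'a ell2 \<Rightarrow> 'a ell2" is "\<lambda>x y i. x i + y i"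
  by (rule square_summable_add)

lift_definition uminus_ell2 :: "'a ell2 \<Rightarrow> 'a ell2" is "\<lambda>x i. - x i"
  by simp

lift_definition minus_ell2 :: "'a ell2 \<Rightarrow> 'a ell2 \<Rightarrow> 'a ell2" is "\<lambda>x y i. x i - y i"
  subgoal for x y
    using square_summable_add[of x UNIV "\<lambda>i. - y i"] by simp
  done

lift_definition scaleR_ell2 :: "real \<Rightarrow> 'a ell2 \<Rightarrow> 'a ell2" is "\<lambda>r x i. complex_of_real r * x i"
  by (rule square_summable_cmult)

lift_definition inner_ell2 :: "'a ell2 \<Rightarrow> 'a ell2 \<Rightarrow> real" is
  "\<lambda>x y. Re (\<Sum>\<^sub>\<infinity>i. x i * cnj (y i))" .

definition norm_ell2 :: "'a ell2 \<Rightarrow> real" where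
  "norm_ell2 x = sqrt (inner x x)"

definition sgn_ell2 :: "'a ell2 \<Rightarrow> 'a ell2" where
  "sgn_ell2 x = inverse (norm x) *\<^sub>R x"

definition dist_ell2 :: "'a ell2 \<Rightarrow> 'a ell2 \<Rightarrow> real" where
  "dist_ell2 x y = norm (x - y)"

definition uniformity_ell2 :: "('a ell2 \<times> 'a ell2) filter" where
  "uniformity_ell2 = (INF e\<in>{0<..}. principal {(x, y). dist x y < e})"

definition open_ell2 :: "'a ell2 set \<Rightarrow> bool" where
  "open_ell2 U \<longleftrightarrow> (\<forall>x\<in>U. \<forall>\<^sub>F (x', y) in uniformity. x' = x \<longrightarrow> y \<in> U)"

lemma summable_ell2: "(\<lambda>i. (cmod (Rep_ell2 x i))\<^sup>2) summable_on UNIV"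
  using Rep_ell2[of x] by simp

lemma inner_self_ell2: "inner x x = (\<Sum>\<^sub>\<infinity>i. (cmod (Rep_ell2 x i))\<^sup>2)"
  by (simp add: inner_ell2.rep_eq infsum_mult_cnj_self[OF summable_ell2])

instance
proof
  fix x y z :: "'a ell2" and r s :: real
  show "x + y + z = x + (y + z)" "x + y = y + x" "0 + x = x" "- x + x = 0" "x - y = x + - y"
    by (transfer, simp add: algebra_simps)+
  show "r *\<^sub>R (x + y) = r *\<^sub>R x + r *\<^sub>R y" "(r + s) *\<^sub>R x = r *\<^sub>R x + s *\<^sub>R x"
    "r *\<^sub>R s *\<^sub>R x = (r * s) *\<^sub>R x" "1 *\<^sub>R x = x"
    by (transfer, simp add: algebra_simps)+
  show "inner x y = inner y x"
  proof transfer
    fix x y :: "'a \<Rightarrow> complex"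
    have "(\<Sum>\<^sub>\<infinity>i. y i * cnj (x i)) = cnj (\<Sum>\<^sub>\<infinity>i. x i * cnj (y i))"
      unfolding infsum_cnj[symmetric] by (simp add: mult.commute del: infsum_cnj)
    then show "Re (\<Sum>\<^sub>\<infinity>i. x i * cnj (y i)) = Re (\<Sum>\<^sub>\<infinity>i. y i * cnj (x i))"
      by simp
  qed
  show "inner (x + y) z = inner x z + inner y z"
    by transfer (simp add: distrib_right infsum_add square_summable_prod)
  show "inner (r *\<^sub>R x) y = r * inner x y"
    by transfer (simp add: mult.assoc infsum_cmult_right')
  show "0 \<le> inner x x"
    by (simp add: inner_self_ell2 infsum_nonneg)
  show "inner x x = 0 \<longleftrightarrow> x = 0"
  proof
    assume "inner x x = 0"
    then have "(cmod (Rep_ell2 x i))\<^sup>2 = 0" for i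
      by (intro nonneg_infsum_le_0D[OF _ summable_ell2]) (simp_all add: inner_self_ell2)
    then show "x = 0"
      by (simp add: Rep_ell2_inject[symmetric] zero_ell2.rep_eq fun_eq_iff)
  next
    assume "x = 0"
    then show "inner x x = 0"
      by (simp add: inner_self_ell2 zero_ell2.rep_eq)
  qed
  show "norm x = sqrt (inner x x)" "sgn x = inverse (norm x) *\<^sub>R x" "dist x y = norm (x - y)"
    by (simp_all add: norm_ell2_def sgn_ell2_def dist_ell2_def)
  show "(uniformity :: ('a ell2 \<times> 'a ell2) filter)
      = (INF e\<in>{0<..}. principal {(x, y). dist x y < e})"
    by (rule uniformity_ell2_def)
  show "open U \<longleftrightarrow> (\<forall>x\<in>U. \<forall>\<^sub>F (x', y) in uniformity. x' = x \<longrightarrow> y \<in> U)" for U :: "'a ell2 set"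
    by (rule open_ell2_def)
qed

end

lemma norm_ell2_square: "(norm x)\<^sup>2 = (\<Sum>\<^sub>\<infinity>i. (cmod (Rep_ell2 x i))\<^sup>2)"
  by (simp add: power2_norm_eq_inner inner_self_ell2)

lemma sum_le_norm_ell2:
  assumes "finite F"
  shows "(\<Sum>i\<in>F. (cmod (Rep_ell2 x i))\<^sup>2) \<le> (norm x)\<^sup>2"
  unfolding norm_ell2_square by (rule finite_sum_le_infsum[OF summable_ell2 assms]) simp_all

lemma norm_ell2_le:
  assumes "\<And>F. finite F \<Longrightarrow> (\<Sum>i\<in>F. (cmod (Rep_ell2 x i))\<^sup>2) \<le> e\<^sup>2" "0 \<le> e"
  shows "norm x \<le> e"
proof (rule power2_le_imp_le)
  show "(norm x)\<^sup>2 \<le> e\<^sup>2"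
    unfolding norm_ell2_square using assms(1) by (rule infsum_le_finite_sums[OF summable_ell2])
qed (rule assms(2))

instance ell2 :: (type) banach
proof
  fix X :: "nat \<Rightarrow> 'a ell2"
  assume "Cauchy X"
  then have Cauchy_X: "\<exists>M. \<forall>m\<ge>M. \<forall>n\<ge>M. norm (X m - X n) < e" if "e > 0" for e
    using that unfolding Cauchy_def dist_norm by blast
  have partial: "(\<Sum>i\<in>F. (cmod (Rep_ell2 (X m) i - Rep_ell2 (X n) i))\<^sup>2) \<le> (norm (X m - X n))\<^sup>2"
    if "finite F" for F m n
    using sum_le_norm_ell2[OF that, of "X m - X n"] by (simp add: minus_ell2.rep_eq)
  have "Cauchy (\<lambda>n. Rep_ell2 (X n) i)" for i
  proof (rule metric_CauchyI)
    fix e :: real assume "0 < e"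
    then obtain M where M: "\<forall>m\<ge>M. \<forall>n\<ge>M. norm (X m - X n) < e"
      using Cauchy_X by blast
    have "dist (Rep_ell2 (X m) i) (Rep_ell2 (X n) i) < e" if "m \<ge> M" "n \<ge> M" for m n
    proof -
      have "cmod (Rep_ell2 (X m) i - Rep_ell2 (X n) i) \<le> norm (X m - X n)"
        using partial[of "{i}" m n] by (auto intro: power2_le_imp_le)
      with M that show ?thesis
        by (fastforce simp: dist_norm)
    qed
    then show "\<exists>M. \<forall>m\<ge>M. \<forall>n\<ge>M. dist (Rep_ell2 (X m) i) (Rep_ell2 (X n) i) < e"
      by blast
  qed
  then have "\<exists>l. (\<lambda>n. Rep_ell2 (X n) i) \<longlonglongrightarrow> l" for i
    by (simp add: Cauchy_convergent_iff convergent_def)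
  then obtain l where l: "\<And>i. (\<lambda>n. Rep_ell2 (X n) i) \<longlonglongrightarrow> l i"
    by metis
  have tail: "(\<Sum>i\<in>F. (cmod (Rep_ell2 (X m) i - l i))\<^sup>2) \<le> e\<^sup>2"
    if "finite F" "m \<ge> M" "\<forall>m\<ge>M. \<forall>n\<ge>M. norm (X m - X n) < e" for F m M e
  proof (rule tendsto_upperbound)
    show "(\<lambda>n. \<Sum>i\<in>F. (cmod (Rep_ell2 (X m) i - Rep_ell2 (X n) i))\<^sup>2)
        \<longlonglongrightarrow> (\<Sum>i\<in>F. (cmod (Rep_ell2 (X m) i - l i))\<^sup>2)"
      by (intro tendsto_intros l)
    show "\<forall>\<^sub>F n in sequentially. (\<Sum>i\<in>F. (cmod (Rep_ell2 (X m) i - Rep_ell2 (X n) i))\<^sup>2) \<le> e\<^sup>2"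
      unfolding eventually_sequentially
    proof (intro exI[of _ M] allI impI)
      fix n assume "M \<le> n"
      then have "(norm (X m - X n))\<^sup>2 \<le> e\<^sup>2"
        using that by (intro power_mono) (auto intro: less_imp_le)
      with partial[OF that(1), of m n]
      show "(\<Sum>i\<in>F. (cmod (Rep_ell2 (X m) i - Rep_ell2 (X n) i))\<^sup>2) \<le> e\<^sup>2"
        by linarith
    qed
  qed simp
  obtain M where M: "\<forall>m\<ge>M. \<forall>n\<ge>M. norm (X m - X n) < 1"
    using Cauchy_X[of 1] by auto
  have "(\<lambda>i. (cmod (Rep_ell2 (X M) i - l i))\<^sup>2) summable_on UNIV"
    using tail[OF _ order_refl M]
    by (intro nonneg_bdd_above_summable_on bdd_aboveI2[where M = 1]) auto
  from square_summable_add[OF this summable_ell2[of "- X M"]]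
  have "(\<lambda>i. (cmod (l i))\<^sup>2) summable_on UNIV"
    by (simp add: uminus_ell2.rep_eq)
  then have L: "Rep_ell2 (Abs_ell2 l) = l"
    by (simp add: Abs_ell2_inverse)
  show "convergent X"
    unfolding convergent_def
  proof (intro exI[of _ "Abs_ell2 l"] metric_LIMSEQ_I)
    fix e :: real assume "0 < e"
    then obtain M where M: "\<forall>m\<ge>M. \<forall>n\<ge>M. norm (X m - X n) < e / 2"
      using Cauchy_X[of "e / 2"] by auto
    have "norm (X m - Abs_ell2 l) \<le> e / 2" if "m \<ge> M" for m
      using tail[OF _ that M] \<open>0 < e\<close> by (intro norm_ell2_le) (simp_all add: minus_ell2.rep_eq L)
    then show "\<exists>M. \<forall>m\<ge>M. dist (X m) (Abs_ell2 l) < e"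
      using \<open>0 < e\<close> by (force simp: dist_norm)
  qed
qed

instantiation ell2 :: (type) complex_hilbert
begin

lift_definition scaleC_ell2 :: "complex \<Rightarrow> 'a ell2 \<Rightarrow> 'a ell2" is "\<lambda>c x i. c * x i"
  by (rule square_summable_cmult)

lift_definition cinner_ell2 :: "'a ell2 \<Rightarrow> 'a ell2 \<Rightarrow> complex" is
  "\<lambda>x y. \<Sum>\<^sub>\<infinity>i. x i * cnj (y i)" .

instance
proof
  fix x y z :: "'a ell2" and r :: real and c d :: complex
  show "c *\<^sub>C (x + y) = c *\<^sub>C x + c *\<^sub>C y" "(c + d) *\<^sub>C x = c *\<^sub>C x + d *\<^sub>C x"
    "c *\<^sub>C d *\<^sub>C x = (c * d) *\<^sub>C x"
    by (transfer, simp add: algebra_simps)+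
  show "complex_of_real r *\<^sub>C x = r *\<^sub>R x"
    by transfer simp
  show "cinner (x + y) z = cinner x z + cinner y z"
    by transfer (simp add: distrib_right infsum_add square_summable_prod)
  show "cinner (c *\<^sub>C x) y = c * cinner x y"
    by transfer (simp add: mult.assoc infsum_cmult_right')
  show "cinner x y = cnj (cinner y x)"
    by transfer (simp add: infsum_cnj[symmetric] mult.commute del: infsum_cnj)
  show "Re (cinner x y) = inner x y"
    by transfer simp
qed

end


section \<open>Left creation operators and the noncommutative disc algebra\<close>

text \<open>The full Fock space $F^2(H_n)$ is the type \<open>'n list ell2\<close>: a vector is given by its
  coefficients in the orthonormal basis $e_\alpha = e_{i_1} \otimes \cdots \otimes e_{i_k}$,
  $\alpha = g_{i_1} \cdots g_{i_k}$, with $e_{g_0} = 1$. In these coordinates $e_i \otimes \varphi$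
  has coefficient $\varphi_\beta$ at $g_i \beta$ and \<open>0\<close> at all words not starting with $g_i$.\<close>

lift_definition creation :: "'n \<Rightarrow> 'n list ell2 \<Rightarrow> 'n list ell2" is
  "\<lambda>i \<phi> \<alpha>. case \<alpha> of [] \<Rightarrow> 0 | j # \<beta> \<Rightarrow> if j = i then \<phi> \<beta> else 0"
proof -
  fix i :: 'n and \<phi> :: "'n list \<Rightarrow> complex"
  let ?g = "\<lambda>\<alpha>. (cmod (case \<alpha> of [] \<Rightarrow> 0 | j # \<beta> \<Rightarrow> if j = i then \<phi> \<beta> else 0))\<^sup>2"
  assume "(\<lambda>\<beta>. (cmod (\<phi> \<beta>))\<^sup>2) summable_on UNIV"
  then have "?g summable_on range ((#) i)"
    by (subst summable_on_reindex) (auto simp: o_def)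
  then show "?g summable_on UNIV"
    by (rule summable_on_cong_neutral[THEN iffD1, rotated -1]) (auto split: list.split)
qed

lemma norm_creation: "norm (creation i \<phi>) = norm \<phi>"
proof -
  let ?g = "\<lambda>\<alpha>. (cmod (Rep_ell2 (creation i \<phi>) \<alpha>))\<^sup>2"
  have "infsum ?g UNIV = infsum ?g (range ((#) i))"
    by (rule infsum_cong_neutral) (auto simp: creation.rep_eq split: list.split)
  also have "\<dots> = (\<Sum>\<^sub>\<infinity>\<beta>. (cmod (Rep_ell2 \<phi> \<beta>))\<^sup>2)"
    by (subst infsum_reindex) (auto simp: o_def creation.rep_eq)
  finally show ?thesis
    by (simp add: norm_eq_sqrt_inner inner_self_ell2)
qed

lemma bounded_linear_creation: "bounded_linear (creation i)"
proof (rule bounded_linear_intro[where K = 1])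
  show "creation i (\<phi> + \<psi>) = creation i \<phi> + creation i \<psi>" for \<phi> \<psi> :: "'a list ell2"
    by transfer (auto split: list.split)
  show "creation i (r *\<^sub>R \<phi>) = r *\<^sub>R creation i \<phi>" for r and \<phi> :: "'a list ell2"
    by transfer (auto split: list.split)
qed (simp add: norm_creation)

definition left_creation :: "'n \<Rightarrow> 'n list ell2 \<Rightarrow>\<^sub>L 'n list ell2" where
  "left_creation i = Blinfun (creation i)"

lemma left_creation_apply [simp]: "left_creation i \<phi> = creation i \<phi>"
  by (simp add: left_creation_def bounded_linear_Blinfun_apply[OF bounded_linear_creation])

definition norm_closed_algebra :: "('a::complex_hilbert \<Rightarrow>\<^sub>L 'a) set \<Rightarrow> bool" where
  "norm_closed_algebra \<A> \<longleftrightarrow> closed \<A> \<and> 0 \<in> \<A> \<and>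
     (\<forall>A\<in>\<A>. \<forall>B\<in>\<A>. A + B \<in> \<A> \<and> A o\<^sub>L B \<in> \<A>) \<and> (\<forall>c. \<forall>A\<in>\<A>. scaleC_op c A \<in> \<A>)"

definition disc_algebra :: "('n list ell2 \<Rightarrow>\<^sub>L 'n list ell2) set" where
  "disc_algebra = norm_closed_algebra hull (insert id_blinfun (range left_creation))"


section \<open>Free holomorphic functions\<close>

text \<open>A free holomorphic function is represented by its family of coefficients $a_\alpha$.\<close>

definition free_holomorphic :: "('n::finite list \<Rightarrow> complex) \<Rightarrow> bool" where
  "free_holomorphic a \<longleftrightarrow>
     limsup (\<lambda>k. ereal (root (2 * k) (\<Sum>\<alpha> | length \<alpha> = k. (cmod (a \<alpha>))\<^sup>2))) \<le> 1"

definition free_eval ::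
    "('n::finite list \<Rightarrow> complex) \<Rightarrow> ('n \<Rightarrow> 'a::complex_hilbert \<Rightarrow>\<^sub>L 'a) \<Rightarrow> 'a \<Rightarrow>\<^sub>L 'a" where
  "free_eval a X = (\<Sum>k. \<Sum>\<alpha> | length \<alpha> = k. scaleC_op (a \<alpha>) (word_op X \<alpha>))"

definition operator_ball :: "('n::finite \<Rightarrow> 'k::complex_hilbert \<Rightarrow>\<^sub>L 'k) set" where
  "operator_ball =
     {X. (\<forall>i. X i \<in> complex_ops) \<and> onorm (\<lambda>x. \<Sum>i\<in>UNIV. X i (cadjoint (X i) x)) < 1}"

text \<open>The norm of the type \<open>'k ^ 'm\<close> is the Hilbert space norm of the direct sum of \<open>m\<close> copies
  of \<open>'k\<close>.\<close>

definition row_operator :: "('m::finite \<Rightarrow> 'k::complex_hilbert \<Rightarrow>\<^sub>L 'k) \<Rightarrow> 'k ^ 'm \<Rightarrow> 'k" where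
  "row_operator F v = (\<Sum>j\<in>UNIV. F j (v $ j))"

definition contractive ::
    "'k::complex_hilbert itself \<Rightarrow> ('m::finite \<Rightarrow> 'n::finite list \<Rightarrow> complex) \<Rightarrow> bool" where
  "contractive _ a \<longleftrightarrow>
     (\<forall>X \<in> (operator_ball :: ('n \<Rightarrow> 'k \<Rightarrow>\<^sub>L 'k) set).
        onorm (row_operator (\<lambda>j. free_eval (a j) X)) \<le> 1)"

text \<open>The scalar $f_j(0)$ is the coefficient of $f_j$ at the empty word.\<close>

definition value_at_zero :: "('m::finite \<Rightarrow> 'n list \<Rightarrow> complex) \<Rightarrow> complex ^ 'm" where
  "value_at_zero a = (\<chi> j. a j [])"

definition boundary_in_disc_algebra :: "('n::finite list \<Rightarrow> complex) \<Rightarrow> bool" where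
  "boundary_in_disc_algebra a \<longleftrightarrow>
     (\<exists>F \<in> disc_algebra.
        ((\<lambda>r::real. free_eval a (\<lambda>i. r *\<^sub>R left_creation i)) \<longlongrightarrow> F) (at_left 1))"

definition functional_calculus ::
    "('m \<Rightarrow> 'n::finite list \<Rightarrow> complex) \<Rightarrow> ('n \<Rightarrow> 'h::complex_hilbert \<Rightarrow>\<^sub>L 'h) \<Rightarrow> 'm \<Rightarrow> 'h \<Rightarrow>\<^sub>L 'h" where
  "functional_calculus a T j = Lim (at_left 1) (\<lambda>r::real. free_eval (a j) (\<lambda>i. r *\<^sub>R T i))"


section \<open>Operators of class $\mathcal C_\rho$\<close>

text \<open>\<open>class_C TYPE('g) \<rho> T\<close> states that \<open>T\<close> has a \<open>\<rho>\<close>-dilation on the Hilbert space \<open>'g\<close>, into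
  which \<open>'h\<close> is embedded by an isometry \<open>J\<close>.

  HOL cannot quantify existentially over \<open>'g\<close> inside a formula. As a hypothesis, with \<open>'g\<close> a type
  variable, the predicate covers dilations on every Hilbert space. As a conclusion it is used with
  \<open>'g = ('n list \<times> 'h) ell2\<close>, i.e. $\ell^2(\mathbb F_n^+ \times \mathcal H)$, which is no
  restriction: given any dilation, the closed span of the vectors $V_\alpha h$ carries a dilation
  too, and the Hilbert dimension of this span is at most the cardinality of the infinite set
  $\mathbb F_n^+ \times \mathcal H$ of labels. Adding a copy of
  $\ell^2(\mathbb F_n^+ \times \mathcal H)$, which admits isometries with orthogonal ranges, makes
  the dimension equal to that cardinality.\<close>

definition class_C ::
    "'g::complex_hilbert itself \<Rightarrow> real \<Rightarrow> ('n \<Rightarrow> 'h::complex_hilbert \<Rightarrow>\<^sub>L 'h) \<Rightarrow> bool" where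
  "class_C _ \<rho> T \<longleftrightarrow>
     (\<forall>i. T i \<in> complex_ops) \<and>
     (\<exists>(J :: 'h \<Rightarrow>\<^sub>L 'g) (V :: 'n \<Rightarrow> 'g \<Rightarrow>\<^sub>L 'g).
        isometric_op J \<and> (\<forall>i. isometric_op (V i)) \<and>
        (\<forall>i j. i \<noteq> j \<longrightarrow> (\<forall>x y. cinner (V i x) (V j y) = 0)) \<and>
        (\<forall>\<alpha> x. \<alpha> \<noteq> [] \<longrightarrow>
           J (word_op T \<alpha> x) = \<rho> *\<^sub>R orth_proj (range J) (word_op V \<alpha> (J x))))"

text \<open>The parameter \<open>c\<close> stands for $\|f(0)\|$.\<close>

definition rho_image :: "real \<Rightarrow> real \<Rightarrow> real" where
  "rho_image \<rho> c =
     (if \<rho> < 1 then 1 + (\<rho> - 1) * ((1 - c) / (1 + c)) else 1 + (\<rho> - 1) * ((1 + c) / (1 - c)))"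

end

theory Submission
  imports Defs
begin

text \<open>Let $V$ on $\mathcal G$ dilate $T$ with constant $\rho$, let $z = f(0)$ and $c = \|z\|$. By the
  noncommutative von Neumann inequality the limits $W_j = \lim_{r\to1} f_j(rV)$ exist, and
  $W = (W_1, \ldots, W_m)$ is a row contraction because $f$ is contractive. Since
  $T_\alpha = \rho P V_\alpha + (1 - \rho)\delta_{\alpha, g_0}$ for all $\alpha$, the operators
  $Y_j = f_j(T)$ satisfy $Y_\beta = \rho P W_\beta + (1 - \rho) z_\beta$ for all words $\beta$.

  $Y$ is of class $\mathcal C_\sigma$ iff the multi-Toeplitz kernel with entries $\sigma$ on the
  diagonal and $Y_\gamma$, $Y_\gamma^*$ off it is positive. With $K_W$, $K_z$ the kernels of $W$, $z$
  (diagonal $1$) this kernel is $\rho P K_W + (1 - \rho) K_z + (\sigma - 1) I$. Here $K_W \ge 0$, and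
  Harnack's inequality $\frac{1-c}{1+c} I \le K_z \le \frac{1+c}{1-c} I$ gives positivity
  for $\sigma = \rho_f$.\<close>

section \<open>Complex Hilbert spaces\<close>

text \<open>Three obstacles shape the argument. The hypothesis on f concerns a fixed space
  \<open>'k\<close>, while V acts on an arbitrary \<open>'g\<close>; contractivity is moved to
  \<open>'g\<close> by finite-dimensional compressions. The row [V_1 ... V_n] has norm 1, on the
  boundary of the ball, where the power series may diverge; the norm limit assumed for the creation
  operators makes f(rV) Cauchy as r tends to 1. Finally, compression is linear but not
  multiplicative, so the identity for the single f_j(T) does not by itself pass to products; it is
  carried along with an arbitrary word in T standing on the right.

  The two cases of \<rho>_f come from the sign of 1 - \<rho>: it decides which Harnack bound
  controls the term (1 - \<rho>) K_z, and \<sigma> - 1 is the multiple of I that exactly compensates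
  this bound. Both bounds come from writing the form of a row operator of norm c as G^2 - Z^2 with Z
  <= c G.

  The dilation space is prescribed as \<open>('m list \<times> 'h) ell2\<close>. The usual quotient
  and completion for a positive kernel are therefore replaced by vectors chosen inside this
  space.\<close>

lemma cinner_add_right: "cinner x (y + z) = cinner x y + cinner x z"
  by (subst (1 2 3) cinner_commute) (simp add: cinner_add_left)

lemma cinner_scaleC_right: "cinner x (c *\<^sub>C y) = cnj c * cinner x y"
  by (subst (1 2) cinner_commute) (simp add: cinner_scaleC_left)

lemma scaleR_scaleC: "r *\<^sub>R x = complex_of_real r *\<^sub>C (x::'a::complex_hilbert)"
  by (simp add: scaleC_of_real)

lemma cinner_scaleR_left: "cinner (r *\<^sub>R x) y = complex_of_real r * cinner x y"
  by (simp add: scaleR_scaleC cinner_scaleC_left)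

lemma cinner_scaleR_right: "cinner x (r *\<^sub>R y) = complex_of_real r * cinner x y"
  by (simp add: scaleR_scaleC cinner_scaleC_right)

lemma cinner_minus_left: "cinner (- x) y = - cinner x y"
  using cinner_scaleR_left[of "-1" x y] by simp

lemma cinner_minus_right: "cinner x (- y) = - cinner x y"
  using cinner_scaleR_right[of x "-1" y] by simp

lemma cinner_diff_left: "cinner (x - y) z = cinner x z - cinner y z"
  using cinner_add_left[of x "- y" z] by (simp add: cinner_minus_left)

lemma cinner_diff_right: "cinner x (y - z) = cinner x y - cinner x z"
  using cinner_add_right[of x y "- z"] by (simp add: cinner_minus_right)

lemma cinner_zero_left [simp]: "cinner 0 x = 0"
  using cinner_scaleR_left[of 0 x x] by simp

lemma cinner_zero_right [simp]: "cinner x 0 = 0"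
  using cinner_scaleR_right[of x 0 x] by simp

lemma cinner_sum_left: "cinner (sum f A) y = (\<Sum>i\<in>A. cinner (f i) y)"
  by (induction A rule: infinite_finite_induct) (simp_all add: cinner_add_left)

lemma cinner_sum_right: "cinner x (sum f A) = (\<Sum>i\<in>A. cinner x (f i))"
  by (induction A rule: infinite_finite_induct) (simp_all add: cinner_add_right)

lemmas cinner_simps = cinner_add_left cinner_add_right cinner_diff_left cinner_diff_right
  cinner_scaleC_left cinner_scaleC_right cinner_scaleR_left cinner_scaleR_right
  cinner_minus_left cinner_minus_right

lemma scaleC_one [simp]: "1 *\<^sub>C x = (x::'a::complex_hilbert)"
  using scaleC_of_real[of 1 x] by simp

lemma scaleC_zero_left [simp]: "0 *\<^sub>C x = (0::'a::complex_hilbert)"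
  using scaleC_of_real[of 0 x] by simp

lemma scaleC_zero_right [simp]: "c *\<^sub>C (0::'a::complex_hilbert) = 0"
  using norm_scaleC[of c "0::'a"] by simp

lemma scaleC_sum_right: "c *\<^sub>C sum f A = (\<Sum>i\<in>A. c *\<^sub>C (f i :: 'a::complex_hilbert))"
  by (induction A rule: infinite_finite_induct) (simp_all add: scaleC_add_right)

lemma cinner_eq_zero_iff [simp]: "cinner x x = 0 \<longleftrightarrow> x = 0"
  by (simp add: cinner_self)

lemma cinner_ext:
  assumes "\<And>z. cinner x z = cinner y z"
  shows "x = y"
proof -
  have "cinner (x - y) (x - y) = 0"
    using assms[of "x - y"] by (simp add: cinner_diff_left)
  then show ?thesis by (simp only: cinner_eq_zero_iff) simp
qed

lemma cinner_ext_right: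
  assumes "\<And>z. cinner z x = cinner z y"
  shows "x = y"
proof -
  have "cinner (x - y) (x - y) = 0"
    using assms[of "x - y"] by (simp add: cinner_diff_right)
  then show ?thesis by (simp only: cinner_eq_zero_iff) simp
qed

lemma cinner_Complex: "cinner x y = Complex (inner x y) (inner x (\<i> *\<^sub>C y))"
proof -
  have "Im (cinner x y) = Re (cinner x (\<i> *\<^sub>C y))"
    by (simp add: cinner_scaleC_right)
  then show ?thesis
    by (simp add: complex_eq_iff Re_cinner)
qed

lemma norm_cinner_le: "cmod (cinner x y) \<le> norm x * norm y"
proof (cases "cinner x y = 0")
  case False
  define c where "c = cnj (cinner x y) / complex_of_real (cmod (cinner x y))"
  have c: "cmod c = 1"
    using False by (simp add: c_def norm_divide)
  have "c * cinner x y = complex_of_real (cmod (cinner x y))"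
    using complex_norm_square[of "cinner x y"] False
    by (simp add: c_def power2_eq_square field_simps)
  then have "cmod (cinner x y) = Re (cinner (c *\<^sub>C x) y)"
    by (simp add: cinner_scaleC_left)
  also have "\<dots> \<le> norm (c *\<^sub>C x) * norm y"
    unfolding Re_cinner by (rule norm_cauchy_schwarz)
  finally show ?thesis
    by (simp add: norm_scaleC c)
qed simp

lemma tendsto_cinner [tendsto_intros]:
  assumes "(f \<longlongrightarrow> x) F" "(g \<longlongrightarrow> y) F"
  shows "((\<lambda>t. cinner (f t) (g t)) \<longlongrightarrow> cinner x (y::'a::complex_hilbert)) F"
  unfolding cinner_Complex
  by (intro tendsto_Complex tendsto_inner assms bounded_linear.tendsto[OF bounded_linear_scaleC])

lemma norm_add_square: "(norm (x + y))\<^sup>2 = (norm x)\<^sup>2 + 2 * Re (cinner x y) + (norm y)\<^sup>2"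
  by (simp add: power2_norm_eq_inner Re_cinner inner_add_left inner_add_right inner_commute)

lemma norm_diff_square: "(norm (x - y))\<^sup>2 = (norm x)\<^sup>2 - 2 * Re (cinner x y) + (norm y)\<^sup>2"
  by (simp add: power2_norm_eq_inner Re_cinner inner_diff_left inner_diff_right inner_commute)

text \<open>Riesz representation for a functional given by its graph \<open>D\<close> on a subspace: the
  representing vector is the limit of a minimizing sequence of
  $\|u\|^2 - 2 l$ over $(u, l) \in D$.\<close>

lemma riesz_graph_real:
  fixes D :: "('a::{real_inner,banach} \<times> real) set"
  assumes D: "subspace D" and bnd: "\<And>u l. (u, l) \<in> D \<Longrightarrow> \<bar>l\<bar> \<le> B * norm u" and "0 \<le> B"
  shows "\<exists>p \<in> closure (fst ` D). norm p \<le> B \<and> (\<forall>(u, l) \<in> D. l = inner u p)"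
proof -
  define q where "q = (\<lambda>d::'a \<times> real. (norm (fst d))\<^sup>2 - 2 * snd d)"
  have q_ge: "- B\<^sup>2 \<le> q d" if "d \<in> D" for d
  proof -
    have "snd d \<le> B * norm (fst d)"
      using bnd[of "fst d" "snd d"] that by auto
    then show ?thesis
      using zero_le_power2[of "norm (fst d) - B"] by (simp add: q_def power2_diff mult.commute)
  qed
  define \<delta> where "\<delta> = (INF d\<in>D. q d)"
  have bdd: "bdd_below (q ` D)"
    using q_ge by (auto intro!: bdd_belowI2)
  have le_q: "\<delta> \<le> q d" if "d \<in> D" for d
    unfolding \<delta>_def by (rule cINF_lower[OF bdd that])
  have "\<exists>d\<in>D. q d < \<delta> + e" if "e > 0" for e
    using cINF_less_iff[OF _ bdd, of "\<delta> + e"] subspace_0[OF D] that by (auto simp: \<delta>_def)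
  then have "\<forall>n. \<exists>d\<in>D. q d < \<delta> + 1 / Suc n"
    by simp
  then obtain d where d: "\<And>n. d n \<in> D" "\<And>n. q (d n) < \<delta> + 1 / Suc n"
    by metis
  define u where "u = (\<lambda>n. fst (d n))"
  have par: "(norm (u m - u n))\<^sup>2 \<le> 2 * (q (d m) - \<delta>) + 2 * (q (d n) - \<delta>)" for m n
  proof -
    have "(1/2) *\<^sub>R (d m + d n) \<in> D"
      by (intro subspace_scale[OF D] subspace_add[OF D] d)
    from le_q[OF this] have "\<delta> \<le> (norm (u m + u n))\<^sup>2 / 4 - (snd (d m) + snd (d n))"
      by (simp add: q_def u_def power_divide add_divide_distrib)
    moreover have "(norm (u m - u n))\<^sup>2 + (norm (u m + u n))\<^sup>2 = 2 * (norm (u m))\<^sup>2 + 2 * (norm (u n))\<^sup>2"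
      by (simp add: power2_norm_eq_inner inner_diff_left inner_diff_right inner_add_left
        inner_add_right inner_commute)
    ultimately show ?thesis
      by (simp add: q_def u_def)
  qed
  have "Cauchy u"
  proof (rule metric_CauchyI)
    fix e :: real assume "0 < e"
    obtain M where M: "4 / e\<^sup>2 < real M"
      using reals_Archimedean2 by blast
    have "dist (u m) (u n) < e" if "M \<le> m" "M \<le> n" for m n
    proof -
      have "(norm (u m - u n))\<^sup>2 < 2 * (1 / Suc m) + 2 * (1 / Suc n)"
        using par[of m n] d(2)[of m] d(2)[of n] by simp
      also have "\<dots> \<le> 2 * (1 / Suc M) + 2 * (1 / Suc M)"
        using that by (intro add_mono mult_left_mono divide_left_mono) auto
      also have "\<dots> < e\<^sup>2"
      proof -
        have "4 < real (Suc M) * e\<^sup>2"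
          using M \<open>0 < e\<close> by (simp add: pos_divide_less_eq distrib_right) (smt (verit) zero_less_power)
        then have "4 / real (Suc M) < e\<^sup>2"
          by (subst pos_divide_less_eq) (simp_all only: mult.commute of_nat_0_less_iff zero_less_Suc)
        then show ?thesis
          by linarith
      qed
      finally show ?thesis
        using \<open>0 < e\<close> by (simp add: dist_norm power_less_imp_less_base)
    qed
    then show "\<exists>M. \<forall>m\<ge>M. \<forall>n\<ge>M. dist (u m) (u n) < e"
      by blast
  qed
  then obtain p where p: "u \<longlonglongrightarrow> p"
    by (meson Cauchy_convergent convergentD)
  have rep: "l = inner v p" if vl: "(v, l) \<in> D" for v l
  proof -
    define s where "s = inner v p - l"
    have ge: "0 \<le> 2 * t * s + t\<^sup>2 * (norm v)\<^sup>2" for t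
    proof (rule LIMSEQ_le_const)
      show "(\<lambda>n. 1 / Suc n + 2 * t * (inner v (u n) - l) + t\<^sup>2 * (norm v)\<^sup>2)
        \<longlonglongrightarrow> 2 * t * s + t\<^sup>2 * (norm v)\<^sup>2"
      proof -
        have "(\<lambda>n. 1 / Suc n + 2 * t * (inner v (u n) - l) + t\<^sup>2 * (norm v)\<^sup>2)
          \<longlonglongrightarrow> 0 + 2 * t * (inner v p - l) + t\<^sup>2 * (norm v)\<^sup>2"
          by (intro tendsto_intros p LIMSEQ_Suc[OF lim_1_over_n])
        then show ?thesis by (simp add: s_def)
      qed
      have "0 \<le> 1 / Suc n + 2 * t * (inner v (u n) - l) + t\<^sup>2 * (norm v)\<^sup>2" for n
      proof -
        have "d n + t *\<^sub>R (v, l) \<in> D"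
          by (intro subspace_scale[OF D] subspace_add[OF D] d vl)
        from le_q[OF this] have "\<delta> \<le> (norm (u n + t *\<^sub>R v))\<^sup>2 - 2 * (snd (d n) + t * l)"
          by (simp add: q_def u_def)
        also have "(norm (u n + t *\<^sub>R v))\<^sup>2 = (norm (u n))\<^sup>2 + 2 * t * inner v (u n) + t\<^sup>2 * (norm v)\<^sup>2"
          unfolding power2_norm_eq_inner
          by (simp add: inner_add_left inner_add_right inner_commute power2_eq_square algebra_simps)
        finally show ?thesis
          using d(2)[of n] by (simp add: q_def u_def algebra_simps)
      qed
      then show "\<exists>N. \<forall>n\<ge>N. 0 \<le> 1 / Suc n + 2 * t * (inner v (u n) - l) + t\<^sup>2 * (norm v)\<^sup>2"
        by blast
    qed
    have "s = 0"
    proof (rule ccontr)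
      assume "s \<noteq> 0"
      define t where "t = - s / ((norm v)\<^sup>2 + 1)"
      have pos: "(norm v)\<^sup>2 + 1 > 0"
        by (smt (verit) zero_le_power2)
      have "t * ((norm v)\<^sup>2 + 1) = - s"
        using pos by (simp add: t_def)
      then have "t * (norm v)\<^sup>2 = - s - t"
        by (simp add: distrib_left)
      then have "t\<^sup>2 * (norm v)\<^sup>2 = t * (- s - t)"
        by (simp only: power2_eq_square mult.assoc)
      then have "0 \<le> s * t - t\<^sup>2"
        using ge[of t] by (simp add: right_diff_distrib power2_eq_square mult.commute)
      moreover have "s * t = - (s\<^sup>2 / ((norm v)\<^sup>2 + 1))"
        by (simp add: t_def power2_eq_square)
      moreover have "s\<^sup>2 / ((norm v)\<^sup>2 + 1) > 0"
        using \<open>s \<noteq> 0\<close> pos by simp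
      ultimately show False
        by (smt (verit) zero_le_power2)
    qed
    then show ?thesis
      by (simp add: s_def)
  qed
  have "(norm p)\<^sup>2 \<le> B * norm p"
  proof (rule LIMSEQ_le)
    show "(\<lambda>n. inner (u n) p) \<longlonglongrightarrow> (norm p)\<^sup>2"
      unfolding power2_norm_eq_inner by (intro tendsto_intros p)
    show "(\<lambda>n. B * norm (u n)) \<longlonglongrightarrow> B * norm p"
      by (intro tendsto_intros p)
    have "inner (u n) p \<le> B * norm (u n)" for n
      using rep[of "u n" "snd (d n)"] bnd[of "u n" "snd (d n)"] d(1)[of n]
      by (cases "d n") (auto simp: u_def)
    then show "\<exists>N. \<forall>n\<ge>N. inner (u n) p \<le> B * norm (u n)"
      by blast
  qed
  then have "norm p \<le> B"
    using \<open>0 \<le> B\<close> by (cases "norm p = 0") (auto simp: power2_eq_square)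
  moreover have "p \<in> closure (fst ` D)"
    unfolding closure_sequential using p d(1) by (intro exI[of _ u]) (auto simp: u_def)
  ultimately show ?thesis
    using rep by blast
qed

text \<open>The real part is represented by the real lemma, and Im l = - Re (\<i> l) recovers the
  rest by complex linearity. Working with a graph leaves well-definedness to the bound: l = 0
  whenever u = 0.\<close>

lemma riesz_graph:
  fixes D :: "('a::complex_hilbert \<times> complex) set"
  assumes zero: "(0, 0) \<in> D"
    and add: "\<And>u l v m. (u, l) \<in> D \<Longrightarrow> (v, m) \<in> D \<Longrightarrow> (u + v, l + m) \<in> D"
    and scale: "\<And>c u l. (u, l) \<in> D \<Longrightarrow> (c *\<^sub>C u, c * l) \<in> D"
    and bnd: "\<And>u l. (u, l) \<in> D \<Longrightarrow> cmod l \<le> B * norm u" and "0 \<le> B"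
  shows "\<exists>p \<in> closure (fst ` D). norm p \<le> B \<and> (\<forall>(u, l) \<in> D. l = cinner u p)"
proof -
  let ?R = "(\<lambda>(u, l). (u, Re l)) ` D"
  have "subspace ?R"
    unfolding subspace_def
  proof (intro conjI ballI allI)
    show "0 \<in> ?R"
      using zero by (force simp: zero_prod_def)
    fix x y r assume x: "x \<in> ?R" 
    from x obtain u l where ul: "x = (u, Re l)" "(u, l) \<in> D" by auto
    show "r *\<^sub>R x \<in> ?R"
      using scale[OF ul(2), of "complex_of_real r"] ul(1)
      by (force simp: scaleC_of_real intro!: image_eqI[rotated])
    assume "y \<in> ?R"
    then obtain v m where "y = (v, Re m)" "(v, m) \<in> D" by auto
    then show "x + y \<in> ?R"
      using add[OF ul(2), of v m] ul(1) by (force intro!: image_eqI[rotated])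
  qed
  moreover have "\<bar>l\<bar> \<le> B * norm u" if "(u, l) \<in> ?R" for u l
    using that bnd abs_Re_le_cmod order_trans by fastforce
  ultimately obtain p where p: "p \<in> closure (fst ` ?R)" "norm p \<le> B"
    "\<And>u l. (u, l) \<in> D \<Longrightarrow> Re l = inner u p"
    using riesz_graph_real[of ?R B] \<open>0 \<le> B\<close> by fastforce
  have "fst ` ?R = fst ` D"
    by force
  moreover have "l = cinner u p" if "(u, l) \<in> D" for u l
  proof (rule complex_eqI)
    show "Re l = Re (cinner u p)"
      using p(3)[OF that] by (simp add: Re_cinner)
    show "Im l = Im (cinner u p)"
      using p(3)[OF scale[OF that, of \<i>]] by (simp flip: Re_cinner add: cinner_scaleC_left)
  qed
  ultimately show ?thesis
    using p by auto
qed

text \<open>The functional u -> <u, x> on M is bounded by the norm of x. Its Riesz vector is the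
  projection, and it lies in M because M is closed.\<close>

lemma projection_exists:
  fixes M :: "'a::complex_hilbert set"
  assumes "complex_vector.subspace M" "closed M"
  shows "\<exists>p\<in>M. \<forall>y\<in>M. cinner (x - p) y = 0"
proof -
  have "\<exists>p \<in> closure (fst ` ((\<lambda>u. (u, cinner u x)) ` M)). norm p \<le> norm x \<and>
      (\<forall>(u, l) \<in> (\<lambda>u. (u, cinner u x)) ` M. l = cinner u p)"
    using assms(1)
    by (intro riesz_graph)
      (auto simp: complex_vector.subspace_def image_iff cinner_simps norm_cinner_le mult.commute[of "norm x"])
  then obtain p where p: "p \<in> M" "\<forall>y\<in>M. cinner y x = cinner y p"
    using assms(2) by (auto simp: image_image)
  have "cinner (x - p) y = 0" if "y \<in> M" for y
  proof -
    have "cinner y (x - p) = 0"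
      using p that by (simp add: cinner_diff_right)
    then show ?thesis
      using cinner_commute[of "x - p" y] by simp
  qed
  with p show ?thesis by blast
qed

lemma orth_proj_eqI:
  assumes "complex_vector.subspace M" "p \<in> M" "\<And>y. y \<in> M \<Longrightarrow> cinner (x - p) y = 0"
  shows "orth_proj M x = p"
  unfolding orth_proj_def
proof (rule the_equality)
  fix p' assume p': "p' \<in> M \<and> (\<forall>y\<in>M. cinner (x - p') y = 0)"
  then have "p - p' \<in> M"
    using assms complex_vector.subspace_diff by blast
  with p' assms(3) have "cinner (x - p') (p - p') - cinner (x - p) (p - p') = 0"
    by simp
  then show "p' = p"
    by (simp flip: cinner_diff_left)
qed (use assms in blast)

lemma orth_proj_orth:
  assumes "complex_vector.subspace M" "closed M" "y \<in> M"
  shows "cinner (x - orth_proj M x) y = 0"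
  using projection_exists[OF assms(1,2), of x] orth_proj_eqI[OF assms(1)] assms(3) by metis

lemma complex_ops_scaleC: "A \<in> complex_ops \<Longrightarrow> blinfun_apply A (c *\<^sub>C x) = c *\<^sub>C blinfun_apply A x"
  by (simp add: complex_ops_def)

text \<open>Existence behind the \<open>THE\<close> in \<open>cadjoint\<close> is Riesz
  representation of x -> <A x, y>; uniqueness is nondegeneracy of the inner product.\<close>

lemma cinner_cadjoint:
  fixes A :: "'a::complex_hilbert \<Rightarrow>\<^sub>L 'b::complex_hilbert"
  assumes A: "A \<in> complex_ops"
  shows "cinner (A x) y = cinner x (cadjoint A y)"
proof -
  have "\<exists>p. \<forall>x. cinner (A x) y = cinner x p" for y
  proof -
    have "\<exists>p \<in> closure (fst ` range (\<lambda>x. (x, cinner (A x) y))). norm p \<le> norm A * norm y \<and>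
      (\<forall>(u, l) \<in> range (\<lambda>x. (x, cinner (A x) y)). l = cinner u p)"
    proof (intro riesz_graph)
      show "cmod l \<le> norm A * norm y * norm u" if "(u, l) \<in> range (\<lambda>x. (x, cinner (A x) y))" for u l
      proof -
        have "cmod l \<le> norm (A u) * norm y"
          using that norm_cinner_le by auto
        also have "\<dots> \<le> (norm A * norm u) * norm y"
          by (intro mult_right_mono norm_blinfun) simp
        finally show ?thesis by (simp add: mult_ac)
      qed
    qed (auto simp: image_iff blinfun.add_right cinner_simps complex_ops_scaleC[OF A])
    then show ?thesis by auto
  qed
  then obtain B where "\<forall>x y. cinner (A x) y = cinner x (B y)"
    by metis
  then have B: "cinner (A x) y = cinner x (B y)" for x y
    by blast
  have "cadjoint A = B"
    unfolding cadjoint_def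
  proof (rule the_equality)
    fix B' assume "\<forall>x y. cinner (A x) y = cinner x (B' y)"
    then have "cinner x (B' y) = cinner x (B y)" for x y
      by (simp add: B)
    then show "B' = B"
      by (intro ext cinner_ext_right)
  qed (use B in blast)
  with B show ?thesis by simp
qed

lemma cadjoint_eqI:
  assumes "A \<in> complex_ops" "\<And>x. cinner (blinfun_apply A x) y = cinner x z"
  shows "cadjoint A y = z"
  using assms by (intro cinner_ext_right) (simp flip: cinner_cadjoint)

lemma norm_cadjoint_le:
  assumes "A \<in> complex_ops"
  shows "norm (cadjoint A y) \<le> norm A * norm y"
proof -
  have "(norm (cadjoint A y))\<^sup>2 = Re (cinner (A (cadjoint A y)) y)"
    by (simp add: cinner_cadjoint[OF assms] cinner_self)
  also have "\<dots> \<le> norm (A (cadjoint A y)) * norm y"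
    unfolding Re_cinner by (rule norm_cauchy_schwarz)
  also have "\<dots> \<le> norm A * norm (cadjoint A y) * norm y"
    by (intro mult_right_mono norm_blinfun) simp
  finally show ?thesis
    by (cases "cadjoint A y = 0") (auto simp: power2_eq_square mult_ac)
qed

section \<open>Finite orthonormal systems\<close>

definition orthonormal :: "'a::complex_hilbert set \<Rightarrow> bool" where
  "orthonormal E \<longleftrightarrow> finite E \<and> (\<forall>x\<in>E. \<forall>y\<in>E. cinner x y = (if x = y then 1 else 0))"

text \<open>For orthonormal E this is the projection onto the span of E; the equation
  \<open>fourier_sum E x = x\<close> serves below as the statement that x lies in that span.\<close>

definition fourier_sum :: "'a::complex_hilbert set \<Rightarrow> 'a \<Rightarrow> 'a" where
  "fourier_sum E x = (\<Sum>e\<in>E. cinner x e *\<^sub>C e)"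

lemma cinner_fourier_sum:
  assumes "orthonormal E" "e \<in> E"
  shows "cinner (fourier_sum E x) e = cinner x e"
proof -
  have "cinner (fourier_sum E x) e = (\<Sum>d\<in>E. if d = e then cinner x d else 0)"
    unfolding fourier_sum_def cinner_sum_left
    by (rule sum.cong) (use assms in \<open>auto simp: orthonormal_def cinner_scaleC_left\<close>)
  also have "\<dots> = cinner x e"
    using assms by (simp add: orthonormal_def)
  finally show ?thesis .
qed

text \<open>One Gram--Schmidt step: the new vector is the normalized residual.\<close>

lemma orthonormal_insert:
  assumes E: "orthonormal E" and x: "fourier_sum E x \<noteq> x"
  shows "\<exists>e. e \<notin> E \<and> orthonormal (insert e E) \<and> fourier_sum (insert e E) x = x"
proof -
  define r where "r = x - fourier_sum E x"
  define e where "e = (1 / norm r) *\<^sub>R r"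
  have [simp]: "r \<noteq> 0"
    using x unfolding r_def by (metis right_minus_eq)
  have re: "cinner r d = 0" if "d \<in> E" for d
    using cinner_fourier_sum[OF E that] by (simp add: r_def cinner_diff_left)
  have ee: "cinner e e = 1"
    by (simp add: e_def cinner_simps cinner_self power2_eq_square)
  have ed: "cinner e d = 0" "cinner d e = 0" if "d \<in> E" for d
    using re[OF that] cinner_commute[of d e] by (simp_all add: e_def cinner_simps)
  have "e \<notin> E"
    using ee ed by auto
  moreover have "orthonormal (insert e E)"
    using E ee ed by (auto simp: orthonormal_def)
  moreover have "fourier_sum (insert e E) x = x"
  proof -
    have "cinner x e = cinner r e + cinner (fourier_sum E x) e"
      by (simp add: r_def flip: cinner_add_left)
    also have "cinner (fourier_sum E x) e = 0"
      by (simp add: fourier_sum_def cinner_sum_left cinner_scaleC_left ed)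
    finally have "cinner x e *\<^sub>C e = r"
      by (simp add: e_def cinner_simps cinner_self power2_eq_square scaleR_scaleC scaleC_scaleC)
    then show ?thesis
      using E \<open>e \<notin> E\<close> by (simp add: fourier_sum_def orthonormal_def r_def)
  qed
  ultimately show ?thesis by blast
qed

lemma fourier_sum_insert:
  assumes "orthonormal (insert e E)" "e \<notin> E" "fourier_sum E x = x"
  shows "fourier_sum (insert e E) x = x"
proof -
  have "cinner x e = cinner (fourier_sum E x) e"
    by (simp add: assms)
  also have "\<dots> = 0"
    using assms(1,2) by (auto simp: fourier_sum_def cinner_sum_left cinner_scaleC_left orthonormal_def
      intro!: sum.neutral)
  finally show ?thesis
    using assms by (simp add: fourier_sum_def orthonormal_def)
qed

lemma finite_orthonormal_basis:
  fixes S :: "'a::complex_hilbert set"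
  assumes "finite S"
  shows "\<exists>E. orthonormal E \<and> (\<forall>x\<in>S. fourier_sum E x = x)"
  using assms
proof (induction S)
  case empty
  show ?case by (intro exI[of _ "{}"]) (simp add: orthonormal_def)
next
  case (insert x S)
  then obtain E where E: "orthonormal E" "\<forall>x\<in>S. fourier_sum E x = x" by blast
  show ?case
  proof (cases "fourier_sum E x = x")
    case True
    with E show ?thesis by auto
  next
    case False
    from orthonormal_insert[OF E(1) this] show ?thesis
      using E(2) fourier_sum_insert by blast
  qed
qed

text \<open>A finite set never spans an infinite-dimensional space, so a further Gram--Schmidt step
  is always possible. This makes room in \<open>'k\<close> for copies of finite-dimensional
  subspaces of other spaces.\<close>

lemma orthonormal_of_card:
  assumes "separable_infinite_dim TYPE('k::complex_hilbert)"
  shows "\<exists>E::'k set. orthonormal E \<and> card E = n"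
proof (induction n)
  case 0
  show ?case by (intro exI[of _ "{}"]) (simp add: orthonormal_def)
next
  case (Suc n)
  then obtain E :: "'k set" where E: "orthonormal E" "card E = n" by blast
  then have "complex_vector.span E \<noteq> UNIV"
    using assms by (auto simp: separable_infinite_dim_def orthonormal_def)
  moreover have "fourier_sum E x \<in> complex_vector.span E" for x
    unfolding fourier_sum_def
    by (intro complex_vector.span_sum complex_vector.span_scale complex_vector.span_base)
  ultimately obtain x where "fourier_sum E x \<noteq> x" by (metis UNIV_eq_I)
  from orthonormal_insert[OF E(1) this] show ?case
    using E by (metis card_insert_disjoint orthonormal_def)
qed

section \<open>Words and row contractions\<close>

lemma finite_words [simp]: "finite {\<alpha>::'n::finite list. length \<alpha> = k}"
  using finite_lists_length_eq[of "UNIV :: 'n set" k] by simp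

lemma finite_words_le [simp]: "finite {\<alpha>::'n::finite list. length \<alpha> \<le> k}"
  using finite_lists_length_le[of "UNIV :: 'n set" k] by simp

lemma sum_words_Suc:
  fixes f :: "'n::finite list \<Rightarrow> 'a::comm_monoid_add"
  shows "(\<Sum>\<alpha> | length \<alpha> = Suc k. f \<alpha>) = (\<Sum>i\<in>UNIV. \<Sum>\<alpha> | length \<alpha> = k. f (i # \<alpha>))"
proof -
  have "(\<Sum>i\<in>UNIV. \<Sum>\<alpha> | length \<alpha> = k. f (i # \<alpha>)) =
      (\<Sum>(i, \<alpha>)\<in>UNIV \<times> {\<alpha>. length \<alpha> = k}. f (i # \<alpha>))"
    by (rule sum.cartesian_product)
  also have "\<dots> = (\<Sum>\<alpha> | length \<alpha> = Suc k. f \<alpha>)"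
    by (rule sum.reindex_bij_witness[of _ "\<lambda>\<alpha>. (hd \<alpha>, tl \<alpha>)" "\<lambda>(i, \<alpha>). i # \<alpha>"])
      (auto simp: length_Suc_conv)
  finally show ?thesis ..
qed

lemma sum_words_le:
  fixes f :: "'n::finite list \<Rightarrow> 'a::comm_monoid_add"
  shows "(\<Sum>\<alpha> | length \<alpha> \<le> N. f \<alpha>) = (\<Sum>k\<le>N. \<Sum>\<alpha> | length \<alpha> = k. f \<alpha>)"
proof -
  have "(\<Sum>k\<le>N. \<Sum>\<alpha> | \<alpha> \<in> {\<alpha>. length \<alpha> \<le> N} \<and> length \<alpha> = k. f \<alpha>) = (\<Sum>\<alpha> | length \<alpha> \<le> N. f \<alpha>)"
    by (rule sum.group) auto
  moreover have "{\<alpha> :: 'n list. \<alpha> \<in> {\<alpha>. length \<alpha> \<le> N} \<and> length \<alpha> = k} = {\<alpha>. length \<alpha> = k}"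
    if "k \<in> {..N}" for k
    using that by auto
  ultimately show ?thesis
    by simp
qed

lemma sum_words_le_Suc:
  fixes f :: "'n::finite list \<Rightarrow> 'a::comm_monoid_add"
  shows "(\<Sum>\<alpha> | length \<alpha> \<le> Suc N. f \<alpha>) = f [] + (\<Sum>i\<in>UNIV. \<Sum>\<alpha> | length \<alpha> \<le> N. f (i # \<alpha>))"
proof -
  have "(\<Sum>\<alpha> | length \<alpha> \<le> Suc N. f \<alpha>) = f [] + (\<Sum>k\<le>N. \<Sum>\<alpha> | length \<alpha> = Suc k. f \<alpha>)"
    unfolding sum_words_le by (subst sum.atMost_Suc_shift) simp
  also have "(\<Sum>k\<le>N. \<Sum>\<alpha> | length \<alpha> = Suc k. f \<alpha>) = (\<Sum>i\<in>UNIV. \<Sum>\<alpha> | length \<alpha> \<le> N. f (i # \<alpha>))"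
    unfolding sum_words_le sum_words_Suc by (rule sum.swap)
  finally show ?thesis .
qed

lemma word_op_Nil [simp]: "word_op X [] = id_blinfun"
  and word_op_Cons [simp]: "word_op X (i # \<alpha>) = X i o\<^sub>L word_op X \<alpha>"
  by (simp_all add: word_op_def)

lemma word_op_append_apply: "word_op X (\<alpha> @ \<beta>) x = word_op X \<alpha> (word_op X \<beta> x)"
  by (induction \<alpha>) simp_all

lemma word_op_scaleR: "word_op (\<lambda>i. r *\<^sub>R X i) \<alpha> = r ^ length \<alpha> *\<^sub>R word_op X \<alpha>"
  by (induction \<alpha>) (auto intro!: blinfun_eqI simp: blinfun.scaleR_left blinfun.scaleR_right)

lemma scaleC_scaleR_commute: "c *\<^sub>C r *\<^sub>R x = r *\<^sub>R c *\<^sub>C (x::'a::complex_hilbert)"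
  by (simp add: scaleR_scaleC scaleC_scaleC mult.commute)

lemma complex_ops_id [simp]: "id_blinfun \<in> complex_ops"
  by (simp add: complex_ops_def)

lemma complex_ops_compose: "A \<in> complex_ops \<Longrightarrow> B \<in> complex_ops \<Longrightarrow> A o\<^sub>L B \<in> complex_ops"
  by (simp add: complex_ops_def)

lemma complex_ops_add: "A \<in> complex_ops \<Longrightarrow> B \<in> complex_ops \<Longrightarrow> A + B \<in> complex_ops"
  by (simp add: complex_ops_def blinfun.add_left scaleC_add_right)

lemma complex_ops_zero [simp]: "0 \<in> complex_ops"
  by (simp add: complex_ops_def)

lemma complex_ops_sum: "(\<And>i. i \<in> S \<Longrightarrow> f i \<in> complex_ops) \<Longrightarrow> sum f S \<in> complex_ops"
  by (induction S rule: infinite_finite_induct) (simp_all add: complex_ops_add)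

lemma complex_ops_scaleR: "A \<in> complex_ops \<Longrightarrow> r *\<^sub>R A \<in> complex_ops"
  by (simp add: complex_ops_def blinfun.scaleR_left scaleC_scaleR_commute)

lemma complex_ops_scaleC_op: "A \<in> complex_ops \<Longrightarrow> scaleC_op c A \<in> complex_ops"
  by (simp add: complex_ops_def scaleC_scaleC mult.commute)

lemma complex_ops_word_op: "(\<And>i. X i \<in> complex_ops) \<Longrightarrow> word_op X \<alpha> \<in> complex_ops"
  by (induction \<alpha>) (simp_all add: complex_ops_compose)

lemma tendsto_blinfun_apply:
  assumes "(f \<longlongrightarrow> A) F"
  shows "((\<lambda>t. blinfun_apply (f t) x) \<longlongrightarrow> A x) F"
  by (rule blinfun.tendsto[OF assms tendsto_const])

lemma complex_ops_limit:
  assumes "(f \<longlongrightarrow> A) F" "\<forall>\<^sub>F t in F. f t \<in> complex_ops" "F \<noteq> bot"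
  shows "A \<in> complex_ops"
  unfolding complex_ops_def
proof (intro CollectI allI)
  fix c x
  show "blinfun_apply A (c *\<^sub>C x) = c *\<^sub>C A x"
  proof (rule tendsto_unique[OF assms(3)])
    show "((\<lambda>t. blinfun_apply (f t) (c *\<^sub>C x)) \<longlongrightarrow> A (c *\<^sub>C x)) F"
      by (rule tendsto_blinfun_apply[OF assms(1)])
    have "((\<lambda>t. c *\<^sub>C blinfun_apply (f t) x) \<longlongrightarrow> c *\<^sub>C A x) F"
      by (intro bounded_linear.tendsto[OF bounded_linear_scaleC] tendsto_blinfun_apply assms)
    then show "((\<lambda>t. blinfun_apply (f t) (c *\<^sub>C x)) \<longlongrightarrow> c *\<^sub>C A x) F"
      by (rule Lim_transform_eventually)
        (use assms(2) in eventually_elim, simp add: complex_ops_scaleC)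
  qed
qed

text \<open>For t >= 0 the inequality says that the row operator [X_1 ... X_n] on the direct sum has
  norm at most t. Tested on families, it needs neither adjoints nor a type for the direct
  sum.\<close>

definition row_bounded :: "real \<Rightarrow> ('n::finite \<Rightarrow> 'a::complex_hilbert \<Rightarrow>\<^sub>L 'a) \<Rightarrow> bool" where
  "row_bounded t X \<longleftrightarrow> (\<forall>i. X i \<in> complex_ops) \<and>
     (\<forall>x. (norm (\<Sum>i\<in>UNIV. X i (x i)))\<^sup>2 \<le> t\<^sup>2 * (\<Sum>i\<in>UNIV. (norm (x i))\<^sup>2))"

lemma row_bounded_complex_ops: "row_bounded t X \<Longrightarrow> X i \<in> complex_ops"
  by (simp add: row_bounded_def)

lemma row_boundedD:
  "row_bounded t X \<Longrightarrow> (norm (\<Sum>i\<in>UNIV. X i (x i)))\<^sup>2 \<le> t\<^sup>2 * (\<Sum>i\<in>UNIV. (norm (x i))\<^sup>2)"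
  by (simp add: row_bounded_def)

lemma row_bounded_scaleR:
  assumes "row_bounded t X"
  shows "row_bounded (r * t) (\<lambda>i. r *\<^sub>R X i)"
  unfolding row_bounded_def
proof (intro conjI allI)
  show "r *\<^sub>R X i \<in> complex_ops" for i
    using assms by (simp add: row_bounded_def complex_ops_scaleR)
  show "(norm (\<Sum>i\<in>UNIV. (r *\<^sub>R X i) (x i)))\<^sup>2 \<le> (r * t)\<^sup>2 * (\<Sum>i\<in>UNIV. (norm (x i))\<^sup>2)" for x
  proof -
    have "(norm (\<Sum>i\<in>UNIV. (r *\<^sub>R X i) (x i)))\<^sup>2 = r\<^sup>2 * (norm (\<Sum>i\<in>UNIV. X i (x i)))\<^sup>2"
      by (simp add: blinfun.scaleR_left power_mult_distrib flip: scaleR_sum_right)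
    also have "\<dots> \<le> r\<^sup>2 * (t\<^sup>2 * (\<Sum>i\<in>UNIV. (norm (x i))\<^sup>2))"
      using row_boundedD[OF assms] by (intro mult_left_mono) auto
    finally show ?thesis by (simp add: power_mult_distrib mult_ac)
  qed
qed

lemma row_bounded_isometries:
  assumes iso: "\<And>i. isometric_op (V i)"
    and orth: "\<And>i j x y. i \<noteq> j \<Longrightarrow> cinner (V i x) (V j y) = 0"
  shows "row_bounded 1 V"
  unfolding row_bounded_def
proof (intro conjI allI)
  show "V i \<in> complex_ops" for i
    using iso by (simp add: isometric_op_def)
  fix x
  have "cinner (\<Sum>i\<in>UNIV. V i (x i)) (\<Sum>i\<in>UNIV. V i (x i)) =
      (\<Sum>i\<in>UNIV. \<Sum>j\<in>UNIV. if j = i then cinner (V i (x i)) (V i (x i)) else 0)"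
    unfolding cinner_sum_left unfolding cinner_sum_right
    by (intro sum.cong refl) (auto simp: orth)
  also have "\<dots> = complex_of_real (\<Sum>i\<in>UNIV. (norm (x i))\<^sup>2)"
    using iso by (simp add: cinner_self isometric_op_def)
  finally show "(norm (\<Sum>i\<in>UNIV. V i (x i)))\<^sup>2 \<le> 1\<^sup>2 * (\<Sum>i\<in>UNIV. (norm (x i))\<^sup>2)"
    by (simp only: cinner_self of_real_eq_iff) simp
qed

text \<open>The row of words of length k + 1 is the row of letters applied after copies of the row
  of words of length k, so the bounds multiply.\<close>

lemma row_bounded_words:
  assumes "row_bounded t X"
  shows "(norm (\<Sum>\<alpha> | length \<alpha> = k. word_op X \<alpha> (x \<alpha>)))\<^sup>2
    \<le> (t ^ k)\<^sup>2 * (\<Sum>\<alpha> | length \<alpha> = k. (norm (x \<alpha>))\<^sup>2)"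
proof (induction k arbitrary: x)
  case (Suc k)
  have "(norm (\<Sum>\<alpha> | length \<alpha> = Suc k. word_op X \<alpha> (x \<alpha>)))\<^sup>2
      = (norm (\<Sum>i\<in>UNIV. X i (\<Sum>\<alpha> | length \<alpha> = k. word_op X \<alpha> (x (i # \<alpha>)))))\<^sup>2"
    by (simp add: sum_words_Suc blinfun.sum_right)
  also have "\<dots> \<le> t\<^sup>2 * (\<Sum>i\<in>UNIV. (norm (\<Sum>\<alpha> | length \<alpha> = k. word_op X \<alpha> (x (i # \<alpha>))))\<^sup>2)"
    by (rule row_boundedD[OF assms])
  also have "\<dots> \<le> t\<^sup>2 * (\<Sum>i\<in>UNIV. (t ^ k)\<^sup>2 * (\<Sum>\<alpha> | length \<alpha> = k. (norm (x (i # \<alpha>)))\<^sup>2))"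
    by (intro mult_left_mono sum_mono Suc.IH) simp
  also have "\<dots> = (t ^ Suc k)\<^sup>2 * (\<Sum>\<alpha> | length \<alpha> = Suc k. (norm (x \<alpha>))\<^sup>2)"
    by (simp add: sum_words_Suc sum_distrib_left power_mult_distrib mult.assoc)
  finally show ?case .
qed simp

section \<open>Convergence of free power series inside the ball\<close>

definition coeff_norm :: "('n::finite list \<Rightarrow> complex) \<Rightarrow> nat \<Rightarrow> real" where
  "coeff_norm a k = sqrt (\<Sum>\<alpha> | length \<alpha> = k. (cmod (a \<alpha>))\<^sup>2)"

lemma coeff_norm_nonneg [simp]: "0 \<le> coeff_norm a k"
  by (simp add: coeff_norm_def sum_nonneg)

lemma coeff_norm_square: "(coeff_norm a k)\<^sup>2 = (\<Sum>\<alpha> | length \<alpha> = k. (cmod (a \<alpha>))\<^sup>2)"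
  by (simp add: coeff_norm_def sum_nonneg)

definition hom_part ::
    "('n::finite list \<Rightarrow> complex) \<Rightarrow> ('n \<Rightarrow> 'a::complex_hilbert \<Rightarrow>\<^sub>L 'a) \<Rightarrow> nat \<Rightarrow> 'a \<Rightarrow>\<^sub>L 'a" where
  "hom_part a X k = (\<Sum>\<alpha> | length \<alpha> = k. scaleC_op (a \<alpha>) (word_op X \<alpha>))"

lemma free_eval_hom_part: "free_eval a X = suminf (hom_part a X)"
  by (simp add: free_eval_def hom_part_def[abs_def])

lemma hom_part_apply: "hom_part a X k x = (\<Sum>\<alpha> | length \<alpha> = k. a \<alpha> *\<^sub>C word_op X \<alpha> x)"
  by (simp add: hom_part_def blinfun.sum_left)

lemma hom_part_complex_ops: "(\<And>i. X i \<in> complex_ops) \<Longrightarrow> hom_part a X k \<in> complex_ops"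
  unfolding hom_part_def by (intro complex_ops_sum complex_ops_scaleC_op complex_ops_word_op)

text \<open>The homogeneous part sends x to the row of words of length k applied to the column of
  all a_\<alpha> x, whose norm is \<open>coeff_norm a k\<close> times that of x.\<close>

lemma norm_hom_part_le:
  assumes X: "row_bounded t X" and "0 \<le> t"
  shows "norm (hom_part a X k) \<le> t ^ k * coeff_norm a k"
proof (rule norm_blinfun_bound)
  show "norm (hom_part a X k x) \<le> t ^ k * coeff_norm a k * norm x" for x
  proof (rule power2_le_imp_le)
    have "hom_part a X k x = (\<Sum>\<alpha> | length \<alpha> = k. word_op X \<alpha> (a \<alpha> *\<^sub>C x))"
      using X by (simp add: hom_part_apply complex_ops_scaleC complex_ops_word_op row_bounded_def)
    then have "(norm (hom_part a X k x))\<^sup>2 \<le> (t ^ k)\<^sup>2 * (\<Sum>\<alpha> | length \<alpha> = k. (norm (a \<alpha> *\<^sub>C x))\<^sup>2)"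
      using row_bounded_words[OF X, where x = "\<lambda>\<alpha>. a \<alpha> *\<^sub>C x" and k = k] by (simp only:)
    also have "\<dots> = (t ^ k * coeff_norm a k * norm x)\<^sup>2"
      by (simp add: norm_scaleC power_mult_distrib coeff_norm_square mult.assoc sum_distrib_right)
    finally show "(norm (hom_part a X k x))\<^sup>2 \<le> (t ^ k * coeff_norm a k * norm x)\<^sup>2" .
  qed (use assms in simp)
qed (use assms in simp)

lemma summable_coeff_norm:
  assumes a: "free_holomorphic a" and t: "0 \<le> t" "t < 1"
  shows "summable (\<lambda>k. t ^ k * coeff_norm a k)"
proof -
  \<comment> \<open>A number strictly between 1 and 1/t, namely their midpoint; for t = 0 any number
    above 1 serves. The root test then compares with the geometric series of ratio t R.\<close>
  define R where "R = (if t = 0 then 2 else 1 + (1 / t - 1) / 2)"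
  have R: "1 < R" "t * R < 1"
    using t by (auto simp: R_def field_simps)
  have "limsup (\<lambda>k. ereal (root (2 * k) (\<Sum>\<alpha> | length \<alpha> = k. (cmod (a \<alpha>))\<^sup>2))) < ereal R"
    using a unfolding free_holomorphic_def by (rule le_less_trans) (use R in simp)
  then have "\<forall>\<^sub>F k in sequentially. ereal (root (2 * k) (\<Sum>\<alpha> | length \<alpha> = k. (cmod (a \<alpha>))\<^sup>2)) < ereal R"
    by (rule Limsup_lessD)
  then have ev: "\<forall>\<^sub>F k in sequentially. norm (t ^ k * coeff_norm a k) \<le> (t * R) ^ k"
    \<comment> \<open>The index k = 0 is excluded because \<open>root 0\<close> is constantly 0 and
      inverts no power.\<close>
    using eventually_gt_at_top[of 0]
  proof eventually_elim
    case (elim k)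
    let ?s = "\<Sum>\<alpha> | length \<alpha> = k. (cmod (a \<alpha>))\<^sup>2"
    have s: "0 \<le> ?s" by (intro sum_nonneg) simp
    have "?s = root (2 * k) ?s ^ (2 * k)"
      using elim s by (intro real_root_pow_pos2[symmetric]) auto
    also have "\<dots> \<le> R ^ (2 * k)"
      using elim s by (intro power_mono) auto
    finally have "(coeff_norm a k)\<^sup>2 \<le> (R ^ k)\<^sup>2"
      by (simp add: coeff_norm_square power_mult[symmetric] mult.commute)
    then have "coeff_norm a k \<le> R ^ k"
      by (rule power2_le_imp_le) (use R in simp)
    then show ?case
      using t by (simp add: power_mult_distrib mult_left_mono)
  qed
  show ?thesis
    by (rule summable_comparison_test_ev[OF ev]) (use t R in \<open>simp add: summable_geometric\<close>)
qed

lemma hom_part_scaleR: "hom_part a (\<lambda>i. r *\<^sub>R X i) k = r ^ k *\<^sub>R hom_part a X k"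
  by (rule blinfun_eqI)
    (simp add: hom_part_apply word_op_scaleR blinfun.scaleR_left scaleC_scaleR_commute scaleR_sum_right)

lemma summable_hom_part:
  assumes "free_holomorphic a" "row_bounded t X" "0 \<le> t" "t < 1"
  shows "summable (\<lambda>k. norm (hom_part a X k))"
  by (rule summable_comparison_test'[OF summable_coeff_norm[OF assms(1,3,4)]])
    (use norm_hom_part_le[OF assms(2,3)] in auto)

lemma hom_part_sums:
  assumes "free_holomorphic a" "row_bounded t X" "0 \<le> t" "t < 1"
  shows "hom_part a X sums free_eval a X"
  unfolding free_eval_hom_part
  by (rule summable_sums[OF summable_norm_cancel[OF summable_hom_part[OF assms]]])

lemma free_eval_complex_ops:
  assumes "free_holomorphic a" "row_bounded t X" "0 \<le> t" "t < 1"
  shows "free_eval a X \<in> complex_ops"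
proof (rule complex_ops_limit)
  show "(\<lambda>n. \<Sum>k<n. hom_part a X k) \<longlonglongrightarrow> free_eval a X"
    using hom_part_sums[OF assms] by (simp add: sums_def)
  show "\<forall>\<^sub>F n in sequentially. (\<Sum>k<n. hom_part a X k) \<in> complex_ops"
    using assms(2) by (intro always_eventually allI complex_ops_sum hom_part_complex_ops)
      (simp add: row_bounded_def)
qed simp

section \<open>The noncommutative von Neumann inequality\<close>

definition row_isometry :: "('n \<Rightarrow> 'a::complex_hilbert \<Rightarrow>\<^sub>L 'a) \<Rightarrow> bool" where
  "row_isometry V \<longleftrightarrow> (\<forall>i. isometric_op (V i)) \<and> (\<forall>i j. i \<noteq> j \<longrightarrow> (\<forall>x y. cinner (V i x) (V j y) = 0))"

lemma row_isometry_row_bounded: "row_isometry V \<Longrightarrow> row_bounded 1 V"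
  by (intro row_bounded_isometries) (auto simp: row_isometry_def)

lemma row_isometry_complex_ops: "row_isometry V \<Longrightarrow> V i \<in> complex_ops"
  by (simp add: row_isometry_def isometric_op_def)

lemma isometric_op_cinner:
  assumes "isometric_op A"
  shows "cinner (A x) (A y) = cinner x y"
proof -
  have A: "A \<in> complex_ops" "norm (A x) = norm x" for x
    using assms by (auto simp: isometric_op_def)
  have re: "Re (cinner (A x) (A y)) = Re (cinner x y)" for x y
    using norm_add_square[of "A x" "A y"] norm_add_square[of x y]
    by (simp add: A(2) flip: blinfun.add_right)
  have "Im (cinner (A x) (A y)) = Im (cinner x y)"
    using re[of x "\<i> *\<^sub>C y"] by (simp add: complex_ops_scaleC[OF A(1)] cinner_scaleC_right)
  with re show ?thesis
    by (intro complex_eqI)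
qed

lemma row_isometry_cinner:
  assumes "row_isometry V"
  shows "cinner (V i x) (V j y) = (if i = j then cinner x y else 0)"
  using assms by (simp add: row_isometry_def isometric_op_cinner)

lemma row_isometry_left_creation: "row_isometry left_creation"
proof -
  have "creation i (c *\<^sub>C \<phi>) = c *\<^sub>C creation i \<phi>" for i :: 'n and c \<phi>
    by transfer (auto split: list.split)
  moreover have "cinner (creation i \<phi>) (creation j \<psi>) = 0" if "i \<noteq> j" for i j :: 'n and \<phi> \<psi>
    using that by transfer (auto intro!: infsum_0 split: list.split)
  ultimately show ?thesis
    by (auto simp: row_isometry_def isometric_op_def complex_ops_def norm_creation)
qed

lemma Rep_word_op_left_creation:
  "Rep_ell2 (word_op left_creation \<gamma> \<phi>) \<beta> =
     (if take (length \<gamma>) \<beta> = \<gamma> then Rep_ell2 \<phi> (drop (length \<gamma>) \<beta>) else 0)"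
  by (induction \<gamma> arbitrary: \<beta>) (auto simp: creation.rep_eq split: list.split)

section \<open>Polynomials in the creation operators as Toeplitz sums\<close>

definition fin_vec :: "'i set \<Rightarrow> ('i \<Rightarrow> complex) \<Rightarrow> 'i ell2" where
  "fin_vec S f = Abs_ell2 (\<lambda>i. if i \<in> S then f i else 0)"

lemma Rep_fin_vec:
  assumes "finite S"
  shows "Rep_ell2 (fin_vec S f) i = (if i \<in> S then f i else 0)"
proof -
  have "(\<lambda>i. (cmod (if i \<in> S then f i else 0))\<^sup>2) summable_on UNIV"
    using summable_on_finite[OF assms, of "\<lambda>i. (cmod (f i))\<^sup>2"]
    by (rule summable_on_cong_neutral[THEN iffD1, rotated -1]) auto
  then show ?thesis
    by (simp add: fin_vec_def Abs_ell2_inverse)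
qed

lemma cinner_fin_vec:
  assumes "finite S"
  shows "cinner x (fin_vec S f) = (\<Sum>i\<in>S. Rep_ell2 x i * cnj (f i))"
  unfolding cinner_ell2.rep_eq
  by (intro infsumI has_sum_finite_neutralI[OF assms]) (auto simp: Rep_fin_vec[OF assms] intro!: sum.cong)

lemma norm_fin_vec:
  assumes "finite S"
  shows "(norm (fin_vec S f))\<^sup>2 = (\<Sum>i\<in>S. (cmod (f i))\<^sup>2)"
  unfolding norm_ell2_square
  by (intro infsumI has_sum_finite_neutralI[OF assms]) (auto simp: Rep_fin_vec[OF assms] intro!: sum.cong)

text \<open>The coefficient of S_\<gamma> u at \<gamma>\<delta> is u_\<delta>. The words that occur
  have length at most N + d, so truncating v there cuts off nothing.\<close>

lemma cinner_word_left_creation_fin_vec: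
  fixes u v :: "'n::finite list \<Rightarrow> complex"
  assumes "length \<gamma> \<le> d"
  shows "cinner (word_op left_creation \<gamma> (fin_vec {\<delta>. length \<delta> \<le> N} u)) (fin_vec {\<beta>. length \<beta> \<le> N + d} v)
    = (\<Sum>\<delta> | length \<delta> \<le> N. u \<delta> * cnj (v (\<gamma> @ \<delta>)))"
proof -
  let ?f = "\<lambda>\<beta>. Rep_ell2 (word_op left_creation \<gamma> (fin_vec {\<delta>. length \<delta> \<le> N} u)) \<beta> * cnj (v \<beta>)"
  have "(\<Sum>\<delta> | length \<delta> \<le> N. u \<delta> * cnj (v (\<gamma> @ \<delta>))) = (\<Sum>\<beta> \<in> (@) \<gamma> ` {\<delta>. length \<delta> \<le> N}. ?f \<beta>)"
    by (subst sum.reindex) (auto simp: inj_on_def Rep_word_op_left_creation Rep_fin_vec)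
  also have "\<dots> = (\<Sum>\<beta> | length \<beta> \<le> N + d. ?f \<beta>)"
  proof (rule sum.mono_neutral_left)
    show "\<forall>\<beta> \<in> {\<beta>. length \<beta> \<le> N + d} - (@) \<gamma> ` {\<delta>. length \<delta> \<le> N}. ?f \<beta> = 0"
    proof
      fix \<beta> assume \<beta>: "\<beta> \<in> {\<beta>. length \<beta> \<le> N + d} - (@) \<gamma> ` {\<delta>. length \<delta> \<le> N}"
      have "\<beta> \<in> (@) \<gamma> ` {\<delta>. length \<delta> \<le> N}"
        if "take (length \<gamma>) \<beta> = \<gamma>" "length (drop (length \<gamma>) \<beta>) \<le> N"
        using append_take_drop_id[of "length \<gamma>" \<beta>] that by (metis image_eqI mem_Collect_eq)
      with \<beta> show "?f \<beta> = 0"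
        by (auto simp: Rep_word_op_left_creation Rep_fin_vec)
    qed
  qed (use assms in auto)
  finally show ?thesis
    by (simp add: cinner_fin_vec)
qed

definition poly_eval ::
    "('n::finite list \<Rightarrow> complex) \<Rightarrow> nat \<Rightarrow> ('n \<Rightarrow> 'a::complex_hilbert \<Rightarrow>\<^sub>L 'a) \<Rightarrow> 'a \<Rightarrow>\<^sub>L 'a" where
  "poly_eval b d X = (\<Sum>k\<le>d. hom_part b X k)"

lemma poly_eval_apply: "poly_eval b d X x = (\<Sum>\<gamma> | length \<gamma> \<le> d. b \<gamma> *\<^sub>C word_op X \<gamma> x)"
  by (simp add: poly_eval_def sum_words_le blinfun.sum_left hom_part_apply)

text \<open>The double sum is <p(S) u, v> for the truncations of u and v as Fock space vectors and
  the polynomial p with coefficients b.\<close>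

lemma toeplitz_bound_scalar:
  fixes u v :: "'n::finite list \<Rightarrow> complex"
  shows "cmod (\<Sum>\<gamma> | length \<gamma> \<le> d. b \<gamma> * (\<Sum>\<delta> | length \<delta> \<le> N. u \<delta> * cnj (v (\<gamma> @ \<delta>))))
    \<le> norm (poly_eval b d left_creation) *
      (sqrt (\<Sum>\<delta> | length \<delta> \<le> N. (cmod (u \<delta>))\<^sup>2) * sqrt (\<Sum>\<beta> | length \<beta> \<le> N + d. (cmod (v \<beta>))\<^sup>2))"
proof -
  define U where "U = fin_vec {\<delta>. length \<delta> \<le> N} u"
  define W where "W = fin_vec {\<beta>. length \<beta> \<le> N + d} v"
  have "(\<Sum>\<gamma> | length \<gamma> \<le> d. b \<gamma> * (\<Sum>\<delta> | length \<delta> \<le> N. u \<delta> * cnj (v (\<gamma> @ \<delta>)))) =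
      cinner (poly_eval b d left_creation U) W"
    by (simp add: poly_eval_apply cinner_sum_left cinner_scaleC_left U_def W_def
        cinner_word_left_creation_fin_vec)
  also have "cmod \<dots> \<le> norm (poly_eval b d left_creation U) * norm W"
    by (rule norm_cinner_le)
  also have "\<dots> \<le> norm (poly_eval b d left_creation) * norm U * norm W"
    by (intro mult_right_mono norm_blinfun) simp
  finally show ?thesis
    unfolding U_def W_def norm_fin_vec[OF finite_words_le, symmetric]
    by (simp add: mult.assoc)
qed

lemma fourier_cinner:
  assumes "fourier_sum E x = x"
  shows "cinner x y = (\<Sum>e\<in>E. cinner x e * cnj (cinner y e))"
proof -
  have "cinner x y = cinner (fourier_sum E x) y"
    by (simp add: assms)
  also have "\<dots> = (\<Sum>e\<in>E. cinner x e * cinner e y)"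
    by (simp add: fourier_sum_def cinner_sum_left cinner_scaleC_left)
  finally show ?thesis
    by (simp flip: cinner_commute)
qed

lemma parseval_finite:
  assumes "fourier_sum E x = x"
  shows "(norm x)\<^sup>2 = (\<Sum>e\<in>E. (cmod (cinner x e))\<^sup>2)"
proof -
  have "complex_of_real ((norm x)\<^sup>2) = complex_of_real (\<Sum>e\<in>E. (cmod (cinner x e))\<^sup>2)"
    using fourier_cinner[OF assms, of x] by (simp add: cinner_self complex_norm_square del: of_real_power)
  then show ?thesis
    by (simp only: of_real_eq_iff)
qed

text \<open>Vector coefficients amount to replacing p(S) by its tensor product with the identity,
  which has the same norm. In coordinates: the scalar bound holds along each member of a finite
  orthonormal system whose span contains all the vectors, and Cauchy--Schwarz sums these
  bounds.\<close>

lemma toeplitz_bound: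
  fixes u v :: "'n::finite list \<Rightarrow> 'a::complex_hilbert"
  shows "cmod (\<Sum>\<gamma> | length \<gamma> \<le> d. b \<gamma> * (\<Sum>\<delta> | length \<delta> \<le> N. cinner (u \<delta>) (v (\<gamma> @ \<delta>))))
    \<le> norm (poly_eval b d left_creation) *
      (sqrt (\<Sum>\<delta> | length \<delta> \<le> N. (norm (u \<delta>))\<^sup>2) * sqrt (\<Sum>\<beta> | length \<beta> \<le> N + d. (norm (v \<beta>))\<^sup>2))"
    (is "cmod ?l \<le> ?C * (sqrt ?u * sqrt ?v)")
proof -
  obtain E where E: "orthonormal E"
    "\<forall>x \<in> u ` {\<delta>. length \<delta> \<le> N} \<union> v ` {\<beta>. length \<beta> \<le> N + d}. fourier_sum E x = x"
    using finite_orthonormal_basis[of "u ` {\<delta>. length \<delta> \<le> N} \<union> v ` {\<beta>. length \<beta> \<le> N + d}"] by auto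
  define ue where "ue = (\<lambda>e. \<Sum>\<delta> | length \<delta> \<le> N. (cmod (cinner (u \<delta>) e))\<^sup>2)"
  define ve where "ve = (\<lambda>e. \<Sum>\<beta> | length \<beta> \<le> N + d. (cmod (cinner (v \<beta>) e))\<^sup>2)"
  have "?l = (\<Sum>\<gamma> | length \<gamma> \<le> d. \<Sum>e\<in>E.
      b \<gamma> * (\<Sum>\<delta> | length \<delta> \<le> N. cinner (u \<delta>) e * cnj (cinner (v (\<gamma> @ \<delta>)) e)))"
  proof (rule sum.cong[OF refl])
    fix \<gamma> :: "'n list"
    have "(\<Sum>\<delta> | length \<delta> \<le> N. cinner (u \<delta>) (v (\<gamma> @ \<delta>))) =
        (\<Sum>\<delta> | length \<delta> \<le> N. \<Sum>e\<in>E. cinner (u \<delta>) e * cnj (cinner (v (\<gamma> @ \<delta>)) e))"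
      by (intro sum.cong refl fourier_cinner) (use E in auto)
    also have "\<dots> = (\<Sum>e\<in>E. \<Sum>\<delta> | length \<delta> \<le> N. cinner (u \<delta>) e * cnj (cinner (v (\<gamma> @ \<delta>)) e))"
      by (rule sum.swap)
    finally show "b \<gamma> * (\<Sum>\<delta> | length \<delta> \<le> N. cinner (u \<delta>) (v (\<gamma> @ \<delta>))) = (\<Sum>e\<in>E.
        b \<gamma> * (\<Sum>\<delta> | length \<delta> \<le> N. cinner (u \<delta>) e * cnj (cinner (v (\<gamma> @ \<delta>)) e)))"
      by (simp add: sum_distrib_left)
  qed
  also have "\<dots> = (\<Sum>e\<in>E. \<Sum>\<gamma> | length \<gamma> \<le> d.
      b \<gamma> * (\<Sum>\<delta> | length \<delta> \<le> N. cinner (u \<delta>) e * cnj (cinner (v (\<gamma> @ \<delta>)) e)))"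
    by (rule sum.swap)
  also have "cmod \<dots> \<le> (\<Sum>e\<in>E. ?C * (sqrt (ue e) * sqrt (ve e)))"
    unfolding ue_def ve_def by (intro sum_norm_le toeplitz_bound_scalar)
  also have "\<dots> = ?C * (\<Sum>e\<in>E. \<bar>sqrt (ue e)\<bar> * \<bar>sqrt (ve e)\<bar>)"
    by (simp add: sum_distrib_left ue_def ve_def sum_nonneg)
  also have "\<dots> \<le> ?C * (L2_set (\<lambda>e. sqrt (ue e)) E * L2_set (\<lambda>e. sqrt (ve e)) E)"
    by (intro mult_left_mono L2_set_mult_ineq) simp
  also have "L2_set (\<lambda>e. sqrt (ue e)) E = sqrt (\<Sum>e\<in>E. ue e)"
    by (simp add: L2_set_def ue_def sum_nonneg)
  also have "L2_set (\<lambda>e. sqrt (ve e)) E = sqrt (\<Sum>e\<in>E. ve e)"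
    by (simp add: L2_set_def ve_def sum_nonneg)
  also have "(\<Sum>e\<in>E. ue e) = ?u"
    unfolding ue_def by (subst sum.swap) (use E in \<open>auto intro!: sum.cong parseval_finite[symmetric]\<close>)
  also have "(\<Sum>e\<in>E. ve e) = ?v"
    unfolding ve_def by (subst sum.swap) (use E in \<open>auto intro!: sum.cong parseval_finite[symmetric]\<close>)
  finally show ?thesis .
qed

section \<open>The noncommutative Poisson kernel of a row isometry\<close>

text \<open>A row and its adjoint column obey the same bound. If s is the squared norm of the column
  of adjoints at y, and z is the row applied to this column, then s = <z, y>, so s^2 is at most t^2
  s times the squared norm of y.\<close>

lemma adjoint_bound:
  assumes X: "\<And>i. X i \<in> complex_ops" and "finite S" and "0 \<le> t"
    and bnd: "\<And>x. (norm (\<Sum>i\<in>S. blinfun_apply (X i) (x i)))\<^sup>2 \<le> t\<^sup>2 * (\<Sum>i\<in>S. (norm (x i))\<^sup>2)"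
  shows "(\<Sum>i\<in>S. (norm (cadjoint (X i) y))\<^sup>2) \<le> t\<^sup>2 * (norm y)\<^sup>2"
proof -
  define s where "s = (\<Sum>i\<in>S. (norm (cadjoint (X i) y))\<^sup>2)"
  define z where "z = (\<Sum>i\<in>S. X i (cadjoint (X i) y))"
  have s0: "0 \<le> s" by (simp add: s_def sum_nonneg)
  have "complex_of_real s = cinner z y"
    by (simp add: s_def z_def cinner_sum_left cinner_cadjoint[OF X] cinner_self)
  then have "s = Re (cinner z y)"
    by (metis Re_complex_of_real)
  also have "\<dots> \<le> norm z * norm y"
    unfolding Re_cinner by (rule norm_cauchy_schwarz)
  finally have "s\<^sup>2 \<le> (norm z)\<^sup>2 * (norm y)\<^sup>2"
    using s0 by (metis power_mono power_mult_distrib)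
  also have "\<dots> \<le> (t\<^sup>2 * s) * (norm y)\<^sup>2"
    unfolding z_def s_def by (intro mult_right_mono bnd) simp
  finally have "s * s \<le> s * (t\<^sup>2 * (norm y)\<^sup>2)"
    by (simp add: power2_eq_square mult_ac)
  then show ?thesis
    using s0 unfolding s_def[symmetric]
    by (cases "s = 0") (simp_all add: mult_le_cancel_left)
qed

lemma adjoint_word_bound:
  fixes X :: "'n::finite \<Rightarrow> 'a::complex_hilbert \<Rightarrow>\<^sub>L 'a"
  assumes "row_bounded t X" "0 \<le> t"
  shows "(\<Sum>\<alpha> | length \<alpha> = k. (norm (cadjoint (word_op X \<alpha>) y))\<^sup>2) \<le> (t ^ k)\<^sup>2 * (norm y)\<^sup>2"
  using assms row_bounded_words[OF assms(1)]
  by (intro adjoint_bound complex_ops_word_op) (auto simp: row_bounded_def)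

lemma cadjoint_word_append:
  assumes "\<And>i. X i \<in> complex_ops"
  shows "cadjoint (word_op X (\<alpha> @ \<beta>)) y = cadjoint (word_op X \<beta>) (cadjoint (word_op X \<alpha>) y)"
  using assms
  by (intro cadjoint_eqI complex_ops_word_op)
    (simp_all add: word_op_append_apply flip: cinner_cadjoint[OF complex_ops_word_op])

text \<open>Adjoints reverse words: for the word \<delta> followed by i, the adjoint of V_i acts
  after that of V_\<delta>. The Poisson sums therefore pass from one level to the next by a letter
  on the right.\<close>

lemma sum_words_snoc:
  fixes f :: "'n::finite list \<Rightarrow> 'a::comm_monoid_add"
  shows "(\<Sum>\<alpha> | length \<alpha> = Suc k. f \<alpha>) = (\<Sum>\<alpha> | length \<alpha> = k. \<Sum>i\<in>UNIV. f (\<alpha> @ [i]))"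
proof (induction k arbitrary: f)
  case 0
  then show ?case using sum_words_Suc[of f 0] by simp
next
  case (Suc k)
  have "(\<Sum>\<alpha> | length \<alpha> = Suc (Suc k). f \<alpha>) = (\<Sum>i\<in>UNIV. \<Sum>\<alpha> | length \<alpha> = k. \<Sum>j\<in>UNIV. f (i # \<alpha> @ [j]))"
    by (subst sum_words_Suc) (simp add: Suc)
  then show ?case
    by (simp add: sum_words_Suc)
qed

text \<open>Since $Q = \sum_i V_i V_i^*$ is a projection, \<open>defect t V\<close> is the square root of
  $I - t^2 Q$, the defect operator of $t V$.\<close>

definition defect :: "real \<Rightarrow> ('n::finite \<Rightarrow> 'a::complex_hilbert \<Rightarrow>\<^sub>L 'a) \<Rightarrow> 'a \<Rightarrow> 'a" where
  "defect t V x = x - (1 - sqrt (1 - t\<^sup>2)) *\<^sub>R (\<Sum>i\<in>UNIV. V i (cadjoint (V i) x))"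

text \<open>The component at \<delta> of the noncommutative Poisson kernel of t V, a map into the
  tensor product of Fock space with \<open>'a\<close>. For t < 1 it is isometric, and it intertwines
  the adjoints of words in t V with those of words in the creation operators; this allows bounds on
  Fock space to be transferred to V.\<close>

definition poisson ::
    "real \<Rightarrow> ('n::finite \<Rightarrow> 'a::complex_hilbert \<Rightarrow>\<^sub>L 'a) \<Rightarrow> 'a \<Rightarrow> 'n list \<Rightarrow> 'a" where
  "poisson t V x \<delta> = t ^ length \<delta> *\<^sub>R defect t V (cadjoint (word_op V \<delta>) x)"

context
  fixes V :: "'n::finite \<Rightarrow> 'a::complex_hilbert \<Rightarrow>\<^sub>L 'a"
  assumes V: "row_isometry V"
begin

lemma cinner_defect:
  assumes "0 \<le> t" "t \<le> 1"
  shows "cinner (defect t V x) (defect t V z) = cinner x z -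
    complex_of_real (t\<^sup>2) * (\<Sum>i\<in>UNIV. cinner (cadjoint (V i) x) (cadjoint (V i) z))"
proof -
  define Q where "Q = (\<lambda>x. \<Sum>i\<in>UNIV. V i (cadjoint (V i) x))"
  define q where "q = (\<Sum>i\<in>UNIV. cinner (cadjoint (V i) x) (cadjoint (V i) z))"
  define c where "c = 1 - sqrt (1 - t\<^sup>2)"
  have "t\<^sup>2 \<le> 1"
    using assms by (simp add: power_le_one)
  \<comment> \<open>This is (1 - c)^2 = 1 - t^2. Since Q is a self-adjoint idempotent, (I - c Q)^2 =
    I + (c^2 - 2 c) Q.\<close>
  then have "c * c - 2 * c = - t\<^sup>2"
    by (simp add: c_def algebra_simps)
  then have c: "complex_of_real c * complex_of_real c - 2 * complex_of_real c = - complex_of_real (t\<^sup>2)"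
    by (metis of_real_diff of_real_minus of_real_mult of_real_numeral)
  have 1: "cinner (Q x) z = q"
    by (simp add: Q_def q_def cinner_sum_left cinner_cadjoint[OF row_isometry_complex_ops[OF V]])
  have "cinner z (Q x) = cnj q" if "cinner (Q x) z = q" for x z q
    using that by (metis cinner_commute)
  moreover have "cinner (Q z) x = cnj q"
    by (simp add: Q_def q_def cinner_sum_left cinner_cadjoint[OF row_isometry_complex_ops[OF V]])
      (simp flip: cinner_commute)
  ultimately have 2: "cinner x (Q z) = q"
    by (metis complex_cnj_cnj)
  have 3: "cinner (Q x) (Q z) = q"
    by (simp add: Q_def q_def cinner_sum_left cinner_sum_right row_isometry_cinner[OF V])
  have def: "defect t V x = x - c *\<^sub>R Q x" for x
    by (simp add: defect_def Q_def c_def)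
  have "cinner (defect t V x) (defect t V z) = cinner x z +
      (complex_of_real c * complex_of_real c - 2 * complex_of_real c) * q"
    unfolding def cinner_simps 1 2 3 by (simp add: algebra_simps)
  then show ?thesis
    by (simp add: c q_def)
qed

text \<open>Telescoping: the squared defect operator I - t^2 Q turns the sum over level k into
  \<open>q k - q (Suc k)\<close>, and \<open>q 0\<close> is <x, z>.\<close>

lemma poisson_sum:
  assumes "0 \<le> t" "t \<le> 1"
  shows "(\<Sum>\<delta> | length \<delta> \<le> N. cinner (poisson t V x \<delta>) (poisson t V z \<delta>)) = cinner x z -
    complex_of_real (t ^ (2 * Suc N)) *
      (\<Sum>\<delta> | length \<delta> = Suc N. cinner (cadjoint (word_op V \<delta>) x) (cadjoint (word_op V \<delta>) z))"
proof -
  define q where "q = (\<lambda>k. complex_of_real (t ^ (2 * k)) *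
    (\<Sum>\<delta> | length \<delta> = k. cinner (cadjoint (word_op V \<delta>) x) (cadjoint (word_op V \<delta>) z)))"
  have Vc: "V i \<in> complex_ops" for i
    by (rule row_isometry_complex_ops[OF V])
  have level: "(\<Sum>\<delta> | length \<delta> = k. cinner (poisson t V x \<delta>) (poisson t V z \<delta>)) = q k - q (Suc k)" for k
  proof -
    have Vid: "V i o\<^sub>L id_blinfun = V i" for i
      by (rule blinfun_eqI) simp
    have pow: "t ^ (2 * k) = t ^ k * t ^ k" "t ^ (2 * Suc k) = t ^ k * t ^ k * t\<^sup>2"
      by (simp_all add: mult_2 power_add power2_eq_square)
    have snoc: "cadjoint (word_op V (\<delta> @ [i])) y = cadjoint (V i) (cadjoint (word_op V \<delta>) y)" for \<delta> i y
      using cadjoint_word_append[of V \<delta> "[i]" y, OF Vc] by (simp add: Vid)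
    have "(\<Sum>\<delta> | length \<delta> = k. cinner (poisson t V x \<delta>) (poisson t V z \<delta>)) =
      (\<Sum>\<delta> | length \<delta> = k. complex_of_real (t ^ (2 * k)) *
         cinner (cadjoint (word_op V \<delta>) x) (cadjoint (word_op V \<delta>) z) -
         complex_of_real (t ^ (2 * Suc k)) * (\<Sum>i\<in>UNIV. cinner (cadjoint (word_op V (\<delta> @ [i])) x)
           (cadjoint (word_op V (\<delta> @ [i])) z)))"
      unfolding pow by (intro sum.cong refl)
        (simp add: poisson_def cinner_simps cinner_defect[OF assms] snoc right_diff_distrib
          power2_eq_square mult_ac)
    also have "\<dots> = q k - q (Suc k)"
      by (simp only: q_def sum_subtractf sum_distrib_left sum_words_snoc)
    finally show ?thesis .
  qed
  have "(\<Sum>\<delta> | length \<delta> \<le> N. cinner (poisson t V x \<delta>) (poisson t V z \<delta>)) = q 0 - q (Suc N)"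
    unfolding sum_words_le level by (induction N) simp_all
  moreover have "cadjoint id_blinfun y = y" for y :: 'a
    by (intro cadjoint_eqI) simp_all
  ultimately show ?thesis
    by (simp add: q_def)
qed

lemma poisson_norm:
  assumes "0 \<le> t" "t \<le> 1"
  shows "(\<Sum>\<delta> | length \<delta> \<le> N. (norm (poisson t V x \<delta>))\<^sup>2) \<le> (norm x)\<^sup>2"
proof -
  have "complex_of_real (\<Sum>\<delta> | length \<delta> \<le> N. (norm (poisson t V x \<delta>))\<^sup>2) =
    complex_of_real ((norm x)\<^sup>2 -
      t ^ (2 * Suc N) * (\<Sum>\<delta> | length \<delta> = Suc N. (norm (cadjoint (word_op V \<delta>) x))\<^sup>2))"
    using poisson_sum[OF assms, where x = x and z = x and N = N] by (simp add: cinner_self)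
  then have "(\<Sum>\<delta> | length \<delta> \<le> N. (norm (poisson t V x \<delta>))\<^sup>2) = (norm x)\<^sup>2 -
      t ^ (2 * Suc N) * (\<Sum>\<delta> | length \<delta> = Suc N. (norm (cadjoint (word_op V \<delta>) x))\<^sup>2)"
    by (simp only: of_real_eq_iff)
  moreover have "0 \<le> t ^ (2 * Suc N) * (\<Sum>\<delta> | length \<delta> = Suc N. (norm (cadjoint (word_op V \<delta>) x))\<^sup>2)"
    using assms by (intro mult_nonneg_nonneg sum_nonneg) simp_all
  ultimately show ?thesis by linarith
qed

text \<open>The remainder is at most t^(2 (N + 1)) times the product of the norms, because the
  adjoints of the words of one fixed length form a contractive column.\<close>

lemma poisson_isometric:
  assumes "0 \<le> t" "t < 1"
  shows "(\<lambda>N. \<Sum>\<delta> | length \<delta> \<le> N. cinner (poisson t V x \<delta>) (poisson t V z \<delta>)) \<longlonglongrightarrow> cinner x z"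
proof -
  define r where "r = (\<lambda>N. complex_of_real (t ^ (2 * Suc N)) *
      (\<Sum>\<delta> | length \<delta> = Suc N. cinner (cadjoint (word_op V \<delta>) x) (cadjoint (word_op V \<delta>) z)))"
  have "r \<longlonglongrightarrow> 0"
  proof (rule Lim_null_comparison)
    show "\<forall>\<^sub>F N in sequentially. norm (r N) \<le> (t\<^sup>2) ^ Suc N * (norm x * norm z)"
    proof (intro always_eventually allI)
      fix N
      let ?W = "{\<delta>::'n list. length \<delta> = Suc N}"
      let ?a = "\<lambda>x \<delta>. norm (cadjoint (word_op V \<delta>) x)"
      have L2: "L2_set (?a x) ?W \<le> norm x" for x
        unfolding L2_set_def using adjoint_word_bound[OF row_isometry_row_bounded[OF V], where k = "Suc N" and y = x]
        by (intro real_le_lsqrt sum_nonneg) simp_all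
      have "cmod (\<Sum>\<delta>\<in>?W. cinner (cadjoint (word_op V \<delta>) x) (cadjoint (word_op V \<delta>) z)) \<le>
          (\<Sum>\<delta>\<in>?W. \<bar>?a x \<delta>\<bar> * \<bar>?a z \<delta>\<bar>)"
        using norm_cinner_le by (intro sum_norm_le) simp
      also have "\<dots> \<le> L2_set (?a x) ?W * L2_set (?a z) ?W"
        by (rule L2_set_mult_ineq)
      also have "\<dots> \<le> norm x * norm z"
        by (intro mult_mono L2) simp_all
      finally have "norm (r N) \<le> t ^ (2 * Suc N) * (norm x * norm z)"
        using assms unfolding r_def norm_mult by (intro mult_mono) (simp_all add: norm_mult norm_power)
      then show "norm (r N) \<le> (t\<^sup>2) ^ Suc N * (norm x * norm z)"
        by (simp only: power_mult)
    qed
    have "t\<^sup>2 < 1"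
      using assms by (simp add: power_less_one_iff abs_square_less_1)
    then have "(\<lambda>N. (t\<^sup>2) ^ Suc N) \<longlonglongrightarrow> 0"
      by (intro LIMSEQ_Suc LIMSEQ_realpow_zero) simp_all
    from tendsto_mult_left_zero[OF this] show "(\<lambda>N. (t\<^sup>2) ^ Suc N * (norm x * norm z)) \<longlonglongrightarrow> 0" .
  qed
  from tendsto_diff[OF tendsto_const this] show ?thesis
    using assms by (simp add: poisson_sum r_def)
qed

text \<open>By the intertwining \<open>shift\<close>, <p(t V) x, y> is a limit of Toeplitz sums
  formed from the Poisson transforms of x and y. Truncating these transforms leaves norms at most
  those of x and y, so \<open>toeplitz_bound\<close> applies uniformly in N.\<close>

lemma von_neumann_scaled:
  assumes t: "0 \<le> t" "t < 1"
  shows "cmod (\<Sum>\<gamma> | length \<gamma> \<le> d. b \<gamma> * complex_of_real (t ^ length \<gamma>) * cinner (word_op V \<gamma> x) y)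
    \<le> norm (poly_eval b d left_creation) * (norm x * norm y)"
proof (rule LIMSEQ_le_const2)
  have Vc: "V i \<in> complex_ops" for i
    by (rule row_isometry_complex_ops[OF V])
  let ?l = "\<lambda>N. \<Sum>\<gamma> | length \<gamma> \<le> d. b \<gamma> * (\<Sum>\<delta> | length \<delta> \<le> N.
    cinner (poisson t V x \<delta>) (poisson t V y (\<gamma> @ \<delta>)))"
  have shift: "poisson t V y (\<gamma> @ \<delta>) = t ^ length \<gamma> *\<^sub>R poisson t V (cadjoint (word_op V \<gamma>) y) \<delta>" for \<gamma> \<delta>
    by (simp add: poisson_def cadjoint_word_append[OF Vc] power_add)
  have "?l \<longlonglongrightarrow> (\<Sum>\<gamma> | length \<gamma> \<le> d. b \<gamma> * (complex_of_real (t ^ length \<gamma>) *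
      cinner x (cadjoint (word_op V \<gamma>) y)))"
    unfolding shift cinner_scaleR_right sum_distrib_left[symmetric]
    by (intro tendsto_intros poisson_isometric t)
  then show "(\<lambda>N. cmod (?l N)) \<longlonglongrightarrow> cmod (\<Sum>\<gamma> | length \<gamma> \<le> d. b \<gamma> * complex_of_real (t ^ length \<gamma>) *
      cinner (word_op V \<gamma> x) y)"
    by (intro tendsto_norm) (simp add: cinner_cadjoint[OF complex_ops_word_op[OF Vc]] mult.assoc)
  have "cmod (?l N) \<le> norm (poly_eval b d left_creation) * (norm x * norm y)" for N
  proof -
    have "sqrt (\<Sum>\<delta> | length \<delta> \<le> M. (norm (poisson t V w \<delta>))\<^sup>2) \<le> norm w" for M w
      using poisson_norm[of t w M] t by (intro real_le_lsqrt) simp_all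
    then show ?thesis
      by (intro order_trans[OF toeplitz_bound] mult_left_mono mult_mono) (simp_all add: sum_nonneg)
  qed
  then show "\<exists>M. \<forall>N\<ge>M. cmod (?l N) \<le> norm (poly_eval b d left_creation) * (norm x * norm y)"
    by blast
qed

text \<open>A polynomial is continuous in t up to t = 1, and the test vector y = p(V) x turns the
  bound on the form into a bound on the operator.\<close>

lemma von_neumann_poly: "norm (poly_eval b d V) \<le> norm (poly_eval b d left_creation)"
proof (rule norm_blinfun_bound)
  fix x
  define C where "C = norm (poly_eval b d left_creation)"
  define y where "y = poly_eval b d V x"
  have "cmod (cinner y y) \<le> C * (norm x * norm y)"
  proof (rule tendsto_upperbound)
    show "((\<lambda>t::real. cmod (\<Sum>\<gamma> | length \<gamma> \<le> d.
        b \<gamma> * complex_of_real (t ^ length \<gamma>) * cinner (word_op V \<gamma> x) y)) \<longlongrightarrow> cmod (cinner y y)) (at_left 1)"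
    proof -
      have "((\<lambda>t::real. \<Sum>\<gamma> | length \<gamma> \<le> d.
          b \<gamma> * complex_of_real (t ^ length \<gamma>) * cinner (word_op V \<gamma> x) y) \<longlongrightarrow>
        (\<Sum>\<gamma> | length \<gamma> \<le> d. b \<gamma> * complex_of_real (1 ^ length \<gamma>) * cinner (word_op V \<gamma> x) y)) (at_left 1)"
        by (intro tendsto_intros)
      moreover have "(\<Sum>\<gamma> | length \<gamma> \<le> d. b \<gamma> * complex_of_real (1 ^ length \<gamma>) * cinner (word_op V \<gamma> x) y) = cinner y y"
        unfolding y_def poly_eval_apply cinner_sum_left by (simp add: cinner_scaleC_left)
      ultimately show ?thesis
        by (intro tendsto_norm) simp
    qed
    have "\<forall>\<^sub>F t::real in at_left 1. 0 < t \<and> t < 1"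
      using eventually_at_left_real[of 0 1] by simp
    then show "\<forall>\<^sub>F t::real in at_left 1. cmod (\<Sum>\<gamma> | length \<gamma> \<le> d.
        b \<gamma> * complex_of_real (t ^ length \<gamma>) * cinner (word_op V \<gamma> x) y) \<le> C * (norm x * norm y)"
      unfolding C_def by eventually_elim (intro von_neumann_scaled, simp_all)
  qed simp
  then have "norm y * norm y \<le> (C * norm x) * norm y"
    by (simp add: cinner_self power2_eq_square mult_ac norm_mult)
  then have "norm y \<le> C * norm x"
    by (cases "norm y = 0") (simp_all add: C_def)
  then show "norm (poly_eval b d V x) \<le> norm (poly_eval b d left_creation) * norm x"
    by (simp add: y_def C_def)
qed simp

lemma von_neumann_diff:
  assumes a: "free_holomorphic a" and r: "0 \<le> r" "r < 1" and s: "0 \<le> s" "s < 1"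
  shows "norm (free_eval a (\<lambda>i. r *\<^sub>R V i) - free_eval a (\<lambda>i. s *\<^sub>R V i)) \<le>
    norm (free_eval a (\<lambda>i. r *\<^sub>R left_creation i) - free_eval a (\<lambda>i. s *\<^sub>R left_creation i))"
proof -
  \<comment> \<open>The difference f(rX) - f(sX) is again a power series in X, with these
    coefficients. Its partial sums are polynomials in the unscaled X, to which the von Neumann
    inequality applies.\<close>
  define b where "b = (\<lambda>\<alpha>. complex_of_real (r ^ length \<alpha> - s ^ length \<alpha>) * a \<alpha>)"
  have hom: "hom_part b X k = hom_part a (\<lambda>i. r *\<^sub>R X i) k - hom_part a (\<lambda>i. s *\<^sub>R X i) k"
    for X :: "'n \<Rightarrow> 'b::complex_hilbert \<Rightarrow>\<^sub>L 'b" and k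
    unfolding hom_part_scaleR
    by (rule blinfun_eqI)
      (simp add: hom_part_apply b_def blinfun.diff_left blinfun.scaleR_left scaleC_sum_right
        scaleR_scaleC scaleC_scaleC complex_vector.scale_left_diff_distrib left_diff_distrib sum_subtractf)
  have lim: "(\<lambda>d. poly_eval b d X) \<longlonglongrightarrow> free_eval a (\<lambda>i. r *\<^sub>R X i) - free_eval a (\<lambda>i. s *\<^sub>R X i)"
    if "row_isometry X" for X :: "'n \<Rightarrow> 'b::complex_hilbert \<Rightarrow>\<^sub>L 'b"
  proof -
    note X = row_isometry_row_bounded[OF that]
    have "hom_part b X sums (free_eval a (\<lambda>i. r *\<^sub>R X i) - free_eval a (\<lambda>i. s *\<^sub>R X i))"
      unfolding hom using row_bounded_scaleR[OF X, of r] row_bounded_scaleR[OF X, of s] r s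
      by (intro sums_diff[OF hom_part_sums[OF a _ r] hom_part_sums[OF a _ s]]) simp_all
    then show ?thesis
      by (simp add: poly_eval_def sums_def_le)
  qed
  show ?thesis
  proof (rule LIMSEQ_le)
    show "(\<lambda>d. norm (poly_eval b d V)) \<longlonglongrightarrow>
        norm (free_eval a (\<lambda>i. r *\<^sub>R V i) - free_eval a (\<lambda>i. s *\<^sub>R V i))"
      by (intro tendsto_norm lim V)
    show "(\<lambda>d. norm (poly_eval b d left_creation)) \<longlonglongrightarrow>
        norm (free_eval a (\<lambda>i. r *\<^sub>R left_creation i) - free_eval a (\<lambda>i. s *\<^sub>R left_creation i))"
      by (intro tendsto_norm lim row_isometry_left_creation)
  qed (use von_neumann_poly in blast)
qed

text \<open>Convergence at the creation operators gives a Cauchy condition as r tends to 1, which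
  \<open>von_neumann_diff\<close> transfers to V; completeness supplies the limit.\<close>

lemma free_eval_boundary:
  assumes a: "free_holomorphic a"
    and F: "((\<lambda>r::real. free_eval a (\<lambda>i. r *\<^sub>R left_creation i)) \<longlongrightarrow> F) (at_left 1)"
  shows "\<exists>W. ((\<lambda>r::real. free_eval a (\<lambda>i. r *\<^sub>R V i)) \<longlongrightarrow> W) (at_left 1)"
proof -
  define f where "f = (\<lambda>r::real. free_eval a (\<lambda>i. r *\<^sub>R V i))"
  have near: "\<exists>c. 0 \<le> c \<and> c < 1 \<and> (\<forall>r s. c < r \<and> r < 1 \<and> c < s \<and> s < 1 \<longrightarrow> norm (f r - f s) < e)"
    if "0 < e" for e
  proof -
    have "\<forall>\<^sub>F r::real in at_left 1. dist (free_eval a (\<lambda>i. r *\<^sub>R left_creation i)) F < e / 2"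
      using tendstoD[OF F, of "e / 2"] that by simp
    then obtain c where c: "c < 1" "\<And>r. c < r \<Longrightarrow> r < 1 \<Longrightarrow>
        dist (free_eval a (\<lambda>i. r *\<^sub>R left_creation i)) F < e / 2"
      unfolding eventually_at_left_field by blast
    have "norm (f r - f s) < e" if "max 0 c < r" "r < 1" "max 0 c < s" "s < 1" for r s
    proof -
      have "norm (f r - f s) \<le>
          dist (free_eval a (\<lambda>i. r *\<^sub>R left_creation i)) (free_eval a (\<lambda>i. s *\<^sub>R left_creation i))"
        unfolding f_def dist_norm using that by (intro von_neumann_diff[OF a]) simp_all
      also have "\<dots> < e"
        by (rule dist_triangle_half_l[OF c(2) c(2)]) (use that in simp_all)
      finally show ?thesis .
    qed
    then show ?thesis
      using c(1) by (intro exI[of _ "max 0 c"]) auto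
  qed
  \<comment> \<open>A sequence tending to 1 from below yields the candidate W; the estimate in r and
    s then extends convergence to the whole filter.\<close>
  define t where "t = (\<lambda>n. 1 - 1 / real (Suc n))"
  have t: "t \<longlonglongrightarrow> 1" "t n < 1" for n
  proof -
    have "t \<longlonglongrightarrow> 1 - 0"
      unfolding t_def by (intro tendsto_intros LIMSEQ_Suc[OF lim_1_over_n])
    then show "t \<longlonglongrightarrow> 1" by simp
  qed (simp add: t_def)
  have t_ev: "\<exists>M. \<forall>n\<ge>M. c < t n" if "c < 1" for c
    using order_tendstoD(1)[OF t(1) that] by (simp add: eventually_sequentially)
  have "Cauchy (\<lambda>n. f (t n))"
  proof (rule metric_CauchyI)
    fix e :: real assume "0 < e"
    then obtain c where c: "c < 1" "\<forall>r s. c < r \<and> r < 1 \<and> c < s \<and> s < 1 \<longrightarrow> norm (f r - f s) < e"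
      using near by blast
    obtain M where "\<forall>n\<ge>M. c < t n"
      using t_ev[OF c(1)] by blast
    then show "\<exists>M. \<forall>m\<ge>M. \<forall>n\<ge>M. dist (f (t m)) (f (t n)) < e"
      using c(2) t(2) unfolding dist_norm by blast
  qed
  then obtain W where W: "(\<lambda>n. f (t n)) \<longlonglongrightarrow> W"
    by (meson Cauchy_convergent convergentD)
  have "(f \<longlongrightarrow> W) (at_left 1)"
  proof (rule tendstoI)
    fix e :: real assume "0 < e"
    then obtain c where c: "c < 1" "\<forall>r s. c < r \<and> r < 1 \<and> c < s \<and> s < 1 \<longrightarrow> norm (f r - f s) < e / 2"
      using near[of "e / 2"] by auto
    have "dist (f r) W < e" if "c < r" "r < 1" for r
    proof -
      obtain M where M: "\<forall>n\<ge>M. c < t n"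
        using t_ev[OF c(1)] by blast
      have "norm (f r - W) \<le> e / 2"
      proof (rule LIMSEQ_le_const2[OF tendsto_norm[OF tendsto_diff[OF tendsto_const W]]])
        show "\<exists>N. \<forall>n\<ge>N. norm (f r - f (t n)) \<le> e / 2"
          using c(2) t(2) that M by (intro exI[of _ M] allI impI less_imp_le) simp
      qed
      then show ?thesis
        using \<open>0 < e\<close> by (simp add: dist_norm)
    qed
    then show "\<forall>\<^sub>F r in at_left 1. dist (f r) W < e"
      unfolding eventually_at_left_field using c(1) by blast
  qed
  then show ?thesis
    unfolding f_def by blast
qed

end

section \<open>Contractive functions of row contractions\<close>

text \<open>The operator in the definition of the ball is the row times its adjoint column. Both
  have norm at most r, so the product has norm at most r^2.\<close>

lemma operator_ballI:
  fixes Y :: "'n::finite \<Rightarrow> 'k::complex_hilbert \<Rightarrow>\<^sub>L 'k"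
  assumes Y: "row_bounded r Y" and r: "0 \<le> r" "r < 1"
  shows "Y \<in> operator_ball"
proof -
  have "norm (\<Sum>i\<in>UNIV. Y i (cadjoint (Y i) x)) \<le> r\<^sup>2 * norm x" for x
  proof (rule power2_le_imp_le)
    have "(norm (\<Sum>i\<in>UNIV. Y i (cadjoint (Y i) x)))\<^sup>2 \<le> r\<^sup>2 * (\<Sum>i\<in>UNIV. (norm (cadjoint (Y i) x))\<^sup>2)"
      by (rule row_boundedD[OF Y])
    also have "\<dots> \<le> r\<^sup>2 * (r\<^sup>2 * (norm x)\<^sup>2)"
      using r by (intro mult_left_mono adjoint_bound row_boundedD[OF Y] row_bounded_complex_ops[OF Y]) simp_all
    finally show "(norm (\<Sum>i\<in>UNIV. Y i (cadjoint (Y i) x)))\<^sup>2 \<le> (r\<^sup>2 * norm x)\<^sup>2"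
      by (simp add: power_mult_distrib power2_eq_square[of "r\<^sup>2"] mult.assoc)
  qed simp
  then have "onorm (\<lambda>x. \<Sum>i\<in>UNIV. Y i (cadjoint (Y i) x)) \<le> r\<^sup>2"
    by (intro onorm_bound) simp_all
  also have "r\<^sup>2 < 1"
    using r by (simp add: power_less_one_iff abs_square_less_1)
  finally show ?thesis
    using Y by (simp add: operator_ball_def row_bounded_complex_ops)
qed

lemma contractive_operator_ball:
  fixes a :: "'m::finite \<Rightarrow> 'n::finite list \<Rightarrow> complex" and y :: "'m \<Rightarrow> 'k::complex_hilbert"
  assumes "contractive TYPE('k) a" "row_bounded r Y" "0 \<le> r" "r < 1"
  shows "norm (\<Sum>j\<in>UNIV. free_eval (a j) Y (y j)) \<le> L2_set (\<lambda>j. norm (y j)) UNIV"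
proof -
  define F where "F = row_operator (\<lambda>j. free_eval (a j) Y)"
  define v where "v = (\<chi> j. y j)"
  have "onorm F \<le> 1"
    using assms operator_ballI by (auto simp: contractive_def F_def)
  moreover have "bounded_linear F"
    unfolding F_def row_operator_def[abs_def]
    by (intro bounded_linear_sum bounded_linear_compose[OF blinfun.bounded_linear_right]
        bounded_linear_vec_nth)
  then have "norm (F v) \<le> onorm F * norm v"
    by (rule onorm)
  ultimately have "norm (F v) \<le> norm v"
    using mult_right_mono[of "onorm F" 1 "norm v"] by simp
  then show ?thesis
    by (simp add: F_def v_def row_operator_def norm_vec_def)
qed

text \<open>For orthonormal families, the partial isometry taking f e to h e and vanishing on the
  complement of the span of the f e; exchanging f and h gives its adjoint. A common index set lets
  the families live in different spaces.\<close>

definition partial_iso :: "'i set \<Rightarrow> ('i \<Rightarrow> 'a::complex_hilbert) \<Rightarrow> ('i \<Rightarrow> 'b::complex_hilbert) \<Rightarrow> 'a \<Rightarrow>\<^sub>L 'b" where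
  "partial_iso E f h = Blinfun (\<lambda>x. \<Sum>e\<in>E. cinner x (f e) *\<^sub>C h e)"

definition orthonormal_family :: "'i set \<Rightarrow> ('i \<Rightarrow> 'a::complex_hilbert) \<Rightarrow> bool" where
  "orthonormal_family E f \<longleftrightarrow>
     finite E \<and> (\<forall>s\<in>E. \<forall>t\<in>E. cinner (f s) (f t) = (if s = t then 1 else 0))"

lemma norm_orthonormal_sum:
  assumes "orthonormal_family E f"
  shows "(norm (\<Sum>s\<in>E. c s *\<^sub>C f s))\<^sup>2 = (\<Sum>s\<in>E. (cmod (c s))\<^sup>2)"
proof -
  have "cinner (\<Sum>s\<in>E. c s *\<^sub>C f s) (\<Sum>s\<in>E. c s *\<^sub>C f s) =
      (\<Sum>s\<in>E. \<Sum>t\<in>E. if t = s then c s * cnj (c s) else 0)"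
    unfolding cinner_sum_left unfolding cinner_sum_right
    by (intro sum.cong refl) (use assms in \<open>auto simp: cinner_simps orthonormal_family_def\<close>)
  also have "\<dots> = complex_of_real (\<Sum>s\<in>E. (cmod (c s))\<^sup>2)"
    using assms by (simp add: orthonormal_family_def complex_norm_square del: of_real_power)
  finally show ?thesis
    by (simp only: cinner_self of_real_eq_iff)
qed

lemma bessel:
  assumes "orthonormal_family E f"
  shows "(\<Sum>e\<in>E. (cmod (cinner x (f e)))\<^sup>2) \<le> (norm x)\<^sup>2"
proof -
  define y where "y = (\<Sum>e\<in>E. cinner x (f e) *\<^sub>C f e)"
  have "cinner x y = complex_of_real (\<Sum>e\<in>E. (cmod (cinner x (f e)))\<^sup>2)"
    by (simp add: y_def cinner_sum_right cinner_scaleC_right complex_norm_square mult.commute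
        del: of_real_power)
  then have "(norm (x - y))\<^sup>2 = (norm x)\<^sup>2 - (\<Sum>e\<in>E. (cmod (cinner x (f e)))\<^sup>2)"
    using norm_orthonormal_sum[OF assms, of "\<lambda>e. cinner x (f e)"]
    by (simp add: norm_diff_square y_def)
  then show ?thesis
    by (smt (verit) zero_le_power2)
qed

lemma partial_iso_apply:
  assumes "orthonormal_family E f" "orthonormal_family E h"
  shows "partial_iso E f h x = (\<Sum>e\<in>E. cinner x (f e) *\<^sub>C h e)"
proof -
  have "bounded_linear (\<lambda>x. \<Sum>e\<in>E. cinner x (f e) *\<^sub>C h e)"
  proof (rule bounded_linear_intro[where K = 1])
    show "norm (\<Sum>e\<in>E. cinner x (f e) *\<^sub>C h e) \<le> norm x * 1" for x
      using bessel[OF assms(1), of x] norm_orthonormal_sum[OF assms(2), of "\<lambda>e. cinner x (f e)"]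
      by (auto intro: power2_le_imp_le)
  qed (simp_all add: cinner_simps scaleC_add_left sum.distrib scaleC_sum_right scaleR_scaleC scaleC_scaleC)
  then show ?thesis
    by (simp add: partial_iso_def bounded_linear_Blinfun_apply)
qed

context
  fixes E :: "'i set" and f :: "'i \<Rightarrow> 'a::complex_hilbert" and h :: "'i \<Rightarrow> 'b::complex_hilbert"
  assumes f: "orthonormal_family E f" and h: "orthonormal_family E h"
begin

lemma norm_partial_iso: "(norm (partial_iso E f h x))\<^sup>2 = (\<Sum>e\<in>E. (cmod (cinner x (f e)))\<^sup>2)"
  by (simp add: partial_iso_apply f h norm_orthonormal_sum)

lemma norm_partial_iso_le: "norm (partial_iso E f h x) \<le> norm x"
  using bessel[OF f, of x] norm_partial_iso[of x] by (auto intro: power2_le_imp_le)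

lemma partial_iso_complex_ops: "partial_iso E f h \<in> complex_ops"
  by (simp add: complex_ops_def partial_iso_apply f h cinner_simps scaleC_sum_right scaleC_scaleC)

lemma partial_iso_partial_iso: "partial_iso E h f (partial_iso E f h x) = (\<Sum>e\<in>E. cinner x (f e) *\<^sub>C f e)"
proof -
  have "cinner (partial_iso E f h x) (h e) = cinner x (f e)" if "e \<in> E" for e
  proof -
    have "cinner (partial_iso E f h x) (h e) = (\<Sum>d\<in>E. if d = e then cinner x (f e) else 0)"
      unfolding partial_iso_apply[OF f h] cinner_sum_left cinner_scaleC_left
      by (intro sum.cong refl) (use h that in \<open>simp add: orthonormal_family_def\<close>)
    then show ?thesis
      using h that by (simp add: orthonormal_family_def)
  qed
  then show ?thesis
    by (simp add: partial_iso_apply[OF h f])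
qed

end

lemma fourier_sum_fixed_sum:
  assumes "\<And>s. s \<in> S \<Longrightarrow> fourier_sum E (f s) = f s"
  shows "fourier_sum E (sum f S) = sum f S"
proof -
  have "fourier_sum E (sum f S) = (\<Sum>s\<in>S. fourier_sum E (f s))"
    unfolding fourier_sum_def cinner_sum_left
    by (subst sum.swap) (simp add: complex_vector.scale_sum_left)
  then show ?thesis
    by (simp add: assms)
qed

lemma fourier_sum_fixed_scaleC:
  assumes "fourier_sum E x = x"
  shows "fourier_sum E (c *\<^sub>C x) = c *\<^sub>C x"
proof -
  have "fourier_sum E (c *\<^sub>C x) = c *\<^sub>C fourier_sum E x"
    by (simp add: fourier_sum_def cinner_scaleC_left scaleC_sum_right scaleC_scaleC)
  then show ?thesis by (simp add: assms)
qed

text \<open>The bound depends on a, t and N alone. Uniformity in X, and in the space it acts on,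
  matters because the tuple to which it is applied changes with N.\<close>

lemma free_eval_tail:
  assumes a: "free_holomorphic a" and X: "row_bounded t X" and t: "0 \<le> t" "t < 1"
  shows "norm (free_eval a X - poly_eval a N X) \<le>
    (\<Sum>k. t ^ k * coeff_norm a k) - (\<Sum>k\<le>N. t ^ k * coeff_norm a k)"
proof -
  let ?g = "\<lambda>k. t ^ k * coeff_norm a k"
  have g: "summable ?g"
    by (rule summable_coeff_norm[OF a t])
  have h: "summable (hom_part a X)"
    by (rule summable_norm_cancel[OF summable_hom_part[OF a X t]])
  have "free_eval a X - poly_eval a N X = (\<Sum>k. hom_part a X (k + Suc N))"
    using suminf_minus_initial_segment[OF h, of "Suc N"]
    by (simp add: free_eval_hom_part poly_eval_def lessThan_Suc_atMost)
  also have "norm \<dots> \<le> (\<Sum>k. ?g (k + Suc N))"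
    by (rule norm_suminf_le[OF norm_hom_part_le[OF X t(1)]]) (rule summable_ignore_initial_segment[OF g])
  also have "\<dots> = (\<Sum>k. ?g k) - (\<Sum>k\<le>N. ?g k)"
    using suminf_minus_initial_segment[OF g, of "Suc N"] by (simp only: lessThan_Suc_atMost)
  finally show ?thesis .
qed

text \<open>The compression of \<open>V\<close> to the span of the finitely many vectors $V_\alpha x_j$,
  $|\alpha| \le N$, agrees with \<open>V\<close> on the terms of degree at most \<open>N\<close>; being finite-dimensional, it
  can be moved to \<open>'k\<close>.\<close>

lemma compression_to_hilbert_space:
  fixes B :: "'n::finite \<Rightarrow> 'g::complex_hilbert \<Rightarrow>\<^sub>L 'g" and x :: "'m::finite \<Rightarrow> 'g"
  assumes K: "separable_infinite_dim TYPE('k::complex_hilbert)" and B: "row_bounded r B"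
  obtains Y :: "'n \<Rightarrow> 'k::complex_hilbert \<Rightarrow>\<^sub>L 'k" and y :: "'m \<Rightarrow> 'k"
  where "row_bounded r Y" "\<And>j. norm (y j) \<le> norm (x j)"
    "\<And>a. norm (\<Sum>j\<in>UNIV. poly_eval (a j) N B (x j)) = norm (\<Sum>j\<in>UNIV. poly_eval (a j) N Y (y j))"
proof -
  let ?S = "(\<lambda>(\<alpha>, j). word_op B \<alpha> (x j)) ` ({\<alpha>. length \<alpha> \<le> N} \<times> UNIV)"
  obtain E where E: "orthonormal E" "\<forall>v \<in> ?S. fourier_sum E v = v"
    using finite_orthonormal_basis[of ?S] by auto
  obtain E' :: "'k set" where E': "orthonormal E'" "card E' = card E"
    using orthonormal_of_card[OF K] by blast
  then obtain \<phi> where \<phi>: "bij_betw \<phi> E E'"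
    using E(1) finite_same_card_bij[of E E'] by (auto simp: orthonormal_def)
  have f: "orthonormal_family E (\<lambda>e. e)"
    using E(1) by (simp add: orthonormal_family_def orthonormal_def)
  have h: "orthonormal_family E \<phi>"
    using E(1) E'(1) \<phi>
    by (auto simp: orthonormal_family_def orthonormal_def bij_betw_def inj_on_eq_iff)
  define \<Phi> where "\<Phi> = partial_iso E (\<lambda>e. e) \<phi>"
  define \<Psi> where "\<Psi> = partial_iso E \<phi> (\<lambda>e. e)"
  have \<Psi>\<Phi>: "\<Psi> (\<Phi> v) = fourier_sum E v" for v
    by (simp add: \<Phi>_def \<Psi>_def partial_iso_partial_iso[OF f h] fourier_sum_def)
  have fix_word: "fourier_sum E (word_op B \<alpha> (x j)) = word_op B \<alpha> (x j)" if "length \<alpha> \<le> N" for \<alpha> j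
    using E(2) that by force
  define Y where "Y = (\<lambda>i. \<Phi> o\<^sub>L B i o\<^sub>L \<Psi>)"
  define y where "y = (\<lambda>j. \<Phi> (x j))"
  have word: "word_op Y \<alpha> (y j) = \<Phi> (word_op B \<alpha> (x j))" if "length \<alpha> \<le> N" for \<alpha> j
    using that by (induction \<alpha>) (simp_all add: y_def Y_def \<Psi>\<Phi> fix_word)
  show thesis
  proof (rule that)
    show "row_bounded r Y"
      unfolding row_bounded_def
    proof (intro conjI allI)
      show "Y i \<in> complex_ops" for i
        unfolding Y_def \<Phi>_def \<Psi>_def
        by (intro complex_ops_compose partial_iso_complex_ops f h row_bounded_complex_ops[OF B])
      fix z
      have "(norm (\<Sum>i\<in>UNIV. Y i (z i)))\<^sup>2 = (norm (\<Phi> (\<Sum>i\<in>UNIV. B i (\<Psi> (z i)))))\<^sup>2"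
        by (simp add: Y_def blinfun.sum_right)
      also have "\<dots> \<le> (norm (\<Sum>i\<in>UNIV. B i (\<Psi> (z i))))\<^sup>2"
        unfolding \<Phi>_def by (intro power_mono norm_partial_iso_le f h) simp
      also have "\<dots> \<le> r\<^sup>2 * (\<Sum>i\<in>UNIV. (norm (\<Psi> (z i)))\<^sup>2)"
        by (rule row_boundedD[OF B])
      also have "\<dots> \<le> r\<^sup>2 * (\<Sum>i\<in>UNIV. (norm (z i))\<^sup>2)"
        unfolding \<Psi>_def by (intro mult_left_mono sum_mono power_mono norm_partial_iso_le f h) simp_all
      finally show "(norm (\<Sum>i\<in>UNIV. Y i (z i)))\<^sup>2 \<le> r\<^sup>2 * (\<Sum>i\<in>UNIV. (norm (z i))\<^sup>2)" .
    qed
    show "norm (y j) \<le> norm (x j)" for j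
      unfolding y_def \<Phi>_def by (rule norm_partial_iso_le[OF f h])
    show "norm (\<Sum>j\<in>UNIV. poly_eval (a j) N B (x j)) = norm (\<Sum>j\<in>UNIV. poly_eval (a j) N Y (y j))"
      for a :: "'m \<Rightarrow> 'n list \<Rightarrow> complex"
    proof -
      define v where "v = (\<Sum>j\<in>UNIV. poly_eval (a j) N B (x j))"
      have "fourier_sum E v = v"
        unfolding v_def poly_eval_apply
        by (intro fourier_sum_fixed_sum fourier_sum_fixed_scaleC fix_word) simp
      then have "(norm (\<Phi> v))\<^sup>2 = (norm v)\<^sup>2"
        by (simp add: \<Phi>_def norm_partial_iso[OF f h] parseval_finite)
      moreover have "(\<Sum>j\<in>UNIV. poly_eval (a j) N Y (y j)) = \<Phi> v"
        unfolding v_def poly_eval_apply blinfun.sum_right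
        by (intro sum.cong refl)
          (simp add: word \<Phi>_def complex_ops_scaleC[OF partial_iso_complex_ops[OF f h]])
      ultimately show ?thesis
        by (simp add: v_def)
    qed
  qed
qed

text \<open>Contractivity is known for f on \<open>'k\<close>, whereas compression preserves the
  norm of truncated series. So the polynomial at B is traded for the one at its compression Y, the
  full f is contractive at Y, and the truncation error is absorbed in \<open>\<tau>\<close>, which
  does not depend on Y and tends to 0.\<close>

lemma contractive_row_bounded:
  fixes a :: "'m::finite \<Rightarrow> 'n::finite list \<Rightarrow> complex" and B :: "'n \<Rightarrow> 'g::complex_hilbert \<Rightarrow>\<^sub>L 'g"
  assumes K: "separable_infinite_dim TYPE('k::complex_hilbert)" and ct: "contractive TYPE('k) a"
    and a: "\<And>j. free_holomorphic (a j)" and B: "row_bounded r B" and r: "0 \<le> r" "r < 1"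
  shows "norm (\<Sum>j\<in>UNIV. free_eval (a j) B (x j)) \<le> L2_set (\<lambda>j. norm (x j)) UNIV"
proof (rule LIMSEQ_le)
  let ?g = "\<lambda>j k. r ^ k * coeff_norm (a j) k"
  define \<tau> where "\<tau> = (\<lambda>j N. (\<Sum>k. ?g j k) - (\<Sum>k\<le>N. ?g j k))"
  have lim: "(\<lambda>N. poly_eval (a j) N B) \<longlonglongrightarrow> free_eval (a j) B" for j
    using hom_part_sums[OF a B r] by (simp add: poly_eval_def sums_def_le)
  show "(\<lambda>N. norm (\<Sum>j\<in>UNIV. poly_eval (a j) N B (x j))) \<longlonglongrightarrow> norm (\<Sum>j\<in>UNIV. free_eval (a j) B (x j))"
    by (intro tendsto_norm tendsto_sum tendsto_blinfun_apply lim)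
  have "(\<lambda>N. \<tau> j N) \<longlonglongrightarrow> (\<Sum>k. ?g j k) - (\<Sum>k. ?g j k)" for j
    unfolding \<tau>_def using summable_sums[OF summable_coeff_norm[OF a r], of j]
    by (intro tendsto_diff tendsto_const) (simp add: sums_def_le)
  then have "(\<lambda>N. L2_set (\<lambda>j. norm (x j)) UNIV + (\<Sum>j\<in>UNIV. \<tau> j N * norm (x j))) \<longlonglongrightarrow>
      L2_set (\<lambda>j. norm (x j)) UNIV + (\<Sum>j\<in>UNIV. 0 * norm (x j))"
    by (intro tendsto_add tendsto_const tendsto_sum tendsto_mult) simp
  then show "(\<lambda>N. L2_set (\<lambda>j. norm (x j)) UNIV + (\<Sum>j\<in>UNIV. \<tau> j N * norm (x j))) \<longlonglongrightarrow>
      L2_set (\<lambda>j. norm (x j)) UNIV"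
    by simp
  have "norm (\<Sum>j\<in>UNIV. poly_eval (a j) N B (x j)) \<le>
      L2_set (\<lambda>j. norm (x j)) UNIV + (\<Sum>j\<in>UNIV. \<tau> j N * norm (x j))" for N
  proof -
    obtain Y :: "'n \<Rightarrow> 'k \<Rightarrow>\<^sub>L 'k" and y :: "'m \<Rightarrow> 'k" where Y: "row_bounded r Y"
      and y: "\<And>j. norm (y j) \<le> norm (x j)"
      and eq: "\<And>a. norm (\<Sum>j\<in>UNIV. poly_eval (a j) N B (x j)) = norm (\<Sum>j\<in>UNIV. poly_eval (a j) N Y (y j))"
      using compression_to_hilbert_space[OF K B, where x = x and N = N] by blast
    have tail: "norm (free_eval (a j) Y (y j) - poly_eval (a j) N Y (y j)) \<le> \<tau> j N * norm (x j)" for j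
    proof -
      have \<tau>: "norm (free_eval (a j) Y - poly_eval (a j) N Y) \<le> \<tau> j N"
        unfolding \<tau>_def by (rule free_eval_tail[OF a Y r])
      have "norm (free_eval (a j) Y (y j) - poly_eval (a j) N Y (y j)) \<le>
          norm (free_eval (a j) Y - poly_eval (a j) N Y) * norm (y j)"
        by (simp add: norm_blinfun flip: blinfun.diff_left)
      also have "\<dots> \<le> \<tau> j N * norm (x j)"
        using order_trans[OF norm_ge_zero \<tau>] by (intro mult_mono \<tau> y) simp_all
      finally show ?thesis .
    qed
    have "norm (\<Sum>j\<in>UNIV. poly_eval (a j) N Y (y j)) \<le> norm (\<Sum>j\<in>UNIV. free_eval (a j) Y (y j)) +
        norm (\<Sum>j\<in>UNIV. free_eval (a j) Y (y j) - poly_eval (a j) N Y (y j))"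
      unfolding sum_subtractf by (subst norm_minus_commute) (rule norm_triangle_sub)
    also have "\<dots> \<le> L2_set (\<lambda>j. norm (y j)) UNIV + (\<Sum>j\<in>UNIV. \<tau> j N * norm (x j))"
      by (intro add_mono contractive_operator_ball[OF ct Y r] sum_norm_le tail)
    also have "\<dots> \<le> L2_set (\<lambda>j. norm (x j)) UNIV + (\<Sum>j\<in>UNIV. \<tau> j N * norm (x j))"
      by (intro add_mono L2_set_mono y order_refl) simp
    finally show ?thesis
      by (simp add: eq)
  qed
  then show "\<exists>M. \<forall>N\<ge>M. norm (\<Sum>j\<in>UNIV. poly_eval (a j) N B (x j)) \<le>
      L2_set (\<lambda>j. norm (x j)) UNIV + (\<Sum>j\<in>UNIV. \<tau> j N * norm (x j))"
    by blast
qed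

section \<open>Vectors with a given Gram matrix\<close>

abbreviation closed_span :: "'a::complex_hilbert set \<Rightarrow> 'a set" where
  "closed_span S \<equiv> closure (complex_vector.span S)"

lemma closed_span_base: "x \<in> S \<Longrightarrow> x \<in> closed_span S"
  using closure_subset complex_vector.span_base by blast

lemma subspace_closed_span: "complex_vector.subspace (closed_span S)"
  unfolding complex_vector.subspace_def
proof (intro conjI ballI allI)
  show "0 \<in> closed_span S"
    using closure_subset complex_vector.span_zero by blast
  fix x c assume "x \<in> closed_span S"
  then obtain f where f: "\<And>n. f n \<in> complex_vector.span S" "f \<longlonglongrightarrow> x"
    unfolding closure_sequential by blast
  show "c *\<^sub>C x \<in> closed_span S"
    unfolding closure_sequential
    by (intro exI[of _ "\<lambda>n. c *\<^sub>C f n"] conjI allI complex_vector.span_scale f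
        bounded_linear.tendsto[OF bounded_linear_scaleC])
  fix y assume "y \<in> closed_span S"
  then obtain g where "\<And>n. g n \<in> complex_vector.span S" "g \<longlonglongrightarrow> y"
    unfolding closure_sequential by blast
  then show "x + y \<in> closed_span S"
    unfolding closure_sequential using f
    by (intro exI[of _ "\<lambda>n. f n + g n"] conjI allI complex_vector.span_add tendsto_add)
qed

lemma closed_span_minimal:
  assumes "S \<subseteq> M" "complex_vector.subspace M" "closed M"
  shows "closed_span S \<subseteq> M"
  using assms by (intro closure_minimal complex_vector.span_minimal)

lemma cinner_eq_zero_commute: "cinner x y = 0 \<longleftrightarrow> cinner y x = 0"
  by (metis cinner_commute complex_cnj_zero)

lemma closed_Collect_cinner: "closed {x. cinner x z = c}"
proof -
  have "continuous_on UNIV (\<lambda>x. cinner x z)"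
    unfolding continuous_on_def by (intro ballI tendsto_cinner tendsto_ident_at tendsto_const)
  then show ?thesis
    by (intro closed_Collect_eq continuous_on_const)
qed

lemma cinner_closed_span:
  assumes "y \<in> closed_span S" "\<And>s. s \<in> S \<Longrightarrow> cinner s z = 0"
  shows "cinner y z = 0"
proof -
  have "closed_span S \<subseteq> {y. cinner y z = 0}"
    using assms(2) by (intro closed_span_minimal closed_Collect_cinner)
      (auto simp: complex_vector.subspace_def cinner_simps)
  with assms(1) show ?thesis by blast
qed

lemma cinner_closed_spans:
  assumes "x \<in> closed_span S" "y \<in> closed_span T" "\<And>s t. s \<in> S \<Longrightarrow> t \<in> T \<Longrightarrow> cinner s t = 0"
  shows "cinner x y = 0"
  using assms by (metis cinner_closed_span cinner_eq_zero_commute)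

lemma closed_span_eqI:
  assumes "x \<in> closed_span S" "y \<in> closed_span S" "\<And>s. s \<in> S \<Longrightarrow> cinner s x = cinner s y"
  shows "x = y"
proof -
  have "x - y \<in> closed_span S"
    by (intro complex_vector.subspace_diff subspace_closed_span assms)
  then have "cinner (x - y) (x - y) = 0"
    by (rule cinner_closed_span) (simp add: cinner_diff_right assms(3))
  then show ?thesis
    by (simp only: cinner_eq_zero_iff) simp
qed

text \<open>The functional sending w_j to l_j is given on finite combinations. The bound forces
  equal values on equal combinations, so the w_j may be linearly dependent.\<close>

lemma riesz_family:
  fixes w :: "'i \<Rightarrow> 'a::complex_hilbert"
  assumes bnd: "\<And>F c. finite F \<Longrightarrow> F \<subseteq> S \<Longrightarrow>
      cmod (\<Sum>j\<in>F. c j * l j) \<le> B * norm (\<Sum>j\<in>F. c j *\<^sub>C w j)" and "0 \<le> B"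
  shows "\<exists>p \<in> closed_span (w ` S). norm p \<le> B \<and> (\<forall>j\<in>S. cinner (w j) p = l j)"
proof -
  define D where "D = {(\<Sum>j\<in>F. c j *\<^sub>C w j, \<Sum>j\<in>F. c j * l j) | F c. finite F \<and> F \<subseteq> S}"
  have "\<exists>p \<in> closure (fst ` D). norm p \<le> B \<and> (\<forall>(u, m) \<in> D. m = cinner u p)"
  proof (rule riesz_graph)
    show "(0, 0) \<in> D"
      unfolding D_def by (intro CollectI exI[of _ "{}"]) simp
    fix u m assume "(u, m) \<in> D"
    then obtain F c where F: "finite F" "F \<subseteq> S" "u = (\<Sum>j\<in>F. c j *\<^sub>C w j)" "m = (\<Sum>j\<in>F. c j * l j)"
      unfolding D_def by auto
    show "cmod m \<le> B * norm u"
      unfolding F by (rule bnd[OF F(1,2)])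
    show "(d *\<^sub>C u, d * m) \<in> D" for d
      unfolding D_def F
      by (intro CollectI exI[of _ F] exI[of _ "\<lambda>j. d * c j"])
        (simp add: F(1,2) scaleC_sum_right scaleC_scaleC sum_distrib_left mult.assoc)
    fix v n assume "(v, n) \<in> D"
    then obtain G d where G: "finite G" "G \<subseteq> S" "v = (\<Sum>j\<in>G. d j *\<^sub>C w j)" "n = (\<Sum>j\<in>G. d j * l j)"
      unfolding D_def by auto
    \<comment> \<open>Extension by zero brings both combinations to the common index set F \<union>
      G.\<close>
    define c' where "c' = (\<lambda>j. if j \<in> F then c j else 0)"
    define d' where "d' = (\<lambda>j. if j \<in> G then d j else 0)"
    have "u = (\<Sum>j\<in>F \<union> G. c' j *\<^sub>C w j)" "m = (\<Sum>j\<in>F \<union> G. c' j * l j)"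
      unfolding F c'_def using F(1) G(1) by (auto intro!: sum.mono_neutral_cong_left)
    moreover have "v = (\<Sum>j\<in>F \<union> G. d' j *\<^sub>C w j)" "n = (\<Sum>j\<in>F \<union> G. d' j * l j)"
      unfolding G d'_def using F(1) G(1) by (auto intro!: sum.mono_neutral_cong_left)
    ultimately show "(u + v, m + n) \<in> D"
      unfolding D_def using F(1,2) G(1,2)
      by (intro CollectI exI[of _ "F \<union> G"] exI[of _ "\<lambda>j. c' j + d' j"])
        (simp add: scaleC_add_left distrib_right sum.distrib)
  qed fact
  then obtain p where p: "p \<in> closure (fst ` D)" "norm p \<le> B" "\<forall>(u, m) \<in> D. m = cinner u p"
    by blast
  have "fst ` D \<subseteq> complex_vector.span (w ` S)"
    unfolding D_def
    by (auto intro!: complex_vector.span_sum complex_vector.span_scale)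
      (intro complex_vector.span_base imageI, blast)
  then have "p \<in> closed_span (w ` S)"
    using p(1) closure_mono by blast
  moreover have "cinner (w j) p = l j" if "j \<in> S" for j
  proof -
    have "(w j, l j) \<in> D"
      unfolding D_def using that by (intro CollectI exI[of _ "{j}"] exI[of _ "\<lambda>_. 1"]) simp
    with p(3) show ?thesis by auto
  qed
  ultimately show ?thesis
    using p(2) by blast
qed

section \<open>Positive kernels as Gram matrices\<close>

lemma cinner_sum_sum:
  "cinner (\<Sum>i\<in>F. c i *\<^sub>C w i) (\<Sum>j\<in>G. d j *\<^sub>C v j) = (\<Sum>i\<in>F. \<Sum>j\<in>G. c i * cnj (d j) * cinner (w i) (v j))"
  unfolding cinner_sum_left unfolding cinner_sum_right
  by (simp add: cinner_scaleC_left cinner_scaleC_right mult_ac)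

definition ell2_basis :: "'i \<Rightarrow> 'i ell2" where
  "ell2_basis i = fin_vec {i} (\<lambda>_. 1)"

lemma cinner_ell2_basis: "cinner x (ell2_basis i) = Rep_ell2 x i"
  by (simp add: ell2_basis_def cinner_fin_vec)

lemma Rep_ell2_basis: "Rep_ell2 (ell2_basis i) j = (if i = j then 1 else 0)"
  by (auto simp: ell2_basis_def Rep_fin_vec)

text \<open>Hermitian symmetry is a clause of its own because the sign of the real part of the form
  does not force it.\<close>

definition positive_kernel :: "('i \<Rightarrow> 'i \<Rightarrow> complex) \<Rightarrow> bool" where
  "positive_kernel K \<longleftrightarrow> (\<forall>i j. K i j = cnj (K j i)) \<and>
     (\<forall>F c. finite F \<longrightarrow> 0 \<le> Re (\<Sum>i\<in>F. \<Sum>j\<in>F. c i * cnj (c j) * K i j))"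

text \<open>Cauchy--Schwarz for the semi-inner product defined by \<open>K\<close>.\<close>

lemma positive_kernel_bound:
  assumes K: "positive_kernel K" and "finite F" "i \<notin> F"
    and w: "\<And>j k. j \<in> F \<Longrightarrow> k \<in> F \<Longrightarrow> cinner (w j) (w k) = K j k"
  shows "cmod (\<Sum>j\<in>F. c j * K j i) \<le> sqrt (Re (K i i)) * norm (\<Sum>j\<in>F. c j *\<^sub>C w j)"
proof -
  define u where "u = (\<Sum>j\<in>F. c j *\<^sub>C w j)"
  define l where "l = (\<Sum>j\<in>F. c j * K j i)"
  define k where "k = Re (K i i)"
  have herm: "K j i = cnj (K i j)" for i j
    using K unfolding positive_kernel_def by blast
  have Kii: "K i i = complex_of_real k"
    using herm[of i i] by (simp add: complex_eq_iff k_def)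
  have ge: "0 \<le> (norm u)\<^sup>2 - 2 * Re (cnj s * l) + (cmod s)\<^sup>2 * k" for s
  proof -
    define c' where "c' = c(i := - s)"
    have c': "c' j = c j" if "j \<in> F" for j
      using that \<open>i \<notin> F\<close> by (auto simp: c'_def)
    have c'i: "c' i = - s"
      by (simp add: c'_def)
    have "(\<Sum>a\<in>insert i F. \<Sum>b\<in>insert i F. c' a * cnj (c' b) * K a b) =
       (\<Sum>a\<in>F. \<Sum>b\<in>F. c a * cnj (c b) * K a b) - cnj s * l - cnj (cnj s * l) + s * cnj s * K i i"
    proof -
      have "(\<Sum>b\<in>F. c' i * cnj (c' b) * K i b) = (\<Sum>b\<in>F. - cnj (cnj s * (c b * K b i)))"
        by (intro sum.cong refl) (simp add: c' c'i herm[of i])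
      then have row: "(\<Sum>b\<in>F. c' i * cnj (c' b) * K i b) = - cnj (cnj s * l)"
        unfolding l_def by (simp only: sum_negf sum_distrib_left cnj_sum)
      have "(\<Sum>a\<in>F. c' a * cnj (c' i) * K a i) = (\<Sum>a\<in>F. - (cnj s * (c a * K a i)))"
        by (intro sum.cong refl) (simp add: c' c'i)
      then have col: "(\<Sum>a\<in>F. c' a * cnj (c' i) * K a i) = - (cnj s * l)"
        unfolding l_def by (simp only: sum_negf sum_distrib_left)
      have "(\<Sum>a\<in>F. \<Sum>b\<in>F. c' a * cnj (c' b) * K a b) = (\<Sum>a\<in>F. \<Sum>b\<in>F. c a * cnj (c b) * K a b)"
        by (intro sum.cong refl) (simp add: c')
      then show ?thesis
        using \<open>finite F\<close> \<open>i \<notin> F\<close> by (simp add: sum.distrib row col) (simp add: c'i)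
    qed
    also have "(\<Sum>a\<in>F. \<Sum>b\<in>F. c a * cnj (c b) * K a b) = cinner u u"
      unfolding u_def cinner_sum_sum by (intro sum.cong refl) (simp add: w)
    also have "s * cnj s * K i i = complex_of_real ((cmod s)\<^sup>2 * k)"
      by (simp add: Kii complex_norm_square del: of_real_power)
    finally have "(\<Sum>a\<in>insert i F. \<Sum>b\<in>insert i F. c' a * cnj (c' b) * K a b) =
        complex_of_real ((norm u)\<^sup>2) - cnj s * l - cnj (cnj s * l) + complex_of_real ((cmod s)\<^sup>2 * k)"
      by (simp only: cinner_self)
    moreover have "0 \<le> Re (\<Sum>a\<in>insert i F. \<Sum>b\<in>insert i F. c' a * cnj (c' b) * K a b)"
      using K \<open>finite F\<close> unfolding positive_kernel_def by blast
    ultimately have "0 \<le> Re (complex_of_real ((norm u)\<^sup>2) - cnj s * l - cnj (cnj s * l) +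
        complex_of_real ((cmod s)\<^sup>2 * k))"
      by (simp only:)
    then show ?thesis
      by (simp only: minus_complex.simps plus_complex.simps cnj.simps Re_complex_of_real)
  qed
  have self: "Re (cnj (complex_of_real t * l) * l) = t * (cmod l)\<^sup>2" for t
  proof -
    have "cnj (complex_of_real t * l) * l = complex_of_real (t * (cmod l)\<^sup>2)"
      by (simp add: complex_norm_square mult_ac del: of_real_power)
    then show ?thesis by (metis Re_complex_of_real)
  qed
  have ge_t: "0 \<le> (norm u)\<^sup>2 - 2 * (t * (cmod l)\<^sup>2) + t\<^sup>2 * (cmod l)\<^sup>2 * k" for t
    using ge[of "complex_of_real t * l"] unfolding self by (simp add: norm_mult power_mult_distrib)
  have k0: "0 \<le> k"
    using K[unfolded positive_kernel_def, THEN conjunct2, rule_format, of "{i}" "\<lambda>_. 1"]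
    by (simp add: k_def)
  \<comment> \<open>The choice s = t l leaves a real quadratic in t. For k = 0 it is affine and l
    must vanish; otherwise its minimizer t = 1/k gives the estimate.\<close>
  have "(cmod l)\<^sup>2 \<le> k * (norm u)\<^sup>2"
  proof (cases "k = 0")
    case True
    have "l = 0"
    proof (rule ccontr)
      assume "l \<noteq> 0"
      then have "0 < (cmod l)\<^sup>2"
        by simp
      then show False
        using ge_t[of "((norm u)\<^sup>2 + 1) / (cmod l)\<^sup>2"] True
        by simp (smt (verit) zero_le_power2)
    qed
    then show ?thesis by (simp add: True)
  next
    case False
    have "0 \<le> (norm u)\<^sup>2 - (cmod l)\<^sup>2 / k"
      using ge_t[of "1 / k"] False by (simp add: power2_eq_square)
    then show ?thesis
      using k0 False by (simp add: field_simps)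
  qed
  then have "(cmod l)\<^sup>2 \<le> (sqrt k * norm u)\<^sup>2"
    using k0 by (simp add: power_mult_distrib)
  then show ?thesis
    unfolding u_def l_def k_def by (rule power2_le_imp_le) (use k0 in \<open>simp add: k_def\<close>)
qed

text \<open>A Cholesky decomposition along a well-ordering of the index set: the vector of index \<open>i\<close> is
  supported on indices up to \<open>i\<close>; its projection to the span of the earlier vectors is prescribed,
  and the missing part of its norm is put at the new coordinate \<open>i\<close>.\<close>

lemma gram_vectors:
  fixes K :: "'i \<Rightarrow> 'i \<Rightarrow> complex"
  assumes K: "positive_kernel K"
  shows "\<exists>w :: 'i \<Rightarrow> 'i ell2. \<forall>i j. cinner (w i) (w j) = K i j"
proof -
  have herm: "K j i = cnj (K i j)" for i j
    using K unfolding positive_kernel_def by blast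
  obtain r0 :: "'i rel" where r0: "well_order_on UNIV r0"
    using well_order_on by blast
  define R where "R = r0 - Id"
  have wf: "wf R" and lin: "linear_order_on UNIV r0"
    using r0 by (simp_all add: R_def well_order_on_def)
  then have po: "partial_order_on UNIV r0" and tot: "total_on UNIV r0"
    by (simp_all add: linear_order_on_def)
  have tr: "trans r0" and anti: "antisym r0"
    using po by (simp_all add: partial_order_on_def preorder_on_def)
  have total: "(i, j) \<in> R \<or> i = j \<or> (j, i) \<in> R" for i j
    using tot by (auto simp: R_def total_on_def)
  have trans: "(i, k) \<in> R" if "(i, j) \<in> R" "(j, k) \<in> R" for i j k
    using that tr anti by (auto simp: R_def dest: transD antisymD)
  have irrefl: "(i, i) \<notin> R" for i
    by (simp add: R_def)
  \<comment> \<open>The requirements on the vector r of index i: support up to i, inner products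
    with earlier vectors, and its own norm. Values of f enter at indices below i alone, as
    well-founded choice demands.\<close>
  define P where "P = (\<lambda>(f :: 'i \<Rightarrow> 'i ell2) i r.
     (\<forall>m. Rep_ell2 r m \<noteq> 0 \<longrightarrow> m = i \<or> (m, i) \<in> R) \<and>
     (\<forall>j. (j, i) \<in> R \<longrightarrow> cinner r (f j) = K i j) \<and> cinner r r = K i i)"
  have "\<exists>w. \<forall>i. P w i (w i)"
  proof (rule dependent_wf_choice[OF wf])
    show "P f i r = P g i r" if "\<And>j. (j, i) \<in> R \<Longrightarrow> f j = g j" for f g i r
      using that by (simp add: P_def)
    fix i f assume prev: "\<And>j. (j, i) \<in> R \<Longrightarrow> P f j (f j)"
    define S where "S = {j. (j, i) \<in> R}"
    have gram: "cinner (f j) (f k) = K j k" if "j \<in> S" "k \<in> S" for j k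
    proof -
      have fj: "P f j (f j)" and fk: "P f k (f k)"
        using prev that by (simp_all add: S_def)
      consider "(j, k) \<in> R" | "j = k" | "(k, j) \<in> R"
        using total by blast
      then show ?thesis
      proof cases
        case 1
        then have "cinner (f k) (f j) = K k j"
          using fk by (simp add: P_def)
        then show ?thesis by (metis cinner_commute herm)
      qed (use fj in \<open>simp_all add: P_def\<close>)
    qed
    define k where "k = Re (K i i)"
    have Kii: "K i i = complex_of_real k"
      using herm[of i i] by (simp add: complex_eq_iff k_def)
    have k0: "0 \<le> k"
      using K[unfolded positive_kernel_def, THEN conjunct2, rule_format, of "{i}" "\<lambda>_. 1"]
      by (simp add: k_def)
    have "\<exists>p \<in> closed_span (f ` S). norm p \<le> sqrt k \<and> (\<forall>j\<in>S. cinner (f j) p = K j i)"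
      unfolding k_def
    proof (intro riesz_family positive_kernel_bound K)
      show "i \<notin> F" if "F \<subseteq> S" for F
        using that irrefl by (auto simp: S_def)
      show "cinner (f j) (f k) = K j k" if "F \<subseteq> S" "j \<in> F" "k \<in> F" for F j k
        using that gram by blast
    qed (use k0 in \<open>simp_all add: k_def\<close>)
    then obtain p where p: "p \<in> closed_span (f ` S)" "norm p \<le> sqrt k" "\<And>j. j \<in> S \<Longrightarrow> cinner (f j) p = K j i"
      by blast
    \<comment> \<open>By transitivity the earlier vectors are supported below i. Hence coordinate i
      is still free, also for p in their closed span.\<close>
    have supp: "Rep_ell2 (f j) m = 0" if "j \<in> S" "m \<notin> S" for j m
      using prev[of j] that trans[of m j i] by (auto simp: P_def S_def)
    have p_supp: "Rep_ell2 p m = 0" if "m \<notin> S" for m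
      unfolding cinner_ell2_basis[symmetric]
      by (rule cinner_closed_span[OF p(1)]) (use supp that in \<open>auto simp: cinner_ell2_basis\<close>)
    have iS: "i \<notin> S"
      by (simp add: S_def irrefl)
    \<comment> \<open>The radicand is nonnegative by the norm bound on p, which rests on positivity
      of K through Cauchy--Schwarz.\<close>
    define t where "t = sqrt (k - (norm p)\<^sup>2)"
    have t2: "t * t = k - (norm p)\<^sup>2"
      using power_mono[OF p(2), of 2] k0 by (simp add: t_def)
    define r where "r = p + complex_of_real t *\<^sub>C ell2_basis i"
    have pe: "cinner p (ell2_basis i) = 0" "cinner (ell2_basis i) p = 0"
      using p_supp[OF iS] cinner_eq_zero_commute[of p "ell2_basis i"] by (simp_all add: cinner_ell2_basis)
    have ee: "norm (ell2_basis i) = 1"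
      by (rule power2_eq_imp_eq) (simp_all add: ell2_basis_def norm_fin_vec)
    have "cinner r r = complex_of_real ((norm p)\<^sup>2 + t * t)"
      unfolding r_def cinner_simps pe by (simp add: cinner_self ee)
    then have "cinner r r = K i i"
      by (simp add: t2 Kii)
    moreover have "cinner r (f j) = K i j" if "(j, i) \<in> R" for j
    proof -
      have j: "j \<in> S"
        using that by (simp add: S_def)
      have "cinner (f j) r = K j i"
        using supp[OF j iS] p(3)[OF j] by (simp add: r_def cinner_simps cinner_ell2_basis)
      then show ?thesis
        using cinner_commute[of r "f j"] herm[of i j] by simp
    qed
    moreover have "m = i \<or> (m, i) \<in> R" if "Rep_ell2 r m \<noteq> 0" for m
    proof (rule ccontr)
      assume "\<not> (m = i \<or> (m, i) \<in> R)"
      then have "Rep_ell2 r m = 0"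
        using p_supp[of m] by (auto simp: r_def S_def plus_ell2.rep_eq scaleC_ell2.rep_eq Rep_ell2_basis)
      with that show False by simp
    qed
    ultimately show "\<exists>r. P f i r"
      unfolding P_def by blast
  qed
  then obtain w where w: "\<And>i. P w i (w i)" by blast
  have "cinner (w i) (w j) = K i j" for i j
  proof -
    consider "(i, j) \<in> R" | "i = j" | "(j, i) \<in> R"
      using total by blast
    then show ?thesis
    proof cases
      case 1
      then have "cinner (w j) (w i) = K j i"
        using w[of j] by (simp add: P_def)
      then show ?thesis by (metis cinner_commute herm)
    qed (use w[of i] in \<open>simp_all add: P_def\<close>)
  qed
  then show ?thesis by blast
qed

text \<open>Riesz representation defines \<open>A x\<close> in the closed span of the $w'_i$ by
  $\langle w'_i, A x\rangle = \langle w_i, x\rangle$; thus \<open>A\<close> vanishes on the orthogonal complement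
  of the $w_i$, and for $w' = w$ it is the projection onto their closed span.\<close>

lemma gram_partial_isometry:
  fixes w :: "'i \<Rightarrow> 'a::complex_hilbert" and w' :: "'i \<Rightarrow> 'b::complex_hilbert"
  assumes gram: "\<And>i j. cinner (w i) (w j) = cinner (w' i) (w' j)"
  shows "\<exists>A\<in>complex_ops. (\<forall>i. blinfun_apply A (w i) = w' i) \<and>
    (\<forall>i x. cinner (w' i) (A x) = cinner (w i) x) \<and> (\<forall>x. A x \<in> closed_span (range w')) \<and>
    (\<forall>x \<in> closed_span (range w). norm (A x) = norm x)"
proof -
  have norm_eq: "norm (\<Sum>i\<in>F. c i *\<^sub>C w i) = norm (\<Sum>i\<in>F. c i *\<^sub>C w' i)" for F c
  proof -
    have "complex_of_real ((norm (\<Sum>i\<in>F. c i *\<^sub>C w i))\<^sup>2) = complex_of_real ((norm (\<Sum>i\<in>F. c i *\<^sub>C w' i))\<^sup>2)"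
      unfolding cinner_self[symmetric] cinner_sum_sum gram ..
    then show ?thesis
      by (simp only: of_real_eq_iff) (simp add: power2_eq_iff_nonneg)
  qed
  have "\<exists>p \<in> closed_span (range w'). norm p \<le> norm x \<and> (\<forall>i\<in>UNIV. cinner (w' i) p = cinner (w i) x)" for x
  proof (rule riesz_family)
    show "cmod (\<Sum>j\<in>F. c j * cinner (w j) x) \<le> norm x * norm (\<Sum>j\<in>F. c j *\<^sub>C w' j)" for F c
    proof -
      have "(\<Sum>j\<in>F. c j * cinner (w j) x) = cinner (\<Sum>j\<in>F. c j *\<^sub>C w j) x"
        by (simp add: cinner_sum_left cinner_scaleC_left)
      then show ?thesis
        using norm_cinner_le[of "\<Sum>j\<in>F. c j *\<^sub>C w j" x] by (simp add: norm_eq mult.commute)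
    qed
  qed simp
  then obtain A0 where A0: "\<And>x. A0 x \<in> closed_span (range w')" "\<And>x. norm (A0 x) \<le> norm x"
    "\<And>i x. cinner (w' i) (A0 x) = cinner (w i) x"
    by (metis UNIV_I)
  have A0_eqI: "A0 x = y" if "y \<in> closed_span (range w')" "\<And>i. cinner (w i) x = cinner (w' i) y" for x y
    by (rule closed_span_eqI[OF A0(1) that(1)]) (use that(2) in \<open>auto simp: A0(3)\<close>)
  have add: "A0 (x + y) = A0 x + A0 y" for x y
    by (intro A0_eqI complex_vector.subspace_add subspace_closed_span A0(1))
      (simp add: cinner_add_right A0(3))
  have scale: "A0 (c *\<^sub>C x) = c *\<^sub>C A0 x" for c x
    by (intro A0_eqI complex_vector.subspace_scale subspace_closed_span A0(1))
      (simp add: cinner_scaleC_right A0(3))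
  have "bounded_linear A0"
    by (rule bounded_linear_intro[where K = 1]) (simp_all add: add scale scaleR_scaleC A0(2))
  then have ap: "blinfun_apply (Blinfun A0) = A0"
    by (rule bounded_linear_Blinfun_apply)
  have ww: "A0 (w i) = w' i" for i
    by (intro A0_eqI closed_span_base) (simp_all add: gram)
  have A0_sum: "A0 (\<Sum>i\<in>F. c i *\<^sub>C w i) = (\<Sum>i\<in>F. c i *\<^sub>C w' i)" for F c
    using blinfun.sum_right[of "Blinfun A0" "\<lambda>i. c i *\<^sub>C w i" F] by (simp add: ap scale ww)
  have "complex_vector.span (range w) \<subseteq> {x. norm (Blinfun A0 x) = norm x}"
  proof
    fix x assume "x \<in> complex_vector.span (range w)"
    then obtain T c where T: "finite T" "T \<subseteq> range w" "x = (\<Sum>v\<in>T. c v *\<^sub>C v)"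
      unfolding complex_vector.span_explicit by auto
    obtain F where F: "inj_on w F" "T = w ` F"
      using subset_image_inj[of T w UNIV] T(2) by blast
    have "x = (\<Sum>i\<in>F. c (w i) *\<^sub>C w i)"
      unfolding T(3) F(2) by (simp add: sum.reindex[OF F(1)])
    then show "x \<in> {x. norm (Blinfun A0 x) = norm x}"
      by (simp add: ap A0_sum norm_eq)
  qed
  moreover have "closed {x. norm (Blinfun A0 x) = norm x}"
    by (intro closed_Collect_eq continuous_intros)
  ultimately have "closed_span (range w) \<subseteq> {x. norm (Blinfun A0 x) = norm x}"
    by (rule closure_minimal)
  then show ?thesis
    by (intro bexI[of _ "Blinfun A0"]) (auto simp: ap complex_ops_def scale ww A0)
qed

text \<open>The basis vectors and their images have equal Gram matrices. The resulting partial
  isometry is isometric everywhere because a vector orthogonal to the whole basis has zero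
  coordinates.\<close>

lemma ell2_reindex:
  fixes q :: "'i \<Rightarrow> 'j"
  assumes "inj q"
  obtains Q :: "'i ell2 \<Rightarrow>\<^sub>L 'j ell2" where "isometric_op Q" "\<And>x. blinfun_apply Q x \<in> closed_span (range (\<lambda>i. ell2_basis (q i)))"
proof -
  have "cinner (ell2_basis i) (ell2_basis j) = cinner (ell2_basis (q i)) (ell2_basis (q j))" for i j
    using assms by (auto simp: cinner_ell2_basis Rep_ell2_basis inj_eq)
  from gram_partial_isometry[of ell2_basis "\<lambda>i. ell2_basis (q i)", OF this]
  obtain Q :: "'i ell2 \<Rightarrow>\<^sub>L 'j ell2" where Q: "Q \<in> complex_ops"
    "\<And>x. blinfun_apply Q x \<in> closed_span (range (\<lambda>i. ell2_basis (q i)))"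
    "\<And>x. x \<in> closed_span (range ell2_basis) \<Longrightarrow> norm (Q x) = norm x"
    by blast
  have "x \<in> closed_span (range ell2_basis)" for x :: "'i ell2"
  proof -
    obtain p where p: "p \<in> closed_span (range ell2_basis)" "\<forall>y\<in>closed_span (range ell2_basis). cinner (x - p) y = 0"
      using projection_exists[OF subspace_closed_span closed_closure] by blast
    then have "Rep_ell2 (x - p) i = 0" for i
      using closed_span_base[of "ell2_basis i" "range ell2_basis"] by (simp flip: cinner_ell2_basis)
    then have "x - p = 0"
      by (simp add: Rep_ell2_inject[symmetric] zero_ell2.rep_eq fun_eq_iff)
    with p show ?thesis by simp
  qed
  then show thesis
    using Q by (intro that[of Q]) (auto simp: isometric_op_def)
qed

section \<open>Dilations of multi-Toeplitz kernels\<close>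

text \<open>Common prefixes are stripped, and the value is 0 unless one word is a prefix of the
  other. If a row isometry V on a larger space compresses to Y on all words, this is <V_\<alpha> x,
  V_\<beta> y>: for \<alpha> = \<beta>\<gamma> it reduces to <V_\<gamma> x, y>.\<close>

fun toeplitz_kernel ::
    "('n list \<Rightarrow> 'h::complex_hilbert \<Rightarrow>\<^sub>L 'h) \<Rightarrow> 'n list \<Rightarrow> 'n list \<Rightarrow> 'h \<Rightarrow> 'h \<Rightarrow> complex" where
  "toeplitz_kernel Y [] \<beta> x y = cinner x (Y \<beta> y)"
| "toeplitz_kernel Y (i # \<alpha>) [] x y = cinner (Y (i # \<alpha>) x) y"
| "toeplitz_kernel Y (i # \<alpha>) (j # \<beta>) x y = (if i = j then toeplitz_kernel Y \<alpha> \<beta> x y else 0)"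

lemma toeplitz_kernel_herm:
  assumes "Y [] = id_blinfun"
  shows "toeplitz_kernel Y \<alpha> \<beta> x y = cnj (toeplitz_kernel Y \<beta> \<alpha> y x)"
  using assms
proof (induction Y \<alpha> \<beta> x y rule: toeplitz_kernel.induct)
  case (1 Y \<beta> x y)
  then show ?case by (cases \<beta>) (simp_all add: cinner_commute[of x])
next
  case (2 Y i \<alpha> x y)
  then show ?case by (simp add: cinner_commute[of y])
next
  case (3 Y i \<alpha> j \<beta> x y)
  then show ?case by simp
qed

context
  fixes Y :: "'n list \<Rightarrow> 'h::complex_hilbert \<Rightarrow>\<^sub>L 'h"
  assumes Y: "\<And>\<alpha>. Y \<alpha> \<in> complex_ops"
begin

lemma toeplitz_kernel_sum_left:
  "toeplitz_kernel Y \<alpha> \<beta> (\<Sum>i\<in>F. c i *\<^sub>C x i) y = (\<Sum>i\<in>F. c i * toeplitz_kernel Y \<alpha> \<beta> (x i) y)"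
  using Y
  by (induction Y \<alpha> \<beta> x' \<equiv> "\<Sum>i\<in>F. c i *\<^sub>C x i" y rule: toeplitz_kernel.induct)
    (simp_all add: cinner_sum_left cinner_scaleC_left blinfun.sum_right complex_ops_scaleC)

lemma toeplitz_kernel_sum_right:
  "toeplitz_kernel Y \<alpha> \<beta> x (\<Sum>i\<in>F. c i *\<^sub>C y i) = (\<Sum>i\<in>F. cnj (c i) * toeplitz_kernel Y \<alpha> \<beta> x (y i))"
  using Y
  by (induction Y \<alpha> \<beta> x y' \<equiv> "\<Sum>i\<in>F. c i *\<^sub>C y i" rule: toeplitz_kernel.induct)
    (simp_all add: cinner_sum_right cinner_scaleC_right blinfun.sum_right complex_ops_scaleC)

end

text \<open>These make room in \<open>('m list \<times> 'h) ell2\<close>: the vectors with prescribed Gram matrix live on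
  the range of \<open>\<iota>\<close>, and the isometries are extended to the orthogonal complement of their
  closed span with values supported on the ranges of the \<open>q j\<close>.\<close>

lemma word_injections:
  obtains \<iota> :: "'m::finite list \<times> 'h \<Rightarrow> 'm list \<times> 'h" and q :: "'m \<Rightarrow> 'm list \<times> 'h \<Rightarrow> 'm list \<times> 'h"
  where "inj \<iota>" "\<And>j. inj (q j)" "\<And>j x y. \<iota> x \<noteq> q j y" "\<And>j k x y. j \<noteq> k \<Longrightarrow> q j x \<noteq> q k y"
proof -
  define g where "g = (\<lambda>(u :: 'm option \<times> 'm list). replicate (to_nat_on UNIV u) (undefined :: 'm))"
  have "countable (UNIV :: ('m option \<times> 'm list) set)"
    by simp
  then have inj: "inj (to_nat_on (UNIV :: ('m option \<times> 'm list) set))"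
    by (rule inj_on_to_nat_on)
  have g: "g u = g v \<longleftrightarrow> u = v" for u v
    using inj by (metis g_def injD length_replicate)
  show thesis
    by (rule that[of "\<lambda>(\<alpha>, x). (g (None, \<alpha>), x)" "\<lambda>j (\<alpha>, x). (g (Some j, \<alpha>), x)"])
      (auto simp: inj_def g)
qed

text \<open>A Naimark-type dilation. Vectors w_\<alpha> x with the kernel as Gram matrix play the
  part of V_\<alpha> x, and V_j must send w_\<alpha> x to w_{j\<alpha>} x. On the complement of
  their closed span V_j is still free, but it has to be isometric there too, with ranges orthogonal
  to that span and to each other. The factor 1/\<sigma> in \<open>Y\<close> comes from the factor
  \<sigma> in the dilation equation.\<close>

lemma class_C_of_positive_kernel:
  fixes T :: "'m::finite \<Rightarrow> 'h::complex_hilbert \<Rightarrow>\<^sub>L 'h"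
  defines "Y \<equiv> \<lambda>\<sigma> \<alpha>. if \<alpha> = [] then id_blinfun else (1 / \<sigma>) *\<^sub>R word_op T \<alpha>"
  assumes T: "\<And>i. T i \<in> complex_ops" and \<sigma>: "\<sigma> > 0"
    and pos: "\<And>N h. (\<And>\<alpha>. N < length \<alpha> \<Longrightarrow> h \<alpha> = 0) \<Longrightarrow>
      0 \<le> Re (\<Sum>\<alpha> | length \<alpha> \<le> N. \<Sum>\<beta> | length \<beta> \<le> N. toeplitz_kernel (Y \<sigma>) \<alpha> \<beta> (h \<alpha>) (h \<beta>))"
  shows "class_C TYPE(('m list \<times> 'h) ell2) \<sigma> T"
proof -
  have Yc: "Y \<sigma> \<alpha> \<in> complex_ops" for \<alpha>
    using T by (simp add: Y_def complex_ops_scaleR complex_ops_word_op)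
  define K where "K = (\<lambda>(\<alpha>, x) (\<beta>, y). toeplitz_kernel (Y \<sigma>) \<alpha> \<beta> x y)"
  have "positive_kernel K"
    unfolding positive_kernel_def
  proof (intro conjI allI impI)
    show "K i j = cnj (K j i)" for i j
      unfolding K_def by (cases i; cases j) (auto intro!: toeplitz_kernel_herm simp: Y_def)
    fix F :: "('m list \<times> 'h) set" and c assume F: "finite F"
    define N where "N = Max (insert 0 ((\<lambda>i. length (fst i)) ` F))"
    have N: "length (fst i) \<le> N" if "i \<in> F" for i
      unfolding N_def using F that by (intro Max_ge) auto
    \<comment> \<open>By sesquilinearity of the kernel in its vector arguments, coefficients
      belonging to the same word can be collected in one vector. The scalar form over F becomes the
      form of the hypothesis at h.\<close>
    define h where "h = (\<lambda>\<alpha>. \<Sum>i | i \<in> F \<and> fst i = \<alpha>. c i *\<^sub>C snd i)"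
    have h0: "h \<alpha> = 0" if "N < length \<alpha>" for \<alpha>
    proof -
      have "{i. i \<in> F \<and> fst i = \<alpha>} = {}"
        using N that by force
      then show ?thesis unfolding h_def by (metis sum.empty)
    qed
    have group: "(\<Sum>i\<in>F. g i) = (\<Sum>\<alpha> | length \<alpha> \<le> N. \<Sum>i | i \<in> F \<and> fst i = \<alpha>. g i)"
      for g :: "'m list \<times> 'h \<Rightarrow> complex"
      using N by (intro sum.group[symmetric] F) auto
    have "(\<Sum>i\<in>F. \<Sum>j\<in>F. c i * cnj (c j) * K i j) =
       (\<Sum>\<alpha> | length \<alpha> \<le> N. \<Sum>i | i \<in> F \<and> fst i = \<alpha>. \<Sum>\<beta> | length \<beta> \<le> N. \<Sum>j | j \<in> F \<and> fst j = \<beta>.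
          c i * cnj (c j) * K i j)"
      by (simp only: group)
    also have "\<dots> = (\<Sum>\<alpha> | length \<alpha> \<le> N. \<Sum>\<beta> | length \<beta> \<le> N. \<Sum>i | i \<in> F \<and> fst i = \<alpha>.
        \<Sum>j | j \<in> F \<and> fst j = \<beta>. c i * cnj (c j) * K i j)"
      by (intro sum.cong refl sum.swap)
    also have "\<dots> = (\<Sum>\<alpha> | length \<alpha> \<le> N. \<Sum>\<beta> | length \<beta> \<le> N. toeplitz_kernel (Y \<sigma>) \<alpha> \<beta> (h \<alpha>) (h \<beta>))"
      unfolding h_def toeplitz_kernel_sum_left[OF Yc]
      unfolding toeplitz_kernel_sum_right[OF Yc] sum_distrib_left
      by (intro sum.cong refl) (auto simp: K_def mult.assoc)
    finally show "0 \<le> Re (\<Sum>i\<in>F. \<Sum>j\<in>F. c i * cnj (c j) * K i j)"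
      using pos[of N h] h0 by simp
  qed
  then obtain w0 :: "'m list \<times> 'h \<Rightarrow> ('m list \<times> 'h) ell2" where w0: "\<And>i j. cinner (w0 i) (w0 j) = K i j"
    using gram_vectors by blast
  obtain \<iota> :: "'m list \<times> 'h \<Rightarrow> 'm list \<times> 'h" and q :: "'m \<Rightarrow> 'm list \<times> 'h \<Rightarrow> 'm list \<times> 'h"
    where inj: "inj \<iota>" "\<And>j. inj (q j)" "\<And>j x y. \<iota> x \<noteq> q j y" "\<And>j k x y. j \<noteq> k \<Longrightarrow> q j x \<noteq> q k y"
    using word_injections by blast
  let ?b = "\<lambda>f. range (\<lambda>i. ell2_basis (f i)) :: ('m list \<times> 'h) ell2 set"
  obtain I :: "('m list \<times> 'h) ell2 \<Rightarrow>\<^sub>L ('m list \<times> 'h) ell2" where I: "isometric_op I" "\<And>x. blinfun_apply I x \<in> closed_span (?b \<iota>)"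
    using ell2_reindex[OF inj(1)] by blast
  have "\<exists>Q :: ('m list \<times> 'h) ell2 \<Rightarrow>\<^sub>L ('m list \<times> 'h) ell2. isometric_op Q \<and> (\<forall>x. blinfun_apply Q x \<in> closed_span (?b (q j)))" for j
    by (rule ell2_reindex[OF inj(2)[of j]]) blast
  then obtain Q :: "'m \<Rightarrow> ('m list \<times> 'h) ell2 \<Rightarrow>\<^sub>L ('m list \<times> 'h) ell2" where Q: "\<And>j. isometric_op (Q j)" "\<And>j x. blinfun_apply (Q j) x \<in> closed_span (?b (q j))"
    by metis
  have b_orth: "cinner (ell2_basis i) (ell2_basis j) = 0" if "i \<noteq> j" for i j :: "'m list \<times> 'h"
    using that by (simp add: cinner_ell2_basis Rep_ell2_basis)
  define w where "w = (\<lambda>\<alpha> x. I (w0 (\<alpha>, x)))"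
  have ww: "cinner (w \<alpha> x) (w \<beta> y) = toeplitz_kernel (Y \<sigma>) \<alpha> \<beta> x y" for \<alpha> \<beta> x y
    by (simp add: w_def isometric_op_cinner[OF I(1)] w0 K_def)
  define M where "M = closed_span (range (\<lambda>(\<alpha>, x). w \<alpha> x))"
  have w_Q: "cinner y (Q j z) = 0" if "y \<in> M" for y j z
  proof (rule cinner_closed_span[OF that[unfolded M_def]])
    have "cinner (I u) (Q j z) = 0" for u
      by (rule cinner_closed_spans[OF I(2) Q(2)]) (use inj(3) b_orth in blast)
    then show "cinner s (Q j z) = 0" if "s \<in> range (\<lambda>(\<alpha>, x). w \<alpha> x)" for s
      using that by (auto simp: w_def)
  qed
  have Q_orth: "cinner (Q j y) (Q k z) = 0" if "j \<noteq> k" for j k y z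
    by (rule cinner_closed_spans[OF Q(2) Q(2)]) (use inj(4)[OF that] b_orth in blast)
  obtain P where P: "P \<in> complex_ops"
    "\<And>i x. cinner (case i of (\<alpha>, y) \<Rightarrow> w \<alpha> y) (blinfun_apply P x) = cinner (case i of (\<alpha>, y) \<Rightarrow> w \<alpha> y) x"
    "\<And>x. P x \<in> M"
    using gram_partial_isometry[of "\<lambda>(\<alpha>, x). w \<alpha> x" "\<lambda>(\<alpha>, x). w \<alpha> x"] unfolding M_def by blast
  define R :: "'m \<Rightarrow> (('m list \<times> 'h) ell2 \<Rightarrow>\<^sub>L ('m list \<times> 'h) ell2) \<Rightarrow> bool" where
    "R = (\<lambda>j A. A \<in> complex_ops \<and> (\<forall>\<alpha> x. A (w \<alpha> x) = w (j # \<alpha>) x) \<and>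
      (\<forall>\<alpha> y x. cinner (w (j # \<alpha>) y) (A x) = cinner (w \<alpha> y) x) \<and>
      (\<forall>x. A x \<in> closed_span (range (\<lambda>(\<alpha>, x). w (j # \<alpha>) x))) \<and> (\<forall>x \<in> M. norm (A x) = norm x))"
  \<comment> \<open>Prefixing j to both words leaves the kernel unchanged, so the two families have
    the same Gram matrix.\<close>
  have "\<exists>A. R j A" for j
    using gram_partial_isometry[of "\<lambda>(\<alpha>, x). w \<alpha> x" "\<lambda>(\<alpha>, x). w (j # \<alpha>) x"]
    by (auto simp: R_def M_def ww)
  then obtain A where R: "\<And>j. R j (A j)"
    by metis
  have A: "\<And>j. A j \<in> complex_ops" "\<And>j \<alpha> x. blinfun_apply (A j) (w \<alpha> x) = w (j # \<alpha>) x"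
    "\<And>j \<alpha> y x. cinner (w (j # \<alpha>) y) (A j x) = cinner (w \<alpha> y) x"
    "\<And>j x. A j x \<in> closed_span (range (\<lambda>(\<alpha>, x). w (j # \<alpha>) x))" "\<And>j x. x \<in> M \<Longrightarrow> norm (A j x) = norm x"
    using R unfolding R_def by blast+
  have wM: "w \<alpha> x \<in> M" for \<alpha> x
    unfolding M_def by (intro closed_span_base) auto
  have AM: "A j x \<in> M" for j x
  proof -
    have "closed_span (range (\<lambda>(\<alpha>, x). w (j # \<alpha>) x)) \<subseteq> M"
      using wM by (intro closed_span_minimal) (auto simp: M_def subspace_closed_span)
    with A(4) show ?thesis by blast
  qed
  have A_orth: "cinner (A j y) (A k z) = 0" if "j \<noteq> k" for j k y z
    by (rule cinner_closed_spans[OF A(4) A(4)]) (use that in \<open>auto simp: ww\<close>)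
  have Pw: "P (w \<alpha> x) = w \<alpha> x" for \<alpha> x
    using P(3) wM P(2) unfolding M_def by (intro closed_span_eqI) (auto simp: image_iff)
  have AP: "A j x = A j (P x)" for j x
    using A(4) A(3) P(2)[of "(\<alpha>, y)" for \<alpha> y] by (intro closed_span_eqI) auto
  \<comment> \<open>Each A_j vanishes on the complement of M, by \<open>AP\<close>; there Q_j takes
    over. The ranges of A_j and Q_j are orthogonal, so the isometries on M and on its complement add
    up to an isometry.\<close>
  define V where "V = (\<lambda>j. A j + (Q j o\<^sub>L (id_blinfun - P)))"
  have V_apply: "V j x = A j x + Q j (x - P x)" for j x
    by (simp add: V_def blinfun.add_left blinfun.diff_left)
  have V_w: "V j (w \<alpha> x) = w (j # \<alpha>) x" for j \<alpha> x
    by (simp add: V_apply A(2) Pw blinfun.zero_right)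
  have QA: "cinner (Q k z) (A j y) = 0" for j k y z
    using w_Q[OF AM] cinner_eq_zero_commute by blast
  have V_iso: "isometric_op (V j)" for j
    unfolding isometric_op_def
  proof (intro conjI allI)
    have "Q j \<in> complex_ops"
      using Q(1) by (simp add: isometric_op_def)
    then show "V j \<in> complex_ops"
      using P(1) A(1)[of j] unfolding complex_ops_def
      by (simp add: V_apply complex_vector.scale_right_diff_distrib[symmetric] scaleC_add_right)
    fix x
    have "cinner (P x) (x - P x) = 0"
    proof (rule cinner_closed_span[OF P(3)[unfolded M_def]])
      show "cinner s (x - P x) = 0" if "s \<in> range (\<lambda>(\<alpha>, x). w \<alpha> x)" for s
        using that P(2) by (auto simp: cinner_diff_right)
    qed
    then have "(norm x)\<^sup>2 = (norm (P x))\<^sup>2 + (norm (x - P x))\<^sup>2"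
      using norm_add_square[of "P x" "x - P x"] by simp
    moreover have "(norm (V j x))\<^sup>2 = (norm (A j (P x)))\<^sup>2 + (norm (Q j (x - P x)))\<^sup>2"
      unfolding V_apply norm_add_square by (simp add: w_Q AM flip: AP)
    ultimately have "(norm (V j x))\<^sup>2 = (norm x)\<^sup>2"
      using A(5)[OF P(3)] Q(1)[of j] by (simp add: isometric_op_def)
    then show "norm (V j x) = norm x"
      by simp
  qed
  have V_orth: "cinner (V j x) (V k y) = 0" if "j \<noteq> k" for j k x y
    using that by (simp add: V_apply cinner_simps A_orth Q_orth w_Q AM QA)
  have word_V: "word_op V \<alpha> (w \<beta> x) = w (\<alpha> @ \<beta>) x" for \<alpha> \<beta> x
    by (induction \<alpha>) (simp_all add: V_w)
  have kernel_Nil: "cinner (w [] x) (w [] y) = cinner x y" for x y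
    by (simp add: ww Y_def)
  have J_lin: "w [] (x + c *\<^sub>C y) = w [] x + c *\<^sub>C w [] y" for x y c
  proof -
    let ?u = "w [] (x + c *\<^sub>C y) - (w [] x + c *\<^sub>C w [] y)"
    have "cinner ?u (w [] z) = 0" for z
      by (simp add: cinner_simps kernel_Nil)
    then have "cinner ?u ?u = 0"
      by (simp only: cinner_diff_right cinner_add_right cinner_scaleC_right) simp
    then show ?thesis
      by (simp only: cinner_eq_zero_iff) simp
  qed
  have J_zero: "w [] 0 = 0"
    using kernel_Nil[of 0 0] by simp
  have J_norm: "norm (w [] x) = norm x" for x
  proof -
    have "(norm (w [] x))\<^sup>2 = (norm x)\<^sup>2"
      using kernel_Nil[of x x] by (simp only: cinner_self of_real_eq_iff)
    then show ?thesis by simp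
  qed
  have J_scale: "w [] (c *\<^sub>C x) = c *\<^sub>C w [] x" for c x
    using J_lin[of 0 c x] by (simp add: J_zero)
  have "bounded_linear (w [])"
    using J_lin[of _ 1]
    by (intro bounded_linear_intro[where K = 1]) (simp_all add: J_scale J_norm scaleR_scaleC)
  then have J: "blinfun_apply (Blinfun (w [])) = w []"
    by (rule bounded_linear_Blinfun_apply)
  have J_sub: "complex_vector.subspace (range (w []))"
    unfolding complex_vector.subspace_def
    using J_lin[of _ 1] by (auto simp: J_zero[symmetric] image_iff simp flip: J_scale) (metis scaleC_one)+
  have proj: "w [] (word_op T \<alpha> x) = \<sigma> *\<^sub>R orth_proj (range (w [])) (word_op V \<alpha> (w [] x))"
    if "\<alpha> \<noteq> []" for \<alpha> x
  proof -
    have "orth_proj (range (w [])) (word_op V \<alpha> (w [] x)) = w [] (Y \<sigma> \<alpha> x)"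
    proof (rule orth_proj_eqI[OF J_sub])
      fix y assume "y \<in> range (w [])"
      then obtain z where z: "y = w [] z" by blast
      obtain i \<alpha>' where "\<alpha> = i # \<alpha>'"
        using \<open>\<alpha> \<noteq> []\<close> by (cases \<alpha>) auto
      then have "cinner (w \<alpha> x) (w [] z) = cinner (Y \<sigma> \<alpha> x) z"
        by (simp add: ww)
      then show "cinner (word_op V \<alpha> (w [] x) - w [] (Y \<sigma> \<alpha> x)) y = 0"
        by (simp add: z word_V cinner_diff_left kernel_Nil)
    qed simp
    then show ?thesis
      using that \<sigma> by (simp add: Y_def blinfun.scaleR_left scaleR_scaleC J_scale scaleC_scaleC)
  qed
  show ?thesis
    unfolding class_C_def
    by (intro conjI allI impI T exI[of _ "Blinfun (w [])"] exI[of _ V])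
      (auto simp: isometric_op_def[of "Blinfun (w [])"] complex_ops_def J J_scale J_norm V_iso V_orth proj)
qed

section \<open>Positivity of multi-Toeplitz kernels\<close>

lemma sum_words_le_Suc_neutral:
  fixes f :: "'n::finite list \<Rightarrow> 'a::comm_monoid_add"
  assumes "\<And>\<alpha>. length \<alpha> = Suc N \<Longrightarrow> f \<alpha> = 0"
  shows "(\<Sum>\<alpha> | length \<alpha> \<le> Suc N. f \<alpha>) = (\<Sum>\<alpha> | length \<alpha> \<le> N. f \<alpha>)"
  by (rule sum.mono_neutral_right) (auto simp: le_Suc_eq intro: assms)

lemma sum_words_le_snoc:
  fixes f :: "'n::finite list \<Rightarrow> 'a::comm_monoid_add"
  shows "(\<Sum>\<alpha> | length \<alpha> \<le> Suc N. f \<alpha>) = f [] + (\<Sum>\<alpha> | length \<alpha> \<le> N. \<Sum>i\<in>UNIV. f (\<alpha> @ [i]))"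
  unfolding sum_words_le by (subst sum.atMost_Suc_shift) (simp add: sum_words_snoc)

lemma Re_of_real_mult: "Re (complex_of_real r * z) = r * Re z"
  by simp

text \<open>When \<open>Y []\<close> is the identity, this is the quadratic form of
  \<open>toeplitz_kernel\<close> at an h supported on words of length at most N: entries at
  (\<alpha>\<gamma>, \<alpha>) and their conjugates are paired, and the diagonal, then counted
  twice, is subtracted once.\<close>

definition toeplitz_form ::
    "('n::finite list \<Rightarrow> 'h::complex_hilbert \<Rightarrow>\<^sub>L 'h) \<Rightarrow> nat \<Rightarrow> ('n list \<Rightarrow> 'h) \<Rightarrow> real" where
  "toeplitz_form Y N h =
     2 * Re (\<Sum>\<alpha> | length \<alpha> \<le> N. \<Sum>\<gamma> | length \<gamma> \<le> N. cinner (Y \<gamma> (h (\<alpha> @ \<gamma>))) (h \<alpha>)) -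
     (\<Sum>\<alpha> | length \<alpha> \<le> N. (norm (h \<alpha>))\<^sup>2)"

text \<open>Induction by first letter: the empty word contributes one row and one column, and the
  remaining matrix is block diagonal, with one copy of the same form for every letter.\<close>

lemma toeplitz_kernel_form:
  assumes "Y [] = id_blinfun" and "\<And>\<alpha>. N < length \<alpha> \<Longrightarrow> h \<alpha> = 0"
  shows "Re (\<Sum>\<alpha> | length \<alpha> \<le> N. \<Sum>\<beta> | length \<beta> \<le> N. toeplitz_kernel Y \<alpha> \<beta> (h \<alpha>) (h \<beta>)) =
    toeplitz_form Y N h"
  using assms(2)
proof (induction N arbitrary: h)
  case 0
  have "{\<alpha>::'a list. length \<alpha> = 0} = {[]}" by auto
  then show ?case
    by (simp add: toeplitz_form_def assms(1) cinner_self)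
next
  case (Suc N)
  define u where "u = (\<Sum>i\<in>UNIV. \<Sum>\<alpha> | length \<alpha> \<le> N. cinner (Y (i # \<alpha>) (h (i # \<alpha>))) (h []))"
  have IH: "Re (\<Sum>\<alpha> | length \<alpha> \<le> N. \<Sum>\<beta> | length \<beta> \<le> N. toeplitz_kernel Y \<alpha> \<beta> (h (i # \<alpha>)) (h (i # \<beta>))) =
      toeplitz_form Y N (\<lambda>\<alpha>. h (i # \<alpha>))" for i
    by (rule Suc.IH) (simp add: Suc.prems)
  have cnj_u: "(\<Sum>i\<in>UNIV. \<Sum>\<alpha> | length \<alpha> \<le> N. cinner (h []) (Y (i # \<alpha>) (h (i # \<alpha>)))) = cnj u"
    unfolding u_def cnj_sum by (intro sum.cong refl) (rule cinner_commute)
  have diag: "(\<Sum>j\<in>UNIV. \<Sum>\<beta> | length \<beta> \<le> N. if i = j then toeplitz_kernel Y \<alpha> \<beta> x (h (j # \<beta>)) else 0) =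
      (\<Sum>\<beta> | length \<beta> \<le> N. toeplitz_kernel Y \<alpha> \<beta> x (h (i # \<beta>)))" for i \<alpha> x
    by (subst sum.swap) simp
  have "(\<Sum>\<alpha> | length \<alpha> \<le> Suc N. \<Sum>\<beta> | length \<beta> \<le> Suc N. toeplitz_kernel Y \<alpha> \<beta> (h \<alpha>) (h \<beta>)) =
      cinner (h []) (h []) + cnj u + u + (\<Sum>i\<in>UNIV. \<Sum>\<alpha> | length \<alpha> \<le> N. \<Sum>\<beta> | length \<beta> \<le> N.
        toeplitz_kernel Y \<alpha> \<beta> (h (i # \<alpha>)) (h (i # \<beta>)))"
    by (simp add: sum_words_le_Suc assms(1) sum.distrib cnj_u diag) (simp add: u_def)
  then have lhs: "Re (\<Sum>\<alpha> | length \<alpha> \<le> Suc N. \<Sum>\<beta> | length \<beta> \<le> Suc N. toeplitz_kernel Y \<alpha> \<beta> (h \<alpha>) (h \<beta>)) =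
      (norm (h []))\<^sup>2 + 2 * Re u + (\<Sum>i\<in>UNIV. toeplitz_form Y N (\<lambda>\<alpha>. h (i # \<alpha>)))"
    by (simp add: cinner_self flip: IH)
  have trunc: "(\<Sum>\<gamma> | length \<gamma> \<le> Suc N. cinner (Y \<gamma> (h (i # \<alpha> @ \<gamma>))) (h (i # \<alpha>))) =
      (\<Sum>\<gamma> | length \<gamma> \<le> N. cinner (Y \<gamma> (h (i # \<alpha> @ \<gamma>))) (h (i # \<alpha>)))" for i \<alpha>
    by (rule sum_words_le_Suc_neutral) (simp add: Suc.prems blinfun.zero_right)
  have "(\<Sum>\<alpha> | length \<alpha> \<le> Suc N. \<Sum>\<gamma> | length \<gamma> \<le> Suc N. cinner (Y \<gamma> (h (\<alpha> @ \<gamma>))) (h \<alpha>)) =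
      (\<Sum>\<gamma> | length \<gamma> \<le> Suc N. cinner (Y \<gamma> (h \<gamma>)) (h [])) +
      (\<Sum>i\<in>UNIV. \<Sum>\<alpha> | length \<alpha> \<le> N. \<Sum>\<gamma> | length \<gamma> \<le> N. cinner (Y \<gamma> (h (i # \<alpha> @ \<gamma>))) (h (i # \<alpha>)))"
    by (subst sum_words_le_Suc) (simp add: trunc)
  also have "(\<Sum>\<gamma> | length \<gamma> \<le> Suc N. cinner (Y \<gamma> (h \<gamma>)) (h [])) = cinner (h []) (h []) + u"
    by (simp add: sum_words_le_Suc assms(1) u_def)
  finally show ?case
    unfolding lhs
    by (simp add: toeplitz_form_def sum_words_le_Suc[of "\<lambda>\<alpha>. (norm (h \<alpha>))\<^sup>2"] cinner_self sum_subtractf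
        sum_distrib_left)
qed

text \<open>With $g_\alpha = \sum_\gamma W_\gamma h_{\alpha\gamma}$ and
  $z_\alpha = \sum_j W_j g_{\alpha g_j}$ one has $h = g - z$, so that
  $2\,\mathrm{Re}\langle g, h\rangle - \|h\|^2 = \|g\|^2 - \|z\|^2$.\<close>

lemma toeplitz_form_row_bounded:
  fixes W :: "'n::finite \<Rightarrow> 'h::complex_hilbert \<Rightarrow>\<^sub>L 'h"
  assumes W: "row_bounded c W" and "0 \<le> c" and h: "\<And>\<alpha>. N < length \<alpha> \<Longrightarrow> h \<alpha> = 0"
  obtains G Z where "0 \<le> G" "0 \<le> Z" "Z \<le> c * G" "toeplitz_form (word_op W) N h = G\<^sup>2 - Z\<^sup>2"
    "L2_set (\<lambda>\<alpha>. norm (h \<alpha>)) {\<alpha>. length \<alpha> \<le> N} \<le> G + Z"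
    "G \<le> L2_set (\<lambda>\<alpha>. norm (h \<alpha>)) {\<alpha>. length \<alpha> \<le> N} + Z"
proof -
  let ?S = "{\<alpha>::'n list. length \<alpha> \<le> N}"
  define g where "g = (\<lambda>\<alpha>. \<Sum>\<gamma>\<in>?S. word_op W \<gamma> (h (\<alpha> @ \<gamma>)))"
  define z where "z = (\<lambda>\<alpha>. \<Sum>j\<in>UNIV. W j (g (\<alpha> @ [j])))"
  have g0: "g \<alpha> = 0" if "N < length \<alpha>" for \<alpha>
    unfolding g_def by (rule sum.neutral) (use that in \<open>simp add: h blinfun.zero_right\<close>)
  have g_eq: "g \<alpha> = h \<alpha> + z \<alpha>" for \<alpha>
  proof -
    \<comment> \<open>Raising the length bound to N + 1 adds vanishing terms and makes room to split
      off the first letter of \<gamma>; the words starting with j assemble to W_j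
      g_{\<alpha>j}.\<close>
    have "g \<alpha> = (\<Sum>\<gamma> | length \<gamma> \<le> Suc N. word_op W \<gamma> (h (\<alpha> @ \<gamma>)))"
      unfolding g_def
      by (rule sum_words_le_Suc_neutral[symmetric]) (simp add: h blinfun.zero_right)
    also have "\<dots> = h \<alpha> + z \<alpha>"
      unfolding sum_words_le_Suc z_def g_def by (simp add: blinfun.sum_right)
    finally show ?thesis .
  qed
  define G where "G = L2_set (\<lambda>\<alpha>. norm (g \<alpha>)) ?S"
  define Z where "Z = L2_set (\<lambda>\<alpha>. norm (z \<alpha>)) ?S"
  define H where "H = L2_set (\<lambda>\<alpha>. norm (h \<alpha>)) ?S"
  have G2: "G\<^sup>2 = (\<Sum>\<alpha>\<in>?S. (norm (g \<alpha>))\<^sup>2)" and Z2: "Z\<^sup>2 = (\<Sum>\<alpha>\<in>?S. (norm (z \<alpha>))\<^sup>2)"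
    by (simp_all add: G_def Z_def L2_set_def sum_nonneg)
  have "Z\<^sup>2 \<le> (\<Sum>\<alpha>\<in>?S. c\<^sup>2 * (\<Sum>j\<in>UNIV. (norm (g (\<alpha> @ [j])))\<^sup>2))"
    unfolding Z2 z_def by (intro sum_mono row_boundedD[OF W])
  also have "\<dots> = c\<^sup>2 * (\<Sum>\<alpha>\<in>?S. \<Sum>j\<in>UNIV. (norm (g (\<alpha> @ [j])))\<^sup>2)"
    by (simp add: sum_distrib_left)
  \<comment> \<open>The words \<alpha> followed by a letter are exactly the nonempty ones; the empty
    word completes the sum to G^2.\<close>
  also have "\<dots> \<le> c\<^sup>2 * ((norm (g []))\<^sup>2 + (\<Sum>\<alpha>\<in>?S. \<Sum>j\<in>UNIV. (norm (g (\<alpha> @ [j])))\<^sup>2))"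
    by (intro mult_left_mono) simp_all
  also have "\<dots> = c\<^sup>2 * (\<Sum>\<alpha> | length \<alpha> \<le> Suc N. (norm (g \<alpha>))\<^sup>2)"
    by (simp add: sum_words_le_snoc)
  also have "\<dots> = c\<^sup>2 * G\<^sup>2"
    unfolding G2 by (subst sum_words_le_Suc_neutral) (simp_all add: g0)
  finally have "Z\<^sup>2 \<le> (c * G)\<^sup>2"
    by (simp add: power_mult_distrib)
  then have "Z \<le> c * G"
    by (rule power2_le_imp_le) (simp add: G_def \<open>0 \<le> c\<close> L2_set_nonneg)
  moreover have "0 \<le> G" "0 \<le> Z"
    by (simp_all add: G_def Z_def L2_set_nonneg)
  moreover have "toeplitz_form (word_op W) N h = G\<^sup>2 - Z\<^sup>2"
  proof -
    have "toeplitz_form (word_op W) N h = (\<Sum>\<alpha>\<in>?S. 2 * Re (cinner (g \<alpha>) (h \<alpha>)) - (norm (h \<alpha>))\<^sup>2)"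
      by (simp add: toeplitz_form_def g_def cinner_sum_left sum_subtractf sum_distrib_left)
    also have "\<dots> = (\<Sum>\<alpha>\<in>?S. (norm (g \<alpha>))\<^sup>2 - (norm (z \<alpha>))\<^sup>2)"
    proof (rule sum.cong[OF refl])
      fix \<alpha>
      have "z \<alpha> = g \<alpha> - h \<alpha>"
        by (simp add: g_eq)
      then show "2 * Re (cinner (g \<alpha>) (h \<alpha>)) - (norm (h \<alpha>))\<^sup>2 = (norm (g \<alpha>))\<^sup>2 - (norm (z \<alpha>))\<^sup>2"
        by (simp add: norm_diff_square)
    qed
    finally show ?thesis
      by (simp add: G2 Z2 sum_subtractf)
  qed
  moreover have "H \<le> G + Z"
  proof -
    have "H \<le> L2_set (\<lambda>\<alpha>. norm (g \<alpha>) + norm (z \<alpha>)) ?S"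
      unfolding H_def
    proof (rule L2_set_mono)
      show "norm (h \<alpha>) \<le> norm (g \<alpha>) + norm (z \<alpha>)" for \<alpha>
        using norm_triangle_ineq4[of "g \<alpha>" "z \<alpha>"] by (simp add: g_eq)
    qed simp
    also have "\<dots> \<le> G + Z"
      unfolding G_def Z_def by (rule L2_set_triangle_ineq)
    finally show ?thesis .
  qed
  moreover have "G \<le> H + Z"
  proof -
    have "G \<le> L2_set (\<lambda>\<alpha>. norm (h \<alpha>) + norm (z \<alpha>)) ?S"
      unfolding G_def g_eq by (intro L2_set_mono norm_triangle_ineq) simp
    also have "\<dots> \<le> H + Z"
      unfolding H_def Z_def by (rule L2_set_triangle_ineq)
    finally show ?thesis .
  qed
  ultimately show thesis
    using that unfolding H_def by blast
qed

text \<open>With H the norm of h, the form is (G - Z) (G + Z), where G - Z <= H <= G + Z. The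
  inequality Z <= c G is the same as (1 - c) (G + Z) <= (1 + c) (G - Z); trading one factor for the
  other produces the Harnack constants.\<close>

lemma
  fixes W :: "'n::finite \<Rightarrow> 'h::complex_hilbert \<Rightarrow>\<^sub>L 'h"
  assumes W: "row_bounded c W" and c: "0 \<le> c" and h: "\<And>\<alpha>. N < length \<alpha> \<Longrightarrow> h \<alpha> = 0"
  shows toeplitz_form_nonneg: "c \<le> 1 \<Longrightarrow> 0 \<le> toeplitz_form (word_op W) N h"
    and toeplitz_form_lower: "c < 1 \<Longrightarrow>
      (1 - c) / (1 + c) * (\<Sum>\<alpha> | length \<alpha> \<le> N. (norm (h \<alpha>))\<^sup>2) \<le> toeplitz_form (word_op W) N h"
    and toeplitz_form_upper: "c < 1 \<Longrightarrow>
      toeplitz_form (word_op W) N h \<le> (1 + c) / (1 - c) * (\<Sum>\<alpha> | length \<alpha> \<le> N. (norm (h \<alpha>))\<^sup>2)"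
proof -
  define H where "H = L2_set (\<lambda>\<alpha>. norm (h \<alpha>)) {\<alpha>::'n list. length \<alpha> \<le> N}"
  have H2: "(\<Sum>\<alpha> | length \<alpha> \<le> N. (norm (h \<alpha>))\<^sup>2) = H\<^sup>2" and H0: "0 \<le> H"
    by (simp_all add: H_def L2_set_def sum_nonneg)
  obtain G Z where G0: "0 \<le> G" and Z: "0 \<le> Z" "Z \<le> c * G" and form: "toeplitz_form (word_op W) N h = G\<^sup>2 - Z\<^sup>2"
    and H: "H \<le> G + Z" "G \<le> H + Z"
    unfolding H_def by (rule toeplitz_form_row_bounded[OF W c h])
  have fact: "G\<^sup>2 - Z\<^sup>2 = (G - Z) * (G + Z)"
    by (simp add: power2_eq_square algebra_simps)
  have GZ: "0 \<le> G - Z" if "c \<le> 1"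
    using Z mult_right_mono[OF that G0] by linarith
  show "0 \<le> toeplitz_form (word_op W) N h" if "c \<le> 1"
    unfolding form fact using GZ[OF that] G0 Z by (intro mult_nonneg_nonneg) linarith+
  have key: "(1 - c) * (G + Z) \<le> (1 + c) * (G - Z)"
    using Z by (simp add: algebra_simps)
  show "(1 - c) / (1 + c) * (\<Sum>\<alpha> | length \<alpha> \<le> N. (norm (h \<alpha>))\<^sup>2) \<le> toeplitz_form (word_op W) N h" if "c < 1"
  proof -
    have "(1 - c) / (1 + c) * H\<^sup>2 \<le> (1 - c) / (1 + c) * (G + Z)\<^sup>2"
      using that c H H0 by (intro mult_left_mono power_mono) simp_all
    also have "\<dots> = ((1 - c) * (G + Z)) * (G + Z) / (1 + c)"
      by (simp add: power2_eq_square)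
    also have "\<dots> \<le> ((1 + c) * (G - Z)) * (G + Z) / (1 + c)"
      using c G0 Z key by (intro divide_right_mono mult_right_mono) simp_all
    also have "\<dots> = (G - Z) * (G + Z)"
      using c by simp
    finally show ?thesis
      by (simp add: H2 form fact)
  qed
  show "toeplitz_form (word_op W) N h \<le> (1 + c) / (1 - c) * (\<Sum>\<alpha> | length \<alpha> \<le> N. (norm (h \<alpha>))\<^sup>2)" if "c < 1"
  proof -
    have "(G - Z) * (G + Z) = (G - Z) * ((1 - c) * (G + Z)) / (1 - c)"
      using that by simp
    also have "\<dots> \<le> (G - Z) * ((1 + c) * (G - Z)) / (1 - c)"
      using that GZ key by (intro divide_right_mono mult_left_mono) simp_all
    also have "\<dots> = (1 + c) / (1 - c) * (G - Z)\<^sup>2"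
      by (simp add: power2_eq_square)
    also have "\<dots> \<le> (1 + c) / (1 - c) * H\<^sup>2"
      using that c GZ H by (intro mult_left_mono power_mono) simp_all
    finally show ?thesis
      by (simp add: H2 form fact)
  qed
qed

lemma row_bounded_scalars:
  fixes z :: "complex ^ 'm::finite"
  shows "row_bounded (norm z) (\<lambda>j. scaleC_op (z $ j) (id_blinfun :: 'h::complex_hilbert \<Rightarrow>\<^sub>L 'h))"
  unfolding row_bounded_def
proof (intro conjI allI complex_ops_scaleC_op complex_ops_id)
  fix x :: "'m \<Rightarrow> 'h"
  have "norm (\<Sum>j\<in>UNIV. (z $ j) *\<^sub>C x j) \<le> (\<Sum>j\<in>UNIV. \<bar>cmod (z $ j)\<bar> * \<bar>norm (x j)\<bar>)"
    by (intro sum_norm_le) (simp add: norm_scaleC)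
  also have "\<dots> \<le> L2_set (\<lambda>j. cmod (z $ j)) UNIV * L2_set (\<lambda>j. norm (x j)) UNIV"
    by (rule L2_set_mult_ineq)
  finally have "(norm (\<Sum>j\<in>UNIV. (z $ j) *\<^sub>C x j))\<^sup>2 \<le> (norm z * L2_set (\<lambda>j. norm (x j)) UNIV)\<^sup>2"
    by (intro power_mono) (simp_all add: norm_vec_def)
  also have "\<dots> = (norm z)\<^sup>2 * (\<Sum>j\<in>UNIV. (norm (x j))\<^sup>2)"
    by (simp add: power_mult_distrib L2_set_def sum_nonneg)
  finally show "(norm (\<Sum>j\<in>UNIV. blinfun_apply (scaleC_op (z $ j) id_blinfun) (x j)))\<^sup>2 \<le>
      (norm z)\<^sup>2 * (\<Sum>j\<in>UNIV. (norm (x j))\<^sup>2)"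
    by simp
qed

text \<open>For \<rho> < 1 the new constant is a convex combination of 1 and \<rho>, hence at least
  \<rho>; for \<rho> >= 1 it is at least 1.\<close>

lemma rho_image_pos:
  assumes "0 < \<rho>" "0 \<le> c" "c < 1"
  shows "0 < rho_image \<rho> c"
proof (cases "\<rho> < 1")
  case True
  define t where "t = (1 - c) / (1 + c)"
  have "t \<le> 1"
    using assms by (simp add: t_def)
  then have "(1 - \<rho>) * t \<le> 1 - \<rho>"
    using mult_left_mono[of t 1 "1 - \<rho>"] True by simp
  moreover have "rho_image \<rho> c = 1 - (1 - \<rho>) * t"
    using True by (simp add: rho_image_def t_def[symmetric] algebra_simps)
  ultimately show ?thesis
    using assms(1) by linarith
next
  case False
  then have "0 \<le> (\<rho> - 1) * ((1 + c) / (1 - c))"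
    using assms by (intro mult_nonneg_nonneg divide_nonneg_nonneg) simp_all
  then show ?thesis
    using False by (simp add: rho_image_def)
qed

lemma class_C_of_moments:
  fixes Y :: "'m::finite \<Rightarrow> 'h::complex_hilbert \<Rightarrow>\<^sub>L 'h" and W :: "'m \<Rightarrow> 'g::complex_hilbert \<Rightarrow>\<^sub>L 'g"
    and z :: "complex ^ 'm"
  assumes Y: "\<And>j. Y j \<in> complex_ops" and W: "row_bounded 1 W" and J: "isometric_op J"
    and z: "norm z < 1" and \<rho>: "0 < \<rho>"
    and moments: "\<And>\<beta> x y. cinner (word_op Y \<beta> x) y = complex_of_real \<rho> * cinner (word_op W \<beta> (J x)) (J y) +
      complex_of_real (1 - \<rho>) * cinner (word_op (\<lambda>j. scaleC_op (z $ j) id_blinfun) \<beta> x) y"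
  shows "class_C TYPE(('m list \<times> 'h) ell2) (rho_image \<rho> (norm z)) Y"
proof (rule class_C_of_positive_kernel[OF Y])
  define c where "c = norm z"
  define \<sigma> where "\<sigma> = rho_image \<rho> (norm z)"
  define D where "D = (\<lambda>j. scaleC_op (z $ j) (id_blinfun :: 'h \<Rightarrow>\<^sub>L 'h))"
  define Y' where "Y' = (\<lambda>\<alpha>. if \<alpha> = [] then id_blinfun else (1 / \<sigma>) *\<^sub>R word_op Y \<alpha>)"
  show \<sigma>0: "0 < rho_image \<rho> (norm z)"
    by (rule rho_image_pos) (use z \<rho> in simp_all)
  fix N and h :: "'m list \<Rightarrow> 'h"
  assume h: "\<And>\<alpha>. N < length \<alpha> \<Longrightarrow> h \<alpha> = 0"
  let ?S = "{\<alpha>::'m list. length \<alpha> \<le> N}"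
  define H where "H = (\<Sum>\<alpha>\<in>?S. (norm (h \<alpha>))\<^sup>2)"
  have H0: "0 \<le> H"
    by (simp add: H_def sum_nonneg)
  have form_Y: "toeplitz_form (word_op Y) N h =
      \<rho> * toeplitz_form (word_op W) N (\<lambda>\<alpha>. J (h \<alpha>)) + (1 - \<rho>) * toeplitz_form (word_op D) N h"
  proof -
    have nJ: "norm (J x) = norm x" for x
      using J by (simp add: isometric_op_def)
    have "(\<Sum>\<alpha>\<in>?S. \<Sum>\<gamma>\<in>?S. cinner (word_op Y \<gamma> (h (\<alpha> @ \<gamma>))) (h \<alpha>)) =
       complex_of_real \<rho> * (\<Sum>\<alpha>\<in>?S. \<Sum>\<gamma>\<in>?S. cinner (word_op W \<gamma> (J (h (\<alpha> @ \<gamma>)))) (J (h \<alpha>))) +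
       complex_of_real (1 - \<rho>) * (\<Sum>\<alpha>\<in>?S. \<Sum>\<gamma>\<in>?S. cinner (word_op D \<gamma> (h (\<alpha> @ \<gamma>))) (h \<alpha>))"
      by (simp only: moments D_def sum.distrib sum_distrib_left)
    then have "Re (\<Sum>\<alpha>\<in>?S. \<Sum>\<gamma>\<in>?S. cinner (word_op Y \<gamma> (h (\<alpha> @ \<gamma>))) (h \<alpha>)) =
       \<rho> * Re (\<Sum>\<alpha>\<in>?S. \<Sum>\<gamma>\<in>?S. cinner (word_op W \<gamma> (J (h (\<alpha> @ \<gamma>)))) (J (h \<alpha>))) +
       (1 - \<rho>) * Re (\<Sum>\<alpha>\<in>?S. \<Sum>\<gamma>\<in>?S. cinner (word_op D \<gamma> (h (\<alpha> @ \<gamma>))) (h \<alpha>))"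
      by (simp only: plus_complex.simps Re_of_real_mult)
    then show ?thesis
      unfolding toeplitz_form_def nJ by (simp only:) (simp only: algebra_simps)
  qed
  \<comment> \<open>\<open>Y'\<close> scales the off-diagonal entries by 1/\<sigma> and keeps the
    diagonal at 1. Multiplication by \<sigma> restores the entries of Y and leaves \<sigma> on the
    diagonal, an excess of \<sigma> - 1.\<close>
  have form_Y': "\<sigma> * toeplitz_form Y' N h = toeplitz_form (word_op Y) N h + (\<sigma> - 1) * H"
  proof -
    have "cinner (Y' \<gamma> x) y = complex_of_real (1 / \<sigma>) * cinner (word_op Y \<gamma> x) y +
        (if \<gamma> = [] then complex_of_real (1 - 1 / \<sigma>) * cinner x y else 0)" for \<gamma> x y
      by (simp add: Y'_def blinfun.scaleR_left cinner_scaleR_left algebra_simps)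
    then have "(\<Sum>\<alpha>\<in>?S. \<Sum>\<gamma>\<in>?S. cinner (Y' \<gamma> (h (\<alpha> @ \<gamma>))) (h \<alpha>)) =
       complex_of_real (1 / \<sigma>) * (\<Sum>\<alpha>\<in>?S. \<Sum>\<gamma>\<in>?S. cinner (word_op Y \<gamma> (h (\<alpha> @ \<gamma>))) (h \<alpha>)) +
       (\<Sum>\<alpha>\<in>?S. \<Sum>\<gamma>\<in>?S. if \<gamma> = [] then complex_of_real (1 - 1 / \<sigma>) * cinner (h (\<alpha> @ \<gamma>)) (h \<alpha>) else 0)"
      by (simp only: sum.distrib sum_distrib_left)
    also have "(\<Sum>\<alpha>\<in>?S. \<Sum>\<gamma>\<in>?S. if \<gamma> = [] then complex_of_real (1 - 1 / \<sigma>) * cinner (h (\<alpha> @ \<gamma>)) (h \<alpha>) else 0)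
        = complex_of_real ((1 - 1 / \<sigma>) * H)"
      by (simp add: H_def cinner_self sum_distrib_left)
    finally have "Re (\<Sum>\<alpha>\<in>?S. \<Sum>\<gamma>\<in>?S. cinner (Y' \<gamma> (h (\<alpha> @ \<gamma>))) (h \<alpha>)) =
        (1 / \<sigma>) * Re (\<Sum>\<alpha>\<in>?S. \<Sum>\<gamma>\<in>?S. cinner (word_op Y \<gamma> (h (\<alpha> @ \<gamma>))) (h \<alpha>)) + (1 - 1 / \<sigma>) * H"
      by (simp only: plus_complex.simps Re_complex_of_real Re_of_real_mult)
    moreover have "\<sigma> * (2 * A - H) = 2 * B - H + (\<sigma> - 1) * H"
      if "A = 1 / \<sigma> * B + (1 - 1 / \<sigma>) * H" for A B
    proof -
      have "\<sigma> * A = B + (\<sigma> - 1) * H"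
        using that \<sigma>0 by (simp add: \<sigma>_def[symmetric] field_simps)
      then show ?thesis by (simp add: algebra_simps)
    qed
    ultimately show ?thesis
      unfolding toeplitz_form_def H_def[symmetric] by blast
  qed
  have formW: "0 \<le> toeplitz_form (word_op W) N (\<lambda>\<alpha>. J (h \<alpha>))"
    by (rule toeplitz_form_nonneg[OF W]) (simp_all add: h blinfun.zero_right)
  have D: "row_bounded c D"
    unfolding D_def c_def by (rule row_bounded_scalars)
  have c: "0 \<le> c" "c < 1"
    using z by (simp_all add: c_def)
  have "0 \<le> toeplitz_form (word_op Y) N h + (\<sigma> - 1) * H"
  proof (cases "\<rho> < 1")
    case True
    \<comment> \<open>Here 1 - \<rho> > 0, so the scalar kernel helps and the lower Harnack bound
      applies; it exactly offsets the negative (\<sigma> - 1) H.\<close>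
    have "(1 - \<rho>) * ((1 - c) / (1 + c) * H) \<le> (1 - \<rho>) * toeplitz_form (word_op D) N h"
      unfolding H_def using True by (intro mult_left_mono toeplitz_form_lower[OF D c(1) h c(2)]) simp_all
    moreover have "(\<sigma> - 1) * H = - ((1 - \<rho>) * ((1 - c) / (1 + c) * H))"
    proof -
      have "\<sigma> - 1 = (\<rho> - 1) * ((1 - c) / (1 + c))"
        using True by (simp add: \<sigma>_def rho_image_def c_def)
      moreover have "(\<rho> - 1) * t * H = - ((1 - \<rho>) * (t * H))" for t
        by (simp add: algebra_simps)
      ultimately show ?thesis by (simp only:)
    qed
    moreover have "0 \<le> \<rho> * toeplitz_form (word_op W) N (\<lambda>\<alpha>. J (h \<alpha>))"
      using formW \<rho> by simp
    ultimately show ?thesis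
      unfolding form_Y by linarith
  next
    case False
    \<comment> \<open>Here 1 - \<rho> <= 0, so the scalar kernel counts against positivity; the
      upper Harnack bound limits the loss to (\<sigma> - 1) H.\<close>
    have "(\<rho> - 1) * toeplitz_form (word_op D) N h \<le> (\<rho> - 1) * ((1 + c) / (1 - c) * H)"
      unfolding H_def using False by (intro mult_left_mono toeplitz_form_upper[OF D c(1) h c(2)]) simp_all
    moreover have "(\<sigma> - 1) * H = (\<rho> - 1) * ((1 + c) / (1 - c) * H)"
      using False by (simp add: \<sigma>_def rho_image_def c_def)
    moreover have "0 \<le> \<rho> * toeplitz_form (word_op W) N (\<lambda>\<alpha>. J (h \<alpha>))"
      using formW \<rho> by simp
    moreover have "(1 - \<rho>) * toeplitz_form (word_op D) N h = - ((\<rho> - 1) * toeplitz_form (word_op D) N h)"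
      by (simp add: algebra_simps)
    ultimately show ?thesis
      unfolding form_Y by linarith
  qed
  then have "0 \<le> toeplitz_form Y' N h"
    using \<sigma>0 unfolding form_Y'[symmetric] \<sigma>_def[symmetric] by (simp add: zero_le_mult_iff)
  also have "toeplitz_form Y' N h =
      Re (\<Sum>\<alpha>\<in>?S. \<Sum>\<beta>\<in>?S. toeplitz_kernel Y' \<alpha> \<beta> (h \<alpha>) (h \<beta>))"
    by (rule toeplitz_kernel_form[symmetric]) (simp_all add: Y'_def h)
  finally show "0 \<le> Re (\<Sum>\<alpha>\<in>?S. \<Sum>\<beta>\<in>?S. toeplitz_kernel (\<lambda>\<alpha>. if \<alpha> = [] then id_blinfun else
      (1 / rho_image \<rho> (norm z)) *\<^sub>R word_op Y \<alpha>) \<alpha> \<beta> (h \<alpha>) (h \<beta>))"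
    by (simp only: Y'_def \<sigma>_def)
qed

section \<open>Functional calculus\<close>

lemma eventually_at_left_1: "\<forall>\<^sub>F r::real in at_left 1. 0 \<le> r \<and> r < 1"
proof -
  have "\<forall>\<^sub>F r::real in at_left 1. r \<in> {0<..<1}"
    by (rule eventually_at_left_real) simp
  then show ?thesis
    by eventually_elim simp
qed

lemma word_op_snoc: "word_op X (\<alpha> @ [i]) = word_op X \<alpha> o\<^sub>L X i"
  by (rule blinfun_eqI) (simp add: word_op_append_apply)

lemma isometric_range:
  fixes J :: "'h::complex_hilbert \<Rightarrow>\<^sub>L 'g::complex_hilbert"
  assumes J: "isometric_op J"
  shows "complex_vector.subspace (range J)" "closed (range J)"
proof -
  have Jc: "J (c *\<^sub>C x) = c *\<^sub>C J x" and Jn: "norm (J x) = norm x" for c x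
    using J by (simp_all add: isometric_op_def complex_ops_def)
  show "complex_vector.subspace (range J)"
    unfolding complex_vector.subspace_def
    by (auto simp: image_iff blinfun.zero_right simp flip: Jc blinfun.add_right
        intro: exI[of _ "0::'h"])
  have "complete (range J)"
    by (rule complete_isometric_image[of 1 UNIV])
      (simp_all add: Jn blinfun.bounded_linear_right complete_UNIV)
  then show "closed (range J)"
    by (rule complete_imp_closed)
qed

text \<open>Pairing the dilation equation with a vector J y of the range removes the projection and
  leaves an identity of moments.\<close>

lemma class_C_moments:
  fixes T :: "'n \<Rightarrow> 'h::complex_hilbert \<Rightarrow>\<^sub>L 'h"
  assumes "class_C TYPE('g::complex_hilbert) \<rho> T"
  obtains J :: "'h \<Rightarrow>\<^sub>L 'g::complex_hilbert" and V :: "'n \<Rightarrow> 'g \<Rightarrow>\<^sub>L 'g"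
  where "\<And>i. T i \<in> complex_ops" "isometric_op J" "row_isometry V"
    "\<And>\<alpha> x y. \<alpha> \<noteq> [] \<Longrightarrow>
      cinner (word_op T \<alpha> x) y = complex_of_real \<rho> * cinner (word_op V \<alpha> (J x)) (J y)"
proof -
  obtain J :: "'h \<Rightarrow>\<^sub>L 'g" and V :: "'n \<Rightarrow> 'g \<Rightarrow>\<^sub>L 'g" where T: "\<And>i. T i \<in> complex_ops"
    and J: "isometric_op J" and V: "row_isometry V"
    and dil: "\<And>\<alpha> x. \<alpha> \<noteq> [] \<Longrightarrow> J (word_op T \<alpha> x) = \<rho> *\<^sub>R orth_proj (range J) (word_op V \<alpha> (J x))"
    using assms unfolding class_C_def row_isometry_def by blast
  have "cinner (word_op T \<alpha> x) y = complex_of_real \<rho> * cinner (word_op V \<alpha> (J x)) (J y)"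
    if "\<alpha> \<noteq> []" for \<alpha> x y
  proof -
    have "cinner (word_op V \<alpha> (J x) - orth_proj (range J) (word_op V \<alpha> (J x))) (J y) = 0"
      by (intro orth_proj_orth isometric_range J rangeI)
    then have "cinner (orth_proj (range J) (word_op V \<alpha> (J x))) (J y) = cinner (word_op V \<alpha> (J x)) (J y)"
      by (simp add: cinner_diff_left)
    then show ?thesis
      using dil[OF that, of x] isometric_op_cinner[OF J, of "word_op T \<alpha> x" y]
      by (simp add: cinner_scaleR_left)
  qed
  then show thesis
    using that T J V by blast
qed

lemma bounded_linear_cadjoint:
  assumes "A \<in> complex_ops"
  shows "bounded_linear (cadjoint A)"
proof (rule bounded_linear_intro[where K = "norm A"])
  show "cadjoint A (x + y) = cadjoint A x + cadjoint A y" for x y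
    by (intro cadjoint_eqI assms) (simp add: cinner_add_right cinner_cadjoint[OF assms])
  show "cadjoint A (r *\<^sub>R x) = r *\<^sub>R cadjoint A x" for r x
    by (intro cadjoint_eqI assms) (simp add: cinner_scaleR_right cinner_cadjoint[OF assms])
  show "norm (cadjoint A x) \<le> norm x * norm A" for x
    using norm_cadjoint_le[OF assms, of x] by (simp add: mult.commute)
qed

context
  fixes T :: "'n::finite \<Rightarrow> 'h::complex_hilbert \<Rightarrow>\<^sub>L 'h" and V :: "'n \<Rightarrow> 'g::complex_hilbert \<Rightarrow>\<^sub>L 'g"
    and J :: "'h \<Rightarrow>\<^sub>L 'g" and \<rho> :: real
  assumes T: "\<And>i. T i \<in> complex_ops" and J: "isometric_op J" and V: "row_isometry V"
    and moments: "\<And>\<alpha> x y. \<alpha> \<noteq> [] \<Longrightarrow>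
      cinner (word_op T \<alpha> x) y = complex_of_real \<rho> * cinner (word_op V \<alpha> (J x)) (J y)"
begin

text \<open>\<open>compression B c\<close> is $\rho J^* B J + (1 - \rho) c I$, the form taken by a function of \<open>T\<close> when
  \<open>B\<close> and \<open>c\<close> are the same function of \<open>V\<close> and of \<open>0\<close>.\<close>

definition compression :: "('g \<Rightarrow>\<^sub>L 'g) \<Rightarrow> complex \<Rightarrow> 'h \<Rightarrow>\<^sub>L 'h" where
  "compression B c = \<rho> *\<^sub>R (Blinfun (cadjoint J) o\<^sub>L B o\<^sub>L J) + scaleC_op (complex_of_real (1 - \<rho>) * c) id_blinfun"

lemma J_complex_ops: "J \<in> complex_ops"
  using J by (simp add: isometric_op_def)

lemma cinner_compression:
  "cinner (compression B c x) y =
    complex_of_real \<rho> * cinner (B (J x)) (J y) + complex_of_real (1 - \<rho>) * (c * cinner x y)"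
proof -
  have "cinner (cadjoint J u) y = cinner u (J y)" for u
    by (metis cinner_cadjoint[OF J_complex_ops] cinner_commute)
  then show ?thesis
    by (simp add: compression_def blinfun.add_left blinfun.scaleR_left cinner_add_left
        cinner_scaleR_left cinner_scaleC_left bounded_linear_cadjoint[OF J_complex_ops]
        bounded_linear_Blinfun_apply mult.assoc)
qed

lemma tendsto_compression:
  assumes "(f \<longlongrightarrow> B) F"
  shows "((\<lambda>t. compression (f t) c) \<longlongrightarrow> compression B c) F"
  unfolding compression_def
  by (intro tendsto_add tendsto_const tendsto_scaleR
      bounded_bilinear.tendsto[OF bounded_bilinear_blinfun_compose] assms)

text \<open>A relation between \<open>A\<close>, \<open>B\<close>, \<open>c\<close> preserved under multiplication by functions of \<open>T\<close>, of
  \<open>V\<close> and of \<open>0\<close>; compressions alone are not multiplicative.\<close>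

definition compatible :: "('h \<Rightarrow>\<^sub>L 'h) \<Rightarrow> ('g \<Rightarrow>\<^sub>L 'g) \<Rightarrow> complex \<Rightarrow> bool" where
  "compatible A B c \<longleftrightarrow> A \<in> complex_ops \<and> B \<in> complex_ops \<and>
     (\<forall>\<alpha> x y. cinner (A (word_op T \<alpha> x)) y = complex_of_real \<rho> * cinner (B (word_op V \<alpha> (J x))) (J y) +
       complex_of_real (1 - \<rho>) * (if \<alpha> = [] then c * cinner x y else 0))"

lemma compatible_moments:
  assumes "compatible A B c"
  shows "cinner (A x) y = complex_of_real \<rho> * cinner (B (J x)) (J y) +
    complex_of_real (1 - \<rho>) * (c * cinner x y)"
  using assms[unfolded compatible_def, THEN conjunct2, THEN conjunct2, rule_format, of "[]" x y] by simp

lemma compatible_id: "compatible id_blinfun id_blinfun 1"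
  unfolding compatible_def
  by (auto simp: moments isometric_op_cinner[OF J] algebra_simps)

text \<open>Each monomial merges with the word on its right, since T_\<gamma> T_\<alpha> =
  T_{\<gamma>\<alpha>}, and likewise for V. The correction term survives when \<gamma>\<alpha> is
  empty, which picks out the constant coefficient.\<close>

lemma compatible_poly_eval:
  assumes "compatible A B c"
  shows "cinner (A (poly_eval a d (\<lambda>i. r *\<^sub>R T i) (word_op T \<alpha> x))) y =
    complex_of_real \<rho> * cinner (B (poly_eval a d (\<lambda>i. r *\<^sub>R V i) (word_op V \<alpha> (J x)))) (J y) +
    complex_of_real (1 - \<rho>) * (if \<alpha> = [] then c * a [] * cinner x y else 0)"
proof -
  have A: "A \<in> complex_ops" and B: "B \<in> complex_ops"
    using assms by (simp_all add: compatible_def)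
  have rel: "cinner (A (word_op T \<alpha> x)) y = complex_of_real \<rho> * cinner (B (word_op V \<alpha> (J x))) (J y) +
       complex_of_real (1 - \<rho>) * (if \<alpha> = [] then c * cinner x y else 0)" for \<alpha> x y
    using assms unfolding compatible_def by blast
  let ?S = "{\<gamma>::'n list. length \<gamma> \<le> d}"
  let ?b = "\<lambda>\<gamma>. a \<gamma> * complex_of_real (r ^ length \<gamma>)"
  have eval: "cinner (C (poly_eval a d (\<lambda>i. r *\<^sub>R X i) (word_op X \<alpha> x))) z =
      (\<Sum>\<gamma>\<in>?S. ?b \<gamma> * cinner (C (word_op X (\<gamma> @ \<alpha>) x)) z)"
    if "C \<in> complex_ops" for C :: "'b::complex_hilbert \<Rightarrow>\<^sub>L 'b" and X :: "'n \<Rightarrow> 'b \<Rightarrow>\<^sub>L 'b" and x z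
    by (simp add: poly_eval_apply blinfun.sum_right cinner_sum_left complex_ops_scaleC[OF that]
        cinner_scaleC_left word_op_scaleR blinfun.scaleR_left blinfun.scaleR_right cinner_scaleR_left
        word_op_append_apply mult.assoc)
  have "(\<Sum>\<gamma>\<in>?S. ?b \<gamma> * (complex_of_real (1 - \<rho>) * (if \<gamma> @ \<alpha> = [] then c * cinner x y else 0))) =
      (\<Sum>\<gamma>\<in>?S. if \<gamma> = [] then ?b [] * (complex_of_real (1 - \<rho>) * (if \<alpha> = [] then c * cinner x y else 0)) else 0)"
    by (intro sum.cong refl) auto
  also have "\<dots> = complex_of_real (1 - \<rho>) * (if \<alpha> = [] then c * a [] * cinner x y else 0)"
    by simp
  finally have const: "(\<Sum>\<gamma>\<in>?S. ?b \<gamma> * (complex_of_real (1 - \<rho>) * (if \<gamma> @ \<alpha> = [] then c * cinner x y else 0))) =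
      complex_of_real (1 - \<rho>) * (if \<alpha> = [] then c * a [] * cinner x y else 0)" .
  show ?thesis
    unfolding eval[OF A] eval[OF B] rel distrib_left sum.distrib const
    by (simp add: sum_distrib_left mult.left_commute)
qed

context
  fixes a :: "'n list \<Rightarrow> complex"
  assumes a: "free_holomorphic a"
begin

lemma poly_eval_compression:
  "poly_eval a d (\<lambda>i. r *\<^sub>R T i) = compression (poly_eval a d (\<lambda>i. r *\<^sub>R V i)) (a [])"
proof (intro blinfun_eqI cinner_ext)
  show "cinner (poly_eval a d (\<lambda>i. r *\<^sub>R T i) x) y =
      cinner (compression (poly_eval a d (\<lambda>i. r *\<^sub>R V i)) (a []) x) y" for x y
    using compatible_poly_eval[OF compatible_id, where \<alpha> = "[]"] by (simp add: cinner_compression)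
qed

lemma poly_eval_tendsto:
  assumes "0 \<le> r" "r < 1"
  shows "(\<lambda>d. poly_eval a d (\<lambda>i. r *\<^sub>R V i)) \<longlonglongrightarrow> free_eval a (\<lambda>i. r *\<^sub>R V i)"
  using hom_part_sums[OF a row_bounded_scaleR[OF row_isometry_row_bounded[OF V], of r]] assms
  by (simp add: poly_eval_def sums_def_le)

text \<open>For \<rho> > 1 the tuple T need not be a row contraction, so the series at r T may lie
  outside the reach of the row norm estimates. Its convergence is inherited from the series at r V,
  because compression is continuous.\<close>

lemma free_eval_compression:
  assumes "0 \<le> r" "r < 1"
  shows "(\<lambda>d. poly_eval a d (\<lambda>i. r *\<^sub>R T i)) \<longlonglongrightarrow> free_eval a (\<lambda>i. r *\<^sub>R T i)"
    and "free_eval a (\<lambda>i. r *\<^sub>R T i) = compression (free_eval a (\<lambda>i. r *\<^sub>R V i)) (a [])"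
proof -
  have lim: "(\<lambda>d. poly_eval a d (\<lambda>i. r *\<^sub>R T i)) \<longlonglongrightarrow> compression (free_eval a (\<lambda>i. r *\<^sub>R V i)) (a [])"
    unfolding poly_eval_compression by (intro tendsto_compression poly_eval_tendsto assms)
  then have "hom_part a (\<lambda>i. r *\<^sub>R T i) sums compression (free_eval a (\<lambda>i. r *\<^sub>R V i)) (a [])"
    by (simp add: poly_eval_def sums_def_le)
  then show eq: "free_eval a (\<lambda>i. r *\<^sub>R T i) = compression (free_eval a (\<lambda>i. r *\<^sub>R V i)) (a [])"
    unfolding free_eval_hom_part by (rule sums_unique[symmetric])
  show "(\<lambda>d. poly_eval a d (\<lambda>i. r *\<^sub>R T i)) \<longlonglongrightarrow> free_eval a (\<lambda>i. r *\<^sub>R T i)"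
    unfolding eq by (rule lim)
qed

lemma compatible_free_eval:
  assumes AB: "compatible A B c" and r: "0 \<le> r" "r < 1"
  shows "cinner (A (free_eval a (\<lambda>i. r *\<^sub>R T i) (word_op T \<alpha> x))) y =
    complex_of_real \<rho> * cinner (B (free_eval a (\<lambda>i. r *\<^sub>R V i) (word_op V \<alpha> (J x)))) (J y) +
    complex_of_real (1 - \<rho>) * (if \<alpha> = [] then c * a [] * cinner x y else 0)"
proof (rule LIMSEQ_unique)
  show "(\<lambda>d. cinner (A (poly_eval a d (\<lambda>i. r *\<^sub>R T i) (word_op T \<alpha> x))) y) \<longlonglongrightarrow>
      cinner (A (free_eval a (\<lambda>i. r *\<^sub>R T i) (word_op T \<alpha> x))) y"
    by (intro tendsto_cinner tendsto_const blinfun.tendsto tendsto_blinfun_apply free_eval_compression r)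
  show "(\<lambda>d. cinner (A (poly_eval a d (\<lambda>i. r *\<^sub>R T i) (word_op T \<alpha> x))) y) \<longlonglongrightarrow>
      complex_of_real \<rho> * cinner (B (free_eval a (\<lambda>i. r *\<^sub>R V i) (word_op V \<alpha> (J x)))) (J y) +
      complex_of_real (1 - \<rho>) * (if \<alpha> = [] then c * a [] * cinner x y else 0)"
    unfolding compatible_poly_eval[OF AB]
    by (intro tendsto_add tendsto_mult tendsto_const tendsto_cinner blinfun.tendsto
        tendsto_blinfun_apply poly_eval_tendsto r)
qed

context
  fixes W :: "'g \<Rightarrow>\<^sub>L 'g"
  assumes W: "((\<lambda>r::real. free_eval a (\<lambda>i. r *\<^sub>R V i)) \<longlongrightarrow> W) (at_left 1)"
begin

lemma boundary_complex_ops: "W \<in> complex_ops"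
proof (rule complex_ops_limit[OF W])
  show "\<forall>\<^sub>F r::real in at_left 1. free_eval a (\<lambda>i. r *\<^sub>R V i) \<in> complex_ops"
    using eventually_at_left_1
  proof eventually_elim
    case (elim r)
    then show ?case
      using row_bounded_scaleR[OF row_isometry_row_bounded[OF V], of r]
      by (intro free_eval_complex_ops[OF a, of r]) simp_all
  qed
qed simp

lemma free_eval_tendsto_compression:
  "((\<lambda>r::real. free_eval a (\<lambda>i. r *\<^sub>R T i)) \<longlongrightarrow> compression W (a [])) (at_left 1)"
proof (rule Lim_transform_eventually[OF tendsto_compression[OF W]])
  show "\<forall>\<^sub>F r::real in at_left 1. compression (free_eval a (\<lambda>i. r *\<^sub>R V i)) (a []) =
      free_eval a (\<lambda>i. r *\<^sub>R T i)"
    using eventually_at_left_1 by eventually_elim (simp add: free_eval_compression)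
qed

lemma compression_complex_ops: "compression W (a []) \<in> complex_ops"
  unfolding complex_ops_def
proof (intro CollectI allI cinner_ext)
  show "cinner (compression W (a []) (s *\<^sub>C x)) y = cinner (s *\<^sub>C compression W (a []) x) y" for s x y
    by (simp add: cinner_compression cinner_scaleC_left complex_ops_scaleC[OF J_complex_ops]
        complex_ops_scaleC[OF boundary_complex_ops] algebra_simps)
qed

lemma compatible_boundary:
  assumes AB: "compatible A B c"
  shows "compatible (A o\<^sub>L compression W (a [])) (B o\<^sub>L W) (c * a [])"
proof -
  have "cinner (A (compression W (a []) (word_op T \<alpha> x))) y =
    complex_of_real \<rho> * cinner (B (W (word_op V \<alpha> (J x)))) (J y) +
    complex_of_real (1 - \<rho>) * (if \<alpha> = [] then c * a [] * cinner x y else 0)" for \<alpha> x y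
  proof (rule tendsto_unique)
    show "((\<lambda>r. cinner (A (free_eval a (\<lambda>i. r *\<^sub>R T i) (word_op T \<alpha> x))) y) \<longlongrightarrow>
        cinner (A (compression W (a []) (word_op T \<alpha> x))) y) (at_left 1)"
      by (intro tendsto_cinner tendsto_const blinfun.tendsto tendsto_blinfun_apply
          free_eval_tendsto_compression)
    have "((\<lambda>r. complex_of_real \<rho> * cinner (B (free_eval a (\<lambda>i. r *\<^sub>R V i) (word_op V \<alpha> (J x)))) (J y) +
        complex_of_real (1 - \<rho>) * (if \<alpha> = [] then c * a [] * cinner x y else 0)) \<longlongrightarrow>
        complex_of_real \<rho> * cinner (B (W (word_op V \<alpha> (J x)))) (J y) +
        complex_of_real (1 - \<rho>) * (if \<alpha> = [] then c * a [] * cinner x y else 0)) (at_left 1)"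
      by (intro tendsto_add tendsto_mult tendsto_const tendsto_cinner blinfun.tendsto
          tendsto_blinfun_apply W)
    then show "((\<lambda>r. cinner (A (free_eval a (\<lambda>i. r *\<^sub>R T i) (word_op T \<alpha> x))) y) \<longlongrightarrow>
        complex_of_real \<rho> * cinner (B (W (word_op V \<alpha> (J x)))) (J y) +
        complex_of_real (1 - \<rho>) * (if \<alpha> = [] then c * a [] * cinner x y else 0)) (at_left 1)"
      by (rule Lim_transform_eventually)
        (use eventually_at_left_1 in eventually_elim, simp add: compatible_free_eval[OF AB])
  qed simp
  then show ?thesis
    using AB compression_complex_ops boundary_complex_ops
    by (simp add: compatible_def complex_ops_compose)
qed

end

end

text \<open>A new factor enters directly to the left of the arbitrary word in T, hence at the right
  end of \<beta>; this is why the induction appends letters.\<close>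

lemma compatible_words:
  fixes a :: "'m \<Rightarrow> 'n list \<Rightarrow> complex"
  assumes a: "\<And>j. free_holomorphic (a j)"
    and W: "\<And>j. ((\<lambda>r::real. free_eval (a j) (\<lambda>i. r *\<^sub>R V i)) \<longlongrightarrow> W j) (at_left 1)"
  shows "compatible (word_op (\<lambda>j. compression (W j) (a j [])) \<beta>) (word_op W \<beta>) (\<Prod>j\<leftarrow>\<beta>. a j [])"
proof (induction \<beta> rule: rev_induct)
  case Nil
  show ?case by (simp add: compatible_id)
next
  case (snoc j \<beta>)
  show ?case
    using compatible_boundary[OF a W snoc.IH] by (simp add: word_op_snoc)
qed

end

lemma word_op_scalars:
  "word_op (\<lambda>j. scaleC_op (z j) id_blinfun) \<beta> x = (\<Prod>j\<leftarrow>\<beta>. z j) *\<^sub>C (x :: 'h::complex_hilbert)"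
  by (induction \<beta>) (simp_all add: scaleC_scaleC)

theorem theorem4p1:
  fixes a :: "'m::finite \<Rightarrow> 'n::finite list \<Rightarrow> complex"
    and T :: "'n \<Rightarrow> 'h::complex_hilbert \<Rightarrow>\<^sub>L 'h"
    and \<rho> :: real
  assumes "separable_infinite_dim TYPE('k::complex_hilbert)"
    and "\<forall>j. free_holomorphic (a j)"
    and "contractive TYPE('k) a"
    and "norm (value_at_zero a) < 1"
    and "\<forall>j. boundary_in_disc_algebra (a j)"
    and "\<rho> > 0"
    and "class_C TYPE('g::complex_hilbert) \<rho> T"
  shows "class_C TYPE(('m list \<times> 'h) ell2) (rho_image \<rho> (norm (value_at_zero a)))
    (functional_calculus a T)"
proof -
  have a: "free_holomorphic (a j)" for j
    using assms(2) by blast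
  obtain J :: "'h \<Rightarrow>\<^sub>L 'g" and V :: "'n \<Rightarrow> 'g \<Rightarrow>\<^sub>L 'g" where T: "\<And>i. T i \<in> complex_ops"
    and J: "isometric_op J" and V: "row_isometry V"
    and moments: "\<And>\<alpha> x y. \<alpha> \<noteq> [] \<Longrightarrow>
      cinner (word_op T \<alpha> x) y = complex_of_real \<rho> * cinner (word_op V \<alpha> (J x)) (J y)"
    by (rule class_C_moments[OF assms(7)]) blast
  have "\<exists>W. ((\<lambda>r::real. free_eval (a j) (\<lambda>i. r *\<^sub>R V i)) \<longlongrightarrow> W) (at_left 1)" for j
    using assms(5) free_eval_boundary[OF V a] unfolding boundary_in_disc_algebra_def by blast
  then obtain W where W: "\<And>j. ((\<lambda>r::real. free_eval (a j) (\<lambda>i. r *\<^sub>R V i)) \<longlongrightarrow> W j) (at_left 1)"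
    by metis
  note ctxt = T J V moments
  define Y where "Y = (\<lambda>j. compression J \<rho> (W j) (a j []))"
  have fc: "functional_calculus a T = Y"
    unfolding functional_calculus_def Y_def
    by (intro ext tendsto_Lim free_eval_tendsto_compression[OF ctxt a W]) simp
  have Yc: "Y j \<in> complex_ops" for j
    unfolding Y_def by (rule compression_complex_ops[OF ctxt a W])
  have "row_bounded 1 W"
    unfolding row_bounded_def
  proof (intro conjI allI)
    show "W j \<in> complex_ops" for j
      by (rule boundary_complex_ops[OF ctxt a W])
    fix x :: "'m \<Rightarrow> 'g"
    \<comment> \<open>For r < 1 the tuple r V lies strictly inside the ball, where contractivity of
      f is available; the bound survives the norm limit.\<close>
    have "norm (\<Sum>j\<in>UNIV. W j (x j)) \<le> L2_set (\<lambda>j. norm (x j)) UNIV"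
    proof (rule tendsto_upperbound)
      show "((\<lambda>r::real. norm (\<Sum>j\<in>UNIV. free_eval (a j) (\<lambda>i. r *\<^sub>R V i) (x j))) \<longlongrightarrow>
          norm (\<Sum>j\<in>UNIV. W j (x j))) (at_left 1)"
        by (intro tendsto_norm tendsto_sum tendsto_blinfun_apply W)
      show "\<forall>\<^sub>F r::real in at_left 1. norm (\<Sum>j\<in>UNIV. free_eval (a j) (\<lambda>i. r *\<^sub>R V i) (x j)) \<le>
          L2_set (\<lambda>j. norm (x j)) UNIV"
        using eventually_at_left_1
      proof eventually_elim
        case (elim r)
        then show ?case
          using row_bounded_scaleR[OF row_isometry_row_bounded[OF V], of r]
          by (intro contractive_row_bounded[OF assms(1,3) a, of r]) simp_all
      qed
    qed simp
    then have "(norm (\<Sum>j\<in>UNIV. W j (x j)))\<^sup>2 \<le> (L2_set (\<lambda>j. norm (x j)) UNIV)\<^sup>2"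
      by (intro power_mono) simp_all
    then show "(norm (\<Sum>j\<in>UNIV. W j (x j)))\<^sup>2 \<le> 1\<^sup>2 * (\<Sum>j\<in>UNIV. (norm (x j))\<^sup>2)"
      by (simp add: L2_set_def sum_nonneg)
  qed
  moreover have "cinner (word_op Y \<beta> x) y = complex_of_real \<rho> * cinner (word_op W \<beta> (J x)) (J y) +
      complex_of_real (1 - \<rho>) *
        cinner (word_op (\<lambda>j. scaleC_op (value_at_zero a $ j) id_blinfun) \<beta> x) y" for \<beta> x y
  proof -
    have "compatible T V J \<rho> (word_op Y \<beta>) (word_op W \<beta>) (\<Prod>j\<leftarrow>\<beta>. a j [])"
      unfolding Y_def by (rule compatible_words[OF ctxt a W])
    from compatible_moments[where T = T and V = V and J = J, OF ctxt this] show ?thesis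
      by (simp add: word_op_scalars cinner_scaleC_left value_at_zero_def)
  qed
  ultimately show ?thesis
    unfolding fc using Yc J assms(4,6) by (intro class_C_of_moments) auto
qed

end
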